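(* Let $f(X)\in\mathbb{Z}[X]$ be a polynomial of degree $n\ge 1$, and let $\varepsilon\in(0,1/n)$. Let $S$ be a finite set of primes, let $S'\subseteq S$ be the subset of all $p\in S$ such that $f$ has a root in $\mathbb{Z}_p$, and put $s':=\#S'$. Suppose that $f$ does not have multiple roots in $\mathbb{Z}_p$ for any $p\in S'$. For real $B>0$ let $$N(f,S,\varepsilon,B):=\#\{x\in\mathbb{Z} : |x|\le B,\ 0<|f(x)|^{\varepsilon}\le [f(x)]_S\}.$$ (i) If $s'\ge 2$, then there exists a constant $C(f,S,\varepsilon)>0$ such that $$N(f,S,\varepsilon,B)\sim C(f,S,\varepsilon)\cdot B^{1-n\varepsilon}(\log B)^{s'-1}\quad\text{as } B\to\infty.$$ (ii) If $s'=1$, then $N(f,S,\varepsilon,B)\asymp_{f,S,\varepsilon} B^{1-n\varepsilon}$ as $B\to\infty$, but an exact asymptotics is not possible, i.e. the limit $\lim_{B\to\infty} N(f,S,\varepsilon,B)/B^{1-n\varepsilon}$ does not exist.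
   Context: $\mathbb{Z}_p$ is the ring of $p$-adic integers and $v_p$ the $p$-adic valuation. For a non-zero integer $y$, the $S$-part of $y$ is $[y]_S:=\prod_{p\in S}p^{v_p(y)}$. The variable $B$ ranges over the positive reals. $F(B)\asymp_{f,S,\varepsilon} G(B)$ as $B\to\infty$ means that there are constants $c_1,c_2>0$ depending only on $f,S,\varepsilon$ such that $c_1G(B)\le F(B)\le c_2G(B)$ for all sufficiently large $B$; $F(B)\sim G(B)$ means $F(B)/G(B)\to 1$. *)

theory Defs
  imports
    "HOL-Algebra.Polynomial_Divisibility"
    "HOL-Computational_Algebra.Computational_Algebra"
    "HOL-Library.Landau_Symbols"
    Complex_Main
begin

(* The inverse limit of the rings Z/p^k: a p-adic integer is the sequence of its
   residues modulo p^k, k = 0, 1, 2, ... *)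
definition padic_int_ring :: "nat \<Rightarrow> (nat \<Rightarrow> int) ring" where
  "padic_int_ring p =
     \<lparr> carrier = {x. \<forall>k. 0 \<le> x k \<and> x k < int p ^ k \<and> x (Suc k) mod int p ^ k = x k},
       mult = (\<lambda>x y k. (x k * y k) mod int p ^ k),
       one = (\<lambda>k. 1 mod int p ^ k),
       zero = (\<lambda>k. 0),
       add = (\<lambda>x y k. (x k + y k) mod int p ^ k) \<rparr>"

definition padic_of_int :: "nat \<Rightarrow> int \<Rightarrow> (nat \<Rightarrow> int)" where
  "padic_of_int p c = (\<lambda>k. c mod int p ^ k)"

(* HOL-Algebra represents a polynomial by its coefficient list, leading coefficient first. *)
definition padic_poly :: "nat \<Rightarrow> int poly \<Rightarrow> (nat \<Rightarrow> int) list" where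
  "padic_poly p f = map (padic_of_int p) (rev (Polynomial.coeffs f))"

definition has_padic_root :: "nat \<Rightarrow> int poly \<Rightarrow> bool" where
  "has_padic_root p f \<longleftrightarrow> (\<exists>a. ring.is_root (padic_int_ring p) (padic_poly p f) a)"

definition has_multiple_padic_root :: "nat \<Rightarrow> int poly \<Rightarrow> bool" where
  "has_multiple_padic_root p f \<longleftrightarrow>
     (\<exists>a\<in>carrier (padic_int_ring p). ring.alg_mult (padic_int_ring p) (padic_poly p f) a \<ge> 2)"

(* Only meaningful for y \<noteq> 0, since multiplicity p 0 = 0. *)
definition S_part :: "nat set \<Rightarrow> int \<Rightarrow> nat" where
  "S_part S y = (\<Prod>p\<in>S. p ^ multiplicity (int p) y)"

definition N_count :: "int poly \<Rightarrow> nat set \<Rightarrow> real \<Rightarrow> real \<Rightarrow> nat" where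
  "N_count f S \<epsilon> B =
     card {x::int. \<bar>real_of_int x\<bar> \<le> B
             \<and> 0 < \<bar>real_of_int (poly f x)\<bar> powr \<epsilon>
             \<and> \<bar>real_of_int (poly f x)\<bar> powr \<epsilon> \<le> real (S_part S (poly f x))}"

lemma padic_mod_mod:
  "(x mod (int p ^ Suc k)) mod int p ^ k = x mod int p ^ k"
  by (simp add: mod_mod_cancel)

lemma padic_carrier_iff:
  "x \<in> carrier (padic_int_ring p) \<longleftrightarrow>
     (\<forall>k. 0 \<le> x k \<and> x k < int p ^ k \<and> x (Suc k) mod int p ^ k = x k)"
  by (simp add: padic_int_ring_def)

lemma padic_mod_self:
  assumes "x \<in> carrier (padic_int_ring p)"
  shows "x k mod int p ^ k = x k"
  using assms by (simp add: padic_carrier_iff)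

lemma padic_mod_le:
  assumes "x \<in> carrier (padic_int_ring p)" and "k \<le> m"
  shows "x m mod int p ^ k = x k"
  using assms(2)
proof (induction m rule: dec_induct)
  case base
  show ?case by (rule padic_mod_self[OF assms(1)])
next
  case (step m)
  have "x (Suc m) mod int p ^ k = (x (Suc m) mod int p ^ m) mod int p ^ k"
    using step.hyps by (simp add: mod_mod_cancel le_imp_power_dvd)
  also have "x (Suc m) mod int p ^ m = x m"
    using assms(1) by (simp add: padic_carrier_iff)
  finally show ?case using step.IH by simp
qed

lemma padic_of_int_closed:
  assumes "p > 0"
  shows "padic_of_int p c \<in> carrier (padic_int_ring p)"
  using assms by (simp add: padic_carrier_iff padic_of_int_def mod_mod_cancel)

lemma padic_add_closed:
  assumes "p > 0" "x \<in> carrier (padic_int_ring p)" "y \<in> carrier (padic_int_ring p)"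
  shows "(\<lambda>k. (x k + y k) mod int p ^ k) \<in> carrier (padic_int_ring p)"
proof -
  have "((x (Suc k) + y (Suc k)) mod int p ^ Suc k) mod int p ^ k = (x k + y k) mod int p ^ k" for k
    unfolding padic_mod_mod
    by (subst mod_add_eq[symmetric]) (use assms in \<open>simp add: padic_carrier_iff\<close>)
  then show ?thesis using assms(1) by (simp add: padic_carrier_iff)
qed

lemma padic_mult_closed:
  assumes "p > 0" "x \<in> carrier (padic_int_ring p)" "y \<in> carrier (padic_int_ring p)"
  shows "(\<lambda>k. (x k * y k) mod int p ^ k) \<in> carrier (padic_int_ring p)"
proof -
  have "((x (Suc k) * y (Suc k)) mod int p ^ Suc k) mod int p ^ k = (x k * y k) mod int p ^ k" for k
    unfolding padic_mod_mod
    by (subst mod_mult_eq[symmetric]) (use assms in \<open>simp add: padic_carrier_iff\<close>)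
  then show ?thesis using assms(1) by (simp add: padic_carrier_iff)
qed

lemma padic_neg_closed:
  assumes "p > 0" "x \<in> carrier (padic_int_ring p)"
  shows "(\<lambda>k. (- x k) mod int p ^ k) \<in> carrier (padic_int_ring p)"
proof -
  have "((- x (Suc k)) mod int p ^ Suc k) mod int p ^ k = (- x k) mod int p ^ k" for k
    unfolding padic_mod_mod
    by (subst mod_minus_eq[symmetric]) (use assms in \<open>simp add: padic_carrier_iff\<close>)
  then show ?thesis using assms(1) by (simp add: padic_carrier_iff)
qed

lemma padic_int_ring_cring:
  assumes "p > 0"
  shows "cring (padic_int_ring p)"
proof (rule cringI)
  let ?R = "padic_int_ring p"
  show "abelian_group ?R"
  proof (rule abelian_groupI)
    fix x assume x: "x \<in> carrier ?R"
    show "\<exists>y\<in>carrier ?R. y \<oplus>\<^bsub>?R\<^esub> x = \<zero>\<^bsub>?R\<^esub>"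
      by (rule bexI[OF _ padic_neg_closed[OF assms x]])
        (simp add: padic_int_ring_def mod_add_left_eq)
  qed (use assms padic_add_closed[OF assms] padic_mod_self in
      \<open>auto simp: padic_int_ring_def mod_simps algebra_simps\<close>)
  show "Group.comm_monoid ?R"
  proof (rule comm_monoidI)
    show "\<one>\<^bsub>?R\<^esub> \<in> carrier ?R"
      using padic_of_int_closed[OF assms, of 1] by (simp add: padic_int_ring_def padic_of_int_def)
  qed (use assms padic_mult_closed[OF assms] padic_mod_self in
      \<open>auto simp: padic_int_ring_def mod_simps algebra_simps\<close>)
qed (auto simp: padic_int_ring_def mod_simps algebra_simps)

lemma padic_int_ring_domain:
  assumes "prime p"
  shows "domain (padic_int_ring p)"
proof -
  have p0: "p > 0" using assms by (simp add: prime_gt_0_nat)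
  have ip: "prime (int p)" using assms by simp
  interpret cring "padic_int_ring p" by (rule padic_int_ring_cring[OF p0])
  let ?R = "padic_int_ring p"
  show ?thesis
  proof (rule domain.intro[OF is_cring], unfold_locales)
    have "1 mod int p ^ 1 \<noteq> 0" using prime_gt_1_nat[OF assms] by (simp add: zmod_trivial_iff)
    then show "\<one>\<^bsub>?R\<^esub> \<noteq> \<zero>\<^bsub>?R\<^esub>"
      by (auto simp: padic_int_ring_def dest!: fun_cong[where x = 1])
  next
    fix x y
    assume xy: "x \<otimes>\<^bsub>?R\<^esub> y = \<zero>\<^bsub>?R\<^esub>" and x: "x \<in> carrier ?R" and y: "y \<in> carrier ?R"
    show "x = \<zero>\<^bsub>?R\<^esub> \<or> y = \<zero>\<^bsub>?R\<^esub>"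
    proof (rule ccontr)
      assume "\<not> ?thesis"
      then obtain k m where km: "x k \<noteq> 0" "y m \<noteq> 0"
        by (auto simp: padic_int_ring_def fun_eq_iff)
      have nx: "\<not> int p ^ k dvd x (k + m)" and ny: "\<not> int p ^ m dvd y (k + m)"
        using km padic_mod_le[OF x, of k "k + m"] padic_mod_le[OF y, of m "k + m"]
        by (auto simp: dvd_eq_mod_eq_0)
      have nz: "x (k + m) \<noteq> 0" "y (k + m) \<noteq> 0" using nx ny by auto
      have pnu: "\<not> is_unit (int p)" using assms prime_gt_1_nat[OF assms] by (metis ip not_prime_unit)
      have "multiplicity (int p) (x (k + m)) < k" "multiplicity (int p) (y (k + m)) < m"
        using nx ny nz pnu by (simp_all add: multiplicity_lessI)
      then have "multiplicity (int p) (x (k + m) * y (k + m)) < k + m"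
        using nz ip by (simp add: prime_elem_multiplicity_mult_distrib)
      then have "\<not> int p ^ (k + m) dvd x (k + m) * y (k + m)"
        using nz pnu by (metis multiplicity_geI mult_eq_0_iff not_less)
      then show False
        using fun_cong[OF xy, of "k + m"] by (simp add: padic_int_ring_def dvd_eq_mod_eq_0)
    qed
  qed
qed

lemma padic_of_int_eq_zero_iff:
  assumes "prime p"
  shows "padic_of_int p c = \<zero>\<^bsub>padic_int_ring p\<^esub> \<longleftrightarrow> c = 0"
proof
  assume h: "padic_of_int p c = \<zero>\<^bsub>padic_int_ring p\<^esub>"
  show "c = 0"
  proof (rule ccontr)
    assume c: "c \<noteq> 0"
    have "int p ^ k dvd c" for k
      using fun_cong[OF h, of k] by (simp add: padic_int_ring_def padic_of_int_def dvd_eq_mod_eq_0)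
    moreover have "\<not> is_unit (int p)"
      using prime_gt_1_nat[OF assms] by simp
    ultimately show False
      using c by (metis multiplicity_geI not_less_eq_eq order_refl)
  qed
qed (simp add: padic_int_ring_def padic_of_int_def)

lemma padic_poly_closed:
  assumes "prime p"
  shows "padic_poly p f \<in> carrier (poly_ring (padic_int_ring p))"
proof (cases "f = 0")
  case True
  then show ?thesis
    by (simp add: padic_poly_def univ_poly_carrier[symmetric] polynomial_def)
next
  case False
  then have ne: "Polynomial.coeffs f \<noteq> []" by simp
  have "set (padic_poly p f) \<subseteq> carrier (padic_int_ring p)"
    using padic_of_int_closed prime_gt_0_nat[OF assms] by (auto simp: padic_poly_def)
  moreover have "hd (padic_poly p f) = padic_of_int p (Polynomial.lead_coeff f)"
    using ne False by (simp add: padic_poly_def hd_map hd_rev last_coeffs_eq_coeff_degree)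
  ultimately show ?thesis
    using False
    by (simp add: univ_poly_carrier[symmetric] polynomial_def padic_of_int_eq_zero_iff[OF assms])
qed

end

theory Submission
  imports Defs "HOL-Analysis.Analysis" "HOL-Real_Asymp.Real_Asymp" "HOL-Number_Theory.Cong"
begin

text \<open>
  Since all roots in \<open>Z\<^sub>p\<close> are simple, Hensel lifting shows that the number of solutions of
  \<open>f x = 0\<close> modulo \<open>p\<^sup>k\<close> is eventually constant in \<open>k\<close>, and eventually positive exactly for
  \<open>p\<close> in \<open>S'\<close>.  By the Chinese remainder theorem the integers whose value has \<open>S\<close>-part \<open>Q\<close>
  have density \<open>a(Q) / Q\<close> with \<open>a(Q) = \<Prod> a\<^sub>p(v\<^sub>p(Q))\<close> and each \<open>a\<^sub>p\<close> eventually constant.  Put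
  \<open>\<beta> = n \<epsilon>\<close> and \<open>\<theta> = 1/\<beta>\<close>.  As \<open>\<bar>f x\<bar>\<close> behaves like \<open>\<bar>lead_coeff f\<bar> \<bar>x\<bar>\<^sup>n\<close>, the count is, with
  \<open>c = \<bar>lead_coeff f\<bar>\<^sup>\<epsilon>\<close>, asymptotic to the sum of \<open>2 a(Q)/Q min B ((Q/c)\<^sup>\<theta>)\<close> over all \<open>S\<close>-smooth \<open>Q\<close>;
  the values \<open>Q > B\<close> are negligible by Rankin's trick.  This sum equals
  \<open>(2/c) B\<^sup>1\<^sup>-\<^sup>\<beta> U(ln c + \<beta> ln B)\<close>, where \<open>U(v) = \<Sum> a(Q) g(ln Q - v)\<close> for a fixed bump \<open>g\<close> that decays
  exponentially on both sides.

  Summation over the exponent of a single prime \<open>p\<close> is a discrete convolution with step \<open>ln p\<close>.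
  The first prime of \<open>S'\<close> turns the bump into an asymptotically \<open>ln p\<close>-periodic function;
  a second prime \<open>q\<close> averages it out because \<open>ln q / ln p\<close> is irrational, which gives linear growth,
  and every further prime raises the degree of growth by one.  If \<open>S'\<close> is a single prime, \<open>U\<close> is
  bounded above and below but has no limit: \<open>y\<^sup>1\<^sup>-\<^sup>\<beta> U(\<beta> ln y)\<close> is a sum of concave functions of \<open>y\<close> whose
  kinks at \<open>y = Q\<^sup>\<theta>\<close> do not become negligible, while \<open>y\<^sup>1\<^sup>-\<^sup>\<beta>\<close> is smooth.
\<close>

section \<open>Roots in the p-adic integers\<close>

text \<open>The hypothesis \<epsilon> < 1/n enters twice. It makes \<open>1 - \<beta>\<close>
  positive, so that errors of order \<open>B powr \<eta>\<close> with small \<eta> are negligible;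
  these come from residue counts whose error is bounded uniformly in \<open>Q\<close>, together with
  the scarcity of smooth \<open>Q\<close>. It also makes \<theta> > 1, which gives the bump its
  decay as \<open>v\<close> grows. The sum \<open>U\<close> is never computed. It is controlled by
  one property, \<open>log_lipschitz\<close>, which passes with the same constant to translates, to
  sums with nonnegative coefficients and to pointwise limits, yields local boundedness, and absorbs
  the factors \<open>1 + \<delta>\<close> and \<open>1 - \<delta>\<close> by which |f(x)| misses its
  leading term. The obstacle is that no single induction over the primes works: a prime outside
  \<open>S'\<close>, the first prime of \<open>S'\<close>, the second and the later ones each need a
  different argument. Since \<open>U\<close> is indexed by sets, the order of the primes is free.
  The primes outside \<open>S'\<close> are inserted at the start, because their convolutions are
  finite sums and so preserve the decay on which asymptotic periodicity rests.\<close>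

lemma int_poly_taylor1:
  fixes f :: "int poly"
  shows "\<exists>q. poly f (x + h) = poly f x + h * poly (pderiv f) x + h\<^sup>2 * q"
proof (induction f)
  case 0
  show ?case by (intro exI[of _ 0]) simp
next
  case (pCons a f)
  then obtain q where "poly f (x + h) = poly f x + h * poly (pderiv f) x + h\<^sup>2 * q" by blast
  then have "poly (pCons a f) (x + h) = poly (pCons a f) x + h * poly (pderiv (pCons a f)) x
      + h\<^sup>2 * (poly (pderiv f) x + x * q + h * q)"
    by (simp add: pderiv_pCons algebra_simps power2_eq_square)
  then show ?case by blast
qed

lemma int_poly_dvd_cong:
  fixes f :: "int poly"
  assumes "m dvd x - y"
  shows "m dvd poly f x \<longleftrightarrow> m dvd poly f y"
proof -
  obtain h where h: "x = y + m * h" using assms by (metis dvdE diff_add_cancel add.commute)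
  obtain q where "poly f x = poly f y + m * h * poly (pderiv f) y + (m * h)\<^sup>2 * q"
    using int_poly_taylor1[of f y "m * h"] h by auto
  then have "poly f x = poly f y + m * (h * poly (pderiv f) y + h * (m * h) * q)"
    by (simp add: algebra_simps power2_eq_square)
  then show ?thesis by (simp add: dvd_add_left_iff)
qed

text \<open>Koenig's lemma on the tree of residues. Solutions of different levels need not be
  compatible, so \<open>Good\<close> keeps only the residues that lift to solutions of arbitrarily
  high level. A good residue has finitely many children, hence one of them is good again.\<close>

lemma padic_compactness:
  fixes P :: "nat \<Rightarrow> int \<Rightarrow> bool"
  assumes p: "p > 0"
    and mono: "\<And>k x. P (Suc k) x \<Longrightarrow> P k x"
    and per: "\<And>k x. P k (x mod int p ^ k) = P k x"
    and ex: "\<And>k. \<exists>x. P k x"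
  shows "\<exists>a\<in>carrier (padic_int_ring p). \<forall>k. P k (a k)"
proof -
  have mono': "P m x \<Longrightarrow> k \<le> m \<Longrightarrow> P k x" for k m x
    by (induction m rule: nat_induct) (auto simp: le_Suc_eq dest: mono)
  define Good where "Good k y \<longleftrightarrow> 0 \<le> y \<and> y < int p ^ k \<and> (\<forall>m\<ge>k. \<exists>x. P m x \<and> x mod int p ^ k = y)" for k y
  have "Good 0 0" using ex by (auto simp: Good_def)
  moreover have "\<exists>y'. Good (Suc k) y' \<and> y' mod int p ^ k = y" if G: "Good k y" for k y
  proof (rule ccontr)
    assume neg: "\<not> ?thesis"
    let ?Y = "{y'\<in>{0..<int p ^ Suc k}. y' mod int p ^ k = y}"
    have "\<forall>y'\<in>?Y. \<exists>m\<ge>Suc k. \<forall>x. P m x \<longrightarrow> x mod int p ^ Suc k \<noteq> y'"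
      using neg unfolding Good_def by auto
    then obtain M where M: "\<And>y'. y' \<in> ?Y \<Longrightarrow> M y' \<ge> Suc k \<and> (\<forall>x. P (M y') x \<longrightarrow> x mod int p ^ Suc k \<noteq> y')"
      by metis
    define m where "m = Max (insert (Suc k) (M ` ?Y))"
    have "finite ?Y" by (rule finite_subset[of _ "{0..<int p ^ Suc k}"]) auto
    then have fin: "finite (insert (Suc k) (M ` ?Y))" by blast
    have "m \<ge> k" using Max_ge[OF fin, of "Suc k"] by (simp add: m_def)
    then obtain x where x: "P m x" "x mod int p ^ k = y" using G unfolding Good_def by auto
    define y' where "y' = x mod int p ^ Suc k"
    have y': "y' \<in> ?Y" using x(2) p unfolding y'_def
      by (auto simp: padic_mod_mod simp del: power_Suc)
    then have "M y' \<le> m" using Max_ge[OF fin, of "M y'"] by (simp add: m_def)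
    then have "P (M y') x" using x(1) mono' by blast
    then show False using M[OF y'] y'_def by blast
  qed
  ultimately obtain a where a: "\<And>k. Good k (a k)" "\<And>k. a (Suc k) mod int p ^ k = a k"
    using dependent_nat_choice[of "Good" "\<lambda>k y y'. y' mod int p ^ k = y"] 
    by metis
  have "a \<in> carrier (padic_int_ring p)"
    using a by (simp add: padic_carrier_iff Good_def)
  moreover have "P k (a k)" for k
    using a(1)[of k] per unfolding Good_def by (metis order_refl)
  ultimately show ?thesis by blast
qed

lemma padic_nth:
  "(x \<oplus>\<^bsub>padic_int_ring p\<^esub> y) k = (x k + y k) mod int p ^ k"
  "(x \<otimes>\<^bsub>padic_int_ring p\<^esub> y) k = (x k * y k) mod int p ^ k"
  "\<zero>\<^bsub>padic_int_ring p\<^esub> k = 0"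
  "\<one>\<^bsub>padic_int_ring p\<^esub> k = 1 mod int p ^ k"
  by (simp_all add: padic_int_ring_def)

lemma padic_pow_nth:
  assumes "p > 0" "x \<in> carrier (padic_int_ring p)"
  shows "(x [^]\<^bsub>padic_int_ring p\<^esub> (m::nat)) k = x k ^ m mod int p ^ k"
proof -
  interpret cring "padic_int_ring p" by (rule padic_int_ring_cring[OF assms(1)])
  show ?thesis
  proof (induction m)
    case 0
    then show ?case by (simp add: padic_nth)
  next
    case (Suc m)
    have "(x [^]\<^bsub>padic_int_ring p\<^esub> (Suc m)) k = ((x [^]\<^bsub>padic_int_ring p\<^esub> m) k * x k) mod int p ^ k"
      by (simp add: padic_nth)
    then show ?case unfolding Suc.IH by (simp add: mod_mult_right_eq mult.commute)
  qed
qed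

lemma padic_eval_padic_poly:
  assumes "prime p" "x \<in> carrier (padic_int_ring p)"
  shows "ring.eval (padic_int_ring p) (padic_poly p f) x k = poly f (x k) mod int p ^ k"
proof -
  have p: "p > 0" using assms(1) by (simp add: prime_gt_0_nat)
  interpret cring "padic_int_ring p" by (rule padic_int_ring_cring[OF p])
  show ?thesis
  proof (induction f)
    case 0
    then show ?case by (simp add: padic_poly_def padic_nth)
  next
    case (pCons a f)
    have cl: "set (padic_poly p f) \<subseteq> carrier (padic_int_ring p)"
      using padic_of_int_closed p by (auto simp: padic_poly_def)
    have ca: "padic_of_int p a \<in> carrier (padic_int_ring p)" by (rule padic_of_int_closed[OF p])
    have "padic_poly p (pCons a f) = padic_poly p f @ [padic_of_int p a]"
      using pCons(1) by (auto simp: padic_poly_def cCons_def)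
    then have "eval (padic_poly p (pCons a f)) x
       = (eval (padic_poly p f) x \<otimes>\<^bsub>padic_int_ring p\<^esub> x) \<oplus>\<^bsub>padic_int_ring p\<^esub> padic_of_int p a"
      using eval_append[OF cl, of "[padic_of_int p a]" x] ca assms(2) eval_in_carrier[OF cl assms(2)]
      by simp
    then have "eval (padic_poly p (pCons a f)) x k
       = ((eval (padic_poly p f) x k * x k) mod int p ^ k + a mod int p ^ k) mod int p ^ k"
      by (simp add: padic_nth padic_of_int_def)
    also have "\<dots> = poly (pCons a f) (x k) mod int p ^ k"
      unfolding pCons(2) by (simp add: mod_simps algebra_simps)
    finally show ?case .
  qed
qed

text \<open>Meant for the cofactor of a linear factor: its coefficients are p-adic, so
  \<open>padic_eval_padic_poly\<close> says nothing about it.\<close>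

lemma padic_eval_cong:
  assumes "p > 0" "x \<in> carrier (padic_int_ring p)" "y \<in> carrier (padic_int_ring p)"
    and "x k = y k"
  shows "ring.eval (padic_int_ring p) h x k = ring.eval (padic_int_ring p) h y k"
proof -
  interpret cring "padic_int_ring p" by (rule padic_int_ring_cring[OF assms(1)])
  show ?thesis
  proof (induction h)
    case (Cons c h)
    have "(x [^]\<^bsub>padic_int_ring p\<^esub> m) k = (y [^]\<^bsub>padic_int_ring p\<^esub> m) k" for m :: nat
      using assms by (simp add: padic_pow_nth)
    then show ?case using Cons by (simp add: padic_nth)
  qed simp
qed

text \<open>The cofactor \<open>h\<close> of \<open>X - a\<close> has to vanish at \<open>a\<close>,
  and its values are read off from those of \<open>f\<close> close to \<open>a\<close>. At
  \<open>a + p ^ j\<close> the linear factor equals \<open>p ^ j\<close>, while Taylor expansion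
  makes \<open>f\<close> vanish there modulo \<open>p ^ (2 * j)\<close>. Cancelling
  \<open>p ^ j\<close> leaves \<open>h\<close> zero modulo \<open>p ^ j\<close> at that point, hence
  also at \<open>a\<close>.\<close>

lemma padic_double_zero_imp_multiple_root:
  assumes "prime p" "f \<noteq> 0" and a: "a \<in> carrier (padic_int_ring p)"
    and f0: "\<And>k. int p ^ k dvd poly f (a k)"
    and f1: "\<And>k. int p ^ k dvd poly (pderiv f) (a k)"
  shows "has_multiple_padic_root p f"
proof -
  let ?R = "padic_int_ring p"
  have p: "p > 0" using assms(1) by (simp add: prime_gt_0_nat)
  interpret domain ?R by (rule padic_int_ring_domain[OF assms(1)])
  interpret UP: domain "poly_ring ?R"
    using univ_poly_is_domain[OF carrier_is_subring] .
  let ?F = "padic_poly p f" and ?b = "[\<one>\<^bsub>?R\<^esub>, \<ominus>\<^bsub>?R\<^esub> a]"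
  have F: "?F \<in> carrier (poly_ring ?R)" by (rule padic_poly_closed[OF assms(1)])
  have F_ne: "?F \<noteq> []" using \<open>f \<noteq> 0\<close> by (simp add: padic_poly_def)
  have b: "?b \<in> carrier (poly_ring ?R)"
    using a unfolding sym[OF univ_poly_carrier] polynomial_def by simp
  have "eval ?F a = \<zero>\<^bsub>?R\<^esub>"
    using f0 by (auto simp: fun_eq_iff padic_eval_padic_poly[OF assms(1) a] padic_nth)
  then have root: "is_root ?F a" using a F_ne by (simp add: is_root_def)
  then obtain h where h: "h \<in> carrier (poly_ring ?R)" and Fh: "?F = ?b \<otimes>\<^bsub>poly_ring ?R\<^esub> h"
    using is_root_imp_pdivides[OF F root] unfolding pdivides_def by auto
  have h_ne: "h \<noteq> []"
  proof
    assume "h = []"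
    then have "h = \<zero>\<^bsub>poly_ring ?R\<^esub>" by (simp add: univ_poly_zero)
    then have "?F = \<zero>\<^bsub>poly_ring ?R\<^esub>" using Fh b by simp
    then show False using F_ne by (simp add: univ_poly_zero)
  qed
  have set_h: "set h \<subseteq> carrier ?R" using h polynomial_incl by (auto simp: sym[OF univ_poly_carrier])
  have "eval h a j = 0" for j
  proof -
    let ?c = "padic_of_int p (int p ^ j)"
    have c: "?c \<in> carrier ?R" by (rule padic_of_int_closed[OF p])
    define y where "y = a \<oplus>\<^bsub>?R\<^esub> ?c"
    have y: "y \<in> carrier ?R" using a c by (simp add: y_def)
    have yk: "y k = (a k + int p ^ j mod int p ^ k) mod int p ^ k" for k
      by (simp add: y_def padic_nth padic_of_int_def)
    have yj: "y j = a j" using padic_mod_self[OF a] by (simp add: yk)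
    have ev: "eval ?F y = eval ?b y \<otimes>\<^bsub>?R\<^esub> eval h y"
      unfolding Fh using ring_hom_memE(2)[OF eval_is_hom[OF carrier_is_subring y] b h] by simp
    have "eval ?b y = y \<oplus>\<^bsub>?R\<^esub> (\<ominus>\<^bsub>?R\<^esub> a)" using y a by simp
    also have "\<dots> = ?c" unfolding y_def using a c by algebra
    finally have eb: "eval ?b y = ?c" .
    let ?m = "2 * j"
    have "poly f (y ?m) mod int p ^ ?m = (int p ^ j mod int p ^ ?m * eval h y ?m) mod int p ^ ?m"
      using fun_cong[OF ev, of ?m] unfolding eb padic_eval_padic_poly[OF assms(1) y]
      by (simp add: padic_nth padic_of_int_def)
    then have e1: "poly f (y ?m) mod int p ^ ?m = (int p ^ j * eval h y ?m) mod int p ^ ?m"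
      by (simp add: mod_mult_left_eq)
    have "int p ^ ?m dvd y ?m - (a ?m + int p ^ j)"
      unfolding yk by (metis mod_add_right_eq mod_eq_dvd_iff mod_mod_trivial)
    then have d1: "int p ^ ?m dvd poly f (y ?m) \<longleftrightarrow> int p ^ ?m dvd poly f (a ?m + int p ^ j)"
      by (rule int_poly_dvd_cong)
    obtain q where "poly f (a ?m + int p ^ j) = poly f (a ?m) + int p ^ j * poly (pderiv f) (a ?m) + (int p ^ j)\<^sup>2 * q"
      using int_poly_taylor1 by blast
    moreover have "int p ^ ?m dvd (int p ^ j)\<^sup>2" by (simp add: power_mult[symmetric] mult.commute)
    ultimately have "int p ^ ?m dvd poly f (a ?m + int p ^ j)"
      using f0[of ?m] f1[of ?m] by (simp add: dvd_add dvd_mult)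
    then have "int p ^ ?m dvd int p ^ j * eval h y ?m" using d1 e1 by (simp add: dvd_eq_mod_eq_0)
    then have "int p ^ j * int p ^ j dvd int p ^ j * eval h y ?m" by (simp add: mult_2 power_add)
    then have "int p ^ j dvd eval h y ?m" using p by simp
    moreover have hy: "eval h y \<in> carrier ?R" using eval_in_carrier[OF set_h y] .
    ultimately have "eval h y j = 0" using padic_mod_le[OF hy, of j ?m] by (simp add: dvd_eq_mod_eq_0)
    then show ?thesis using padic_eval_cong[OF p y a yj, of h] by simp
  qed
  then have "eval h a = \<zero>\<^bsub>?R\<^esub>" by (auto simp: padic_nth)
  then have "is_root h a" using a h_ne by (simp add: is_root_def)
  then obtain g where g: "g \<in> carrier (poly_ring ?R)" and hg: "h = ?b \<otimes>\<^bsub>poly_ring ?R\<^esub> g"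
    using is_root_imp_pdivides[OF h] unfolding pdivides_def by auto
  have "?F = (?b [^]\<^bsub>poly_ring ?R\<^esub> (2::nat)) \<otimes>\<^bsub>poly_ring ?R\<^esub> g"
    unfolding Fh hg using b g by (simp add: numeral_2_eq_2 UP.m_assoc)
  then have "(?b [^]\<^bsub>poly_ring ?R\<^esub> (2::nat)) pdivides\<^bsub>?R\<^esub> ?F"
    unfolding pdivides_def using g by auto
  then have "2 \<le> alg_mult ?F a" by (rule alg_multE(2)[OF a F F_ne])
  then show ?thesis unfolding has_multiple_padic_root_def using a by blast
qed

lemma has_padic_root_iff:
  assumes "prime p" "f \<noteq> 0"
  shows "has_padic_root p f \<longleftrightarrow> (\<forall>k. \<exists>x. int p ^ k dvd poly f x)"
proof -
  have p: "p > 0" using assms(1) by (simp add: prime_gt_0_nat)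
  interpret domain "padic_int_ring p" by (rule padic_int_ring_domain[OF assms(1)])
  have F_ne: "padic_poly p f \<noteq> []" using \<open>f \<noteq> 0\<close> by (simp add: padic_poly_def)
  have rt: "is_root (padic_poly p f) a \<longleftrightarrow> (\<forall>k. int p ^ k dvd poly f (a k))"
    if "a \<in> carrier (padic_int_ring p)" for a
    using that F_ne unfolding is_root_def
    by (auto simp: fun_eq_iff padic_eval_padic_poly[OF assms(1)] padic_nth)
  show ?thesis
  proof
    assume "has_padic_root p f"
    then show "\<forall>k. \<exists>x. int p ^ k dvd poly f x"
      using rt unfolding has_padic_root_def is_root_def by blast
  next
    assume ex: "\<forall>k. \<exists>x. int p ^ k dvd poly f x"
    have "\<exists>a\<in>carrier (padic_int_ring p). \<forall>k. int p ^ k dvd poly f (a k)"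
    proof (rule padic_compactness[OF p, of "\<lambda>k x. int p ^ k dvd poly f x"])
      show "int p ^ k dvd poly f (x mod int p ^ k) \<longleftrightarrow> int p ^ k dvd poly f x" for k x
        by (rule int_poly_dvd_cong) (metis mod_eq_dvd_iff mod_mod_trivial)
    qed (use ex in \<open>auto elim: dvd_trans[rotated] simp: le_imp_power_dvd\<close>)
    then show "has_padic_root p f" using rt unfolding has_padic_root_def by blast
  qed
qed

text \<open>The uniform bound on the valuation of the derivative at approximate roots that Hensel
  lifting requires. It is a compactness statement: common approximate zeros of \<open>f\<close> and
  its derivative of every order would produce a double root.\<close>

lemma no_multiple_root_bound:
  assumes "prime p" "f \<noteq> 0" "\<not> has_multiple_padic_root p f"
  shows "\<exists>J. \<forall>x. \<not> (int p ^ J dvd poly f x \<and> int p ^ J dvd poly (pderiv f) x)"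
proof (rule ccontr)
  have p: "p > 0" using assms(1) by (simp add: prime_gt_0_nat)
  assume "\<not> ?thesis"
  then have ex: "\<forall>J. \<exists>x. int p ^ J dvd poly f x \<and> int p ^ J dvd poly (pderiv f) x" by simp
  have "\<exists>a\<in>carrier (padic_int_ring p). \<forall>k. int p ^ k dvd poly f (a k) \<and> int p ^ k dvd poly (pderiv f) (a k)"
  proof (rule padic_compactness[OF p])
    fix k x
    have "int p ^ k dvd x mod int p ^ k - x" by (metis mod_eq_dvd_iff mod_mod_trivial)
    then show "(int p ^ k dvd poly f (x mod int p ^ k) \<and> int p ^ k dvd poly (pderiv f) (x mod int p ^ k)) =
           (int p ^ k dvd poly f x \<and> int p ^ k dvd poly (pderiv f) x)"
      using int_poly_dvd_cong by blast
  qed (use ex in \<open>auto elim: dvd_trans[rotated] simp: le_imp_power_dvd\<close>)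
  then show False using padic_double_zero_imp_multiple_root[OF assms(1,2)] assms(3) by blast
qed

section \<open>Counting residues and Hensel lifting\<close>

definition root_count :: "int poly \<Rightarrow> nat \<Rightarrow> nat" where
  "root_count f m = card {x\<in>{0..<int m}. int m dvd poly f x}"

lemma dvd_diff_mod_int: "(m::int) dvd x mod m - x"
  by (metis mod_eq_dvd_iff mod_mod_trivial)

lemma dvd_diff_shift:
  fixes x y c :: int
  assumes "n dvd x - (y + c)" "n dvd c"
  shows "n dvd x - y"
  using dvd_add[OF assms] by simp

section \<open>Counting solutions of periodic conditions\<close>

lemma card_periodic_mult:
  fixes m n :: nat
  assumes m: "m > 0" and per: "\<And>x. P (x mod int m) = P x"
  shows "card {x\<in>{0..<int (m * n)}. P x} = n * card {x\<in>{0..<int m}. P x}"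
proof -
  let ?A = "{x\<in>{0..<int m}. P x}"
  have "bij_betw (\<lambda>(x, j). x + int m * j) (?A \<times> {0..<int n}) {x\<in>{0..<int (m * n)}. P x}"
  proof (rule bij_betw_byWitness[where f' = "\<lambda>y. (y mod int m, y div int m)"])
    show "(\<lambda>(x, j). x + int m * j) ` (?A \<times> {0..<int n}) \<subseteq> {x\<in>{0..<int (m * n)}. P x}"
    proof clarsimp
      fix a b assume ab: "0 \<le> a" "a < int m" "P a" "0 \<le> b" "b < int n"
      have "int m * (b + 1) \<le> int m * int n" using ab by (intro mult_left_mono) auto
      moreover have "P (a + int m * b)" using per[of "a + int m * b"] ab by simp
      ultimately show "a + int m * b < int m * int n \<and> P (a + int m * b)"
        using ab by (simp add: algebra_simps)
    qed
    show "(\<lambda>y. (y mod int m, y div int m)) ` {x\<in>{0..<int (m * n)}. P x} \<subseteq> ?A \<times> {0..<int n}"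
    proof (clarsimp simp: per m)
      fix x assume x: "0 \<le> x" "x < int m * int n" 
      have "x = int m * (x div int m) + x mod int m" by simp
      then have "int m * (x div int m) < int m * int n"
        using x m by (smt (verit) pos_mod_sign of_nat_0_less_iff)
      then show "0 \<le> x div int m \<and> x div int m < int n"
        using m x by (simp add: pos_imp_zdiv_nonneg_iff)
    qed
  qed (use m in auto)
  then have "card (?A \<times> {0..<int n}) = card {x\<in>{0..<int (m * n)}. P x}" by (rule bij_betw_same_card)
  then show ?thesis by (simp add: card_cartesian_product mult.commute)
qed

lemma card_periodic_coprime:
  fixes m n :: nat
  assumes "m > 0" "n > 0" "coprime m n"
    and P: "\<And>x. P (x mod int m) = P x" and Q: "\<And>x. Q (x mod int n) = Q x"
  shows "card {x\<in>{0..<int (m * n)}. P x \<and> Q x} =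
         card {x\<in>{0..<int m}. P x} * card {x\<in>{0..<int n}. Q x}"
proof -
  have "bij_betw (\<lambda>x. (x mod int m, x mod int n)) {x\<in>{0..<int (m * n)}. P x \<and> Q x}
     ({x\<in>{0..<int m}. P x} \<times> {x\<in>{0..<int n}. Q x})"
  proof (rule bij_betw_imageI)
    show "inj_on (\<lambda>x. (x mod int m, x mod int n)) {x\<in>{0..<int (m * n)}. P x \<and> Q x}"
    proof (rule inj_onI)
      fix x y assume xy: "x \<in> {x\<in>{0..<int (m * n)}. P x \<and> Q x}" "y \<in> {x\<in>{0..<int (m * n)}. P x \<and> Q x}"
        "(x mod int m, x mod int n) = (y mod int m, y mod int n)"
      then have "int m dvd x - y" "int n dvd x - y" by (auto simp: mod_eq_dvd_iff)
      then have "int m * int n dvd x - y"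
        using assms(3) by (intro divides_mult) auto
      then have "x mod (int m * int n) = y mod (int m * int n)" by (simp add: mod_eq_dvd_iff)
      then show "x = y" using xy by simp
    qed
    show "(\<lambda>x. (x mod int m, x mod int n)) ` {x\<in>{0..<int (m * n)}. P x \<and> Q x} =
       {x\<in>{0..<int m}. P x} \<times> {x\<in>{0..<int n}. Q x}"
    proof (intro equalityI subsetI)
      fix z assume "z \<in> (\<lambda>x. (x mod int m, x mod int n)) ` {x\<in>{0..<int (m * n)}. P x \<and> Q x}"
      then show "z \<in> {x\<in>{0..<int m}. P x} \<times> {x\<in>{0..<int n}. Q x}"
        using assms by auto
    next
      fix z assume "z \<in> {x\<in>{0..<int m}. P x} \<times> {x\<in>{0..<int n}. Q x}"
      then obtain a b where z: "z = (a, b)" "0 \<le> a" "a < int m" "P a" "0 \<le> b" "b < int n" "Q b" by auto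
      obtain x where x: "[x = nat a] (mod m)" "[x = nat b] (mod n)"
        using binary_chinese_remainder_nat[OF assms(3)] by blast
      define y where "y = int x mod int (m * n)"
      have xa: "int x mod int m = a" "int x mod int n = b"
        using x z by (simp_all add: cong_def zmod_int[symmetric])
      have ya: "y mod int m = a" "y mod int n = b"
        using xa by (simp_all add: y_def mod_mod_cancel)
      have "y \<in> {0..<int (m * n)}" using assms by (simp add: y_def)
      moreover have "P y" "Q y" using P[of y] Q[of y] ya z by auto
      ultimately show "z \<in> (\<lambda>x. (x mod int m, x mod int n)) ` {x\<in>{0..<int (m * n)}. P x \<and> Q x}"
        using ya z by (intro image_eqI[of _ _ y]) auto
    qed
  qed
  then have "card {x\<in>{0..<int (m * n)}. P x \<and> Q x} = card ({x\<in>{0..<int m}. P x} \<times> {x\<in>{0..<int n}. Q x})"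
    by (rule bij_betw_same_card)
  then show ?thesis by (simp only: card_cartesian_product)
qed

lemma card_periodic_prod:
  fixes m :: "'a \<Rightarrow> nat"
  assumes "finite S" "\<And>p. p \<in> S \<Longrightarrow> m p > 0"
    and "\<And>p q. p \<in> S \<Longrightarrow> q \<in> S \<Longrightarrow> p \<noteq> q \<Longrightarrow> coprime (m p) (m q)"
    and "\<And>p x. p \<in> S \<Longrightarrow> P p (x mod int (m p)) = P p x"
  shows "card {x\<in>{0..<int (\<Prod>p\<in>S. m p)}. \<forall>p\<in>S. P p x} = (\<Prod>p\<in>S. card {x\<in>{0..<int (m p)}. P p x})"
  using assms
proof (induction S rule: finite_induct)
  case empty
  have "{x::int. 0 \<le> x \<and> x < 1} = {0}" by auto
  then show ?case by simp
next
  case (insert a S)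
  have cop: "coprime (m a) (\<Prod>p\<in>S. m p)"
    by (rule prod_coprime_right) (metis insert.hyps(2) insert.prems(2) insertCI)
  have per: "(\<forall>p\<in>S. P p (x mod int (\<Prod>p\<in>S. m p))) = (\<forall>p\<in>S. P p x)" for x
  proof -
    have "P p (x mod int (\<Prod>p\<in>S. m p)) = P p x" if "p \<in> S" for p
    proof -
      have "m p dvd (\<Prod>p\<in>S. m p)" using insert that by (simp add: dvd_prodI)
      then have "x mod int (\<Prod>p\<in>S. m p) mod int (m p) = x mod int (m p)"
        by (intro mod_mod_cancel) (simp only: of_nat_dvd_iff)
      then show ?thesis using insert.prems(3)[of p] that by (metis insertCI)
    qed
    then show ?thesis by blast
  qed
  have "card {x\<in>{0..<int (m a * (\<Prod>p\<in>S. m p))}. P a x \<and> (\<forall>p\<in>S. P p x)} =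
        card {x\<in>{0..<int (m a)}. P a x} * card {x\<in>{0..<int (\<Prod>p\<in>S. m p)}. \<forall>p\<in>S. P p x}"
    by (rule card_periodic_coprime) (use insert.prems(1,3) cop per in \<open>auto intro!: prod_pos\<close>)
  also have "card {x\<in>{0..<int (\<Prod>p\<in>S. m p)}. \<forall>p\<in>S. P p x} = (\<Prod>p\<in>S. card {x\<in>{0..<int (m p)}. P p x})"
    by (rule insert.IH) (use insert.prems in blast)+
  finally show ?case using insert.hyps by simp
qed

lemma card_residue_interval:
  fixes m :: nat and Y :: real
  assumes "m > 0" "Y \<ge> 0"
  shows "finite {x::int. \<bar>real_of_int x\<bar> \<le> Y \<and> x mod int m = a}"
    and "0 \<le> a \<Longrightarrow> a < int m \<Longrightarrow>
      \<bar>real (card {x::int. \<bar>real_of_int x\<bar> \<le> Y \<and> x mod int m = a}) - 2 * Y / real m\<bar> \<le> 1"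
proof -
  have "{x::int. \<bar>real_of_int x\<bar> \<le> Y} \<subseteq> {- \<lceil>Y\<rceil>..\<lceil>Y\<rceil>}" by (auto; linarith)
  then have "finite {x::int. \<bar>real_of_int x\<bar> \<le> Y}" using finite_subset by blast
  then show "finite {x::int. \<bar>real_of_int x\<bar> \<le> Y \<and> x mod int m = a}" by simp
  assume a: "0 \<le> a" "a < int m"
  define l u where "l = (- Y - a) / real m" and "u = (Y - a) / real m"
  have m: "real m > 0" using assms by simp
  have "bij_betw (\<lambda>j. a + int m * j) {\<lceil>l\<rceil>..\<lfloor>u\<rfloor>} {x::int. \<bar>real_of_int x\<bar> \<le> Y \<and> x mod int m = a}"
  proof (rule bij_betw_byWitness[where f' = "\<lambda>x. x div int m"])
    show "\<forall>j\<in>{\<lceil>l\<rceil>..\<lfloor>u\<rfloor>}. (a + int m * j) div int m = j" using assms a by simp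
    show "\<forall>x\<in>{x. \<bar>real_of_int x\<bar> \<le> Y \<and> x mod int m = a}. a + int m * (x div int m) = x"
      by (auto simp: algebra_simps)
    show "(\<lambda>j. a + int m * j) ` {\<lceil>l\<rceil>..\<lfloor>u\<rfloor>} \<subseteq> {x. \<bar>real_of_int x\<bar> \<le> Y \<and> x mod int m = a}"
    proof clarsimp
      fix j assume "\<lceil>l\<rceil> \<le> j" "j \<le> \<lfloor>u\<rfloor>"
      then have "l \<le> j" "j \<le> u" by linarith+
      then have "- Y - a \<le> j * m" "j * m \<le> Y - a" using m by (simp_all add: l_def u_def field_simps)
      then show "\<bar>real_of_int a + real m * real_of_int j\<bar> \<le> Y \<and> a mod int m = a"
        using a by (auto simp: algebra_simps abs_le_iff)
    qed
    show "(\<lambda>x. x div int m) ` {x. \<bar>real_of_int x\<bar> \<le> Y \<and> x mod int m = a} \<subseteq> {\<lceil>l\<rceil>..\<lfloor>u\<rfloor>}"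
    proof clarsimp
      fix x assume x: "\<bar>real_of_int x\<bar> \<le> Y" "a = x mod int m"
      have "x = (x div int m) * int m + a" using x by simp
      then have "real_of_int x = real_of_int (x div int m) * real m + real_of_int a"
        by (metis of_int_add of_int_mult of_int_of_nat_eq)
      then have "- Y - a \<le> real_of_int (x div int m) * m" "real_of_int (x div int m) * m \<le> Y - a"
        using x(1) by (auto simp: abs_le_iff)
      then have "l \<le> real_of_int (x div int m)" "real_of_int (x div int m) \<le> u"
        using m by (simp_all add: l_def u_def field_simps)
      then show "\<lceil>l\<rceil> \<le> x div int m \<and> x div int m \<le> \<lfloor>u\<rfloor>" by (simp add: le_floor_iff ceiling_le_iff)
    qed
  qed
  then have c: "card {x::int. \<bar>real_of_int x\<bar> \<le> Y \<and> x mod int m = a} = nat (\<lfloor>u\<rfloor> - \<lceil>l\<rceil> + 1)"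
    by (simp add: bij_betw_same_card[symmetric])
  have ul: "u - l = 2 * Y / real m" using m by (simp add: l_def u_def field_simps)
  then have "u - l \<ge> 0" using assms by simp
  then have "\<lfloor>u\<rfloor> - \<lceil>l\<rceil> + 1 \<ge> 0" by linarith
  then have "real (nat (\<lfloor>u\<rfloor> - \<lceil>l\<rceil> + 1)) = real_of_int (\<lfloor>u\<rfloor> - \<lceil>l\<rceil> + 1)" by simp
  then show "\<bar>real (card {x::int. \<bar>real_of_int x\<bar> \<le> Y \<and> x mod int m = a}) - 2 * Y / real m\<bar> \<le> 1"
    unfolding c ul[symmetric] by linarith
qed

text \<open>The error is the number of admissible residue classes and not the modulus. This is what
  keeps the error in \<open>level_count\<close> bounded as \<open>Q\<close> grows.\<close>

lemma card_periodic_interval: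
  fixes m :: nat and Y :: real
  assumes "m > 0" "Y \<ge> 0" and per: "\<And>x. P (x mod int m) = P x"
  shows "\<bar>real (card {x::int. \<bar>real_of_int x\<bar> \<le> Y \<and> P x}) - 2 * Y * real (card {x\<in>{0..<int m}. P x}) / real m\<bar>
      \<le> real (card {x\<in>{0..<int m}. P x})"
proof -
  let ?A = "{x\<in>{0..<int m}. P x}" and ?B = "\<lambda>a. {x::int. \<bar>real_of_int x\<bar> \<le> Y \<and> x mod int m = a}"
  have "finite ?A" by (rule finite_subset[of _ "{0..<int m}"]) auto
  have "{x::int. \<bar>real_of_int x\<bar> \<le> Y \<and> P x} = (\<Union>a\<in>?A. ?B a)"
  proof (intro equalityI subsetI)
    fix x assume "x \<in> {x::int. \<bar>real_of_int x\<bar> \<le> Y \<and> P x}"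
    then have "x mod int m \<in> ?A" "x \<in> ?B (x mod int m)" using assms by auto
    then show "x \<in> (\<Union>a\<in>?A. ?B a)" by blast
  next
    fix x assume "x \<in> (\<Union>a\<in>?A. ?B a)"
    then show "x \<in> {x::int. \<bar>real_of_int x\<bar> \<le> Y \<and> P x}" using per by auto
  qed
  also have "card \<dots> = (\<Sum>a\<in>?A. card (?B a))"
    by (rule card_UN_disjoint) (use card_residue_interval(1)[OF assms(1,2)] \<open>finite ?A\<close> in auto)
  finally have "real (card {x::int. \<bar>real_of_int x\<bar> \<le> Y \<and> P x}) - 2 * Y * real (card ?A) / real m
      = (\<Sum>a\<in>?A. real (card (?B a)) - 2 * Y / real m)"
    by (simp add: sum_subtractf)
  also have "\<bar>\<dots>\<bar> \<le> (\<Sum>a\<in>?A. \<bar>real (card (?B a)) - 2 * Y / real m\<bar>)" by (rule sum_abs)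
  also have "\<dots> \<le> (\<Sum>a\<in>?A. 1)"
    by (rule sum_mono) (use card_residue_interval(2)[OF assms(1,2)] in auto)
  finally show ?thesis by simp
qed

section \<open>Stabilization of the root counts modulo prime powers\<close>

lemma multiplicity_shift:
  fixes g :: "int poly"
  assumes "prime q" "multiplicity q (poly g x) = v" "poly g x \<noteq> 0" "q ^ Suc v dvd z - x"
  shows "multiplicity q (poly g z) = v" "poly g z \<noteq> 0"
proof -
  have nd: "\<not> q ^ Suc v dvd poly g x"
    using assms by (metis multiplicity_geI not_prime_unit not_less_eq_eq order_refl)
  then have nd': "\<not> q ^ Suc v dvd poly g z" using int_poly_dvd_cong[OF assms(4)] by blast
  have "q ^ v dvd z - x" using assms(4) power_le_dvd by (metis le_SucI order_refl)
  moreover have "q ^ v dvd poly g x" using assms(2) multiplicity_dvd by blast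
  ultimately have "q ^ v dvd poly g z" using int_poly_dvd_cong by blast
  then show "multiplicity q (poly g z) = v" using nd' by (rule multiplicity_eqI)
  show "poly g z \<noteq> 0" using nd' by auto
qed

text \<open>Hensel lifting as a bijection: every solution modulo \<open>p\<^sup>k\<close>, viewed modulo \<open>p\<^sup>k\<^sup>+\<^sup>1\<close>,
  is a unique translate by a multiple of \<open>p\<^sup>k\<^sup>-\<^sup>v\<close> of a solution modulo \<open>p\<^sup>k\<^sup>+\<^sup>1\<close>, where \<open>v\<close>
  is the valuation of the derivative, which the translation preserves.\<close>

lemma root_count_step:
  assumes "prime p" and J: "\<And>x. \<not> (int p ^ J dvd poly f x \<and> int p ^ J dvd poly (pderiv f) x)"
    and k: "k \<ge> 2 * J + 1"
  shows "root_count f (p ^ Suc k) = root_count f (p ^ k)"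
proof -
  let ?q = "int p"
  define f' where "f' = pderiv f"
  have q: "prime ?q" using assms(1) by simp
  have p0: "p > 0" using assms(1) prime_gt_0_nat by simp
  define v where "v x = multiplicity ?q (poly f' x)" for x
  define A where "A = {x\<in>{0..<?q ^ Suc k}. ?q ^ k dvd poly f x}"
  define R where "R = {x\<in>{0..<?q ^ Suc k}. ?q ^ Suc k dvd poly f x}"
  \<comment> \<open>Translating \<open>y\<close> by \<open>t * p ^ (k - v y)\<close> adds
    \<open>t * u * p ^ k\<close> to the value of \<open>f\<close> modulo \<open>p ^ Suc k\<close>,
    with \<open>u\<close> prime to \<open>p\<close>. So for each solution modulo
    \<open>p ^ k\<close> exactly one digit \<open>t\<close> accounts for the obstruction to being a
    solution modulo \<open>p ^ Suc k\<close>.\<close>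
  define \<phi> where "\<phi> = (\<lambda>(y, t). (y + t * ?q ^ (k - v y)) mod ?q ^ Suc k)"
  have vJ: "v x < J" "poly f' x \<noteq> 0" if "?q ^ k dvd poly f x" for x
  proof -
    have "?q ^ J dvd poly f x" using that power_le_dvd k by (metis add_leE le_add2 mult_2 order_trans)
    then have nd: "\<not> ?q ^ J dvd poly f' x" using J f'_def by blast
    then show "poly f' x \<noteq> 0" by auto
    then show "v x < J" unfolding v_def using nd by (metis linorder_not_less multiplicity_dvd')
  qed
  have vshift: "v z = v x" if "?q ^ k dvd poly f x" "?q ^ (k - v x) dvd z - x" for x z
  proof -
    have "?q ^ Suc (v x) dvd z - x" using that(2) vJ[OF that(1)] k 
      by (intro power_le_dvd[OF that(2)]) auto
    then show ?thesis using multiplicity_shift(1)[OF q _ vJ(2)[OF that(1)], of "v x" z] by (simp add: v_def)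
  qed
  \<comment> \<open>The first-order expansion is exact modulo \<open>p ^ Suc k\<close>: from
    \<open>v x < J\<close> and \<open>k \<ge> 2 * J + 1\<close> follows
    \<open>2 * (k - v x) \<ge> Suc k\<close>, which kills the quadratic term.\<close>
  have expand: "?q ^ Suc k dvd poly f z - (poly f x + t * ?q ^ (k - v x) * poly f' x)"
    if x: "?q ^ k dvd poly f x" and z: "?q ^ Suc k dvd z - (x + t * ?q ^ (k - v x))" for x z t
  proof -
    obtain s where s: "z = x + (t * ?q ^ (k - v x) + ?q ^ Suc k * s)"
      using z by (metis add.assoc add_diff_cancel_left' dvdE diff_add_cancel add.commute)
    define e where "e = k - v x"
    have e: "k - v x = e" "2 * e \<ge> Suc k" "Suc k \<ge> e" using vJ[OF x] k by (auto simp: e_def)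
    have q2: "?q ^ Suc k dvd (?q ^ e)\<^sup>2"
      unfolding power_mult[symmetric] by (rule le_imp_power_dvd) (use e in linarith)
    obtain w where w: "?q ^ Suc k = ?q ^ e * w" using e(3) by (metis dvdE le_imp_power_dvd)
    obtain r where r: "poly f z = poly f x + (t * ?q ^ e + ?q ^ Suc k * s) * poly f' x
        + (t * ?q ^ e + ?q ^ Suc k * s)\<^sup>2 * r"
      using int_poly_taylor1[of f x] unfolding s e f'_def by blast
    have "(t * ?q ^ e + ?q ^ Suc k * s) = ?q ^ e * (t + w * s)" unfolding w by (simp add: algebra_simps)
    then have "(t * ?q ^ e + ?q ^ Suc k * s)\<^sup>2 * r = (?q ^ e)\<^sup>2 * ((t + w * s)\<^sup>2 * r)" by (simp add: power_mult_distrib)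
    then have "?q ^ Suc k dvd (t * ?q ^ e + ?q ^ Suc k * s)\<^sup>2 * r" using q2 by (metis dvd_mult2)
    then have "?q ^ Suc k dvd ?q ^ Suc k * (s * poly f' x) + (t * ?q ^ e + ?q ^ Suc k * s)\<^sup>2 * r"
      by (intro dvd_add) auto
    then show ?thesis unfolding r e by (simp add: algebra_simps)
  qed
  have unit: "\<exists>u. poly f' x = ?q ^ v x * u \<and> \<not> ?q dvd u" if "?q ^ k dvd poly f x" for x
    using multiplicity_decompose'[of "poly f' x" ?q] vJ(2)[OF that] q 
    by (metis not_prime_unit v_def)
  have qk: "?q ^ (k - v x) * (?q ^ v x * u) = ?q ^ k * u" if "?q ^ k dvd poly f x" for x u
    using vJ(1)[OF that] k by (simp add: mult.assoc[symmetric] power_add[symmetric])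
  have RA: "?q ^ k dvd poly f x" if "x \<in> R" for x
    using that by (auto simp: R_def intro: dvd_trans[OF le_imp_power_dvd[of k "Suc k"]])
  have "bij_betw \<phi> (R \<times> {0..<?q}) A"
  proof (rule bij_betw_imageI)
    show "inj_on \<phi> (R \<times> {0..<?q})"
    proof (rule inj_onI, clarify)
      fix y1 t1 y2 t2 assume R: "y1 \<in> R" "y2 \<in> R" and t: "t1 \<in> {0..<?q}" "t2 \<in> {0..<?q}"
        and eq: "\<phi> (y1, t1) = \<phi> (y2, t2)"
      define z where "z = \<phi> (y1, t1)"
      have d1: "?q ^ Suc k dvd z - (y1 + t1 * ?q ^ (k - v y1))" unfolding z_def \<phi>_def prod.case by (rule dvd_diff_mod_int)
      have d2: "?q ^ Suc k dvd z - (y2 + t2 * ?q ^ (k - v y2))" unfolding z_def eq unfolding \<phi>_def prod.case by (rule dvd_diff_mod_int)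
      \<comment> \<open>The common image \<open>z\<close> is close enough to both preimages for the
        derivative to have the same valuation at all three points, so both translations use the same
        step.\<close>
      have dz: "?q ^ (k - v y) dvd z - y" if dvd: "?q ^ Suc k dvd z - (y + t * ?q ^ (k - v y))" for y t
      proof -
        have "?q ^ (k - v y) dvd z - (y + t * ?q ^ (k - v y))"
          by (rule power_le_dvd[OF dvd]) auto
        then show ?thesis by (rule dvd_diff_shift) simp
      qed
      have v1: "v z = v y1" using vshift[OF RA[OF R(1)] dz[OF d1]] .
      have v2: "v z = v y2" using vshift[OF RA[OF R(2)] dz[OF d2]] .
      have vv: "v y2 = v y1" using v1 v2 by simp
      have "?q ^ Suc k dvd (z - (y1 + t1 * ?q ^ (k - v y1))) - (z - (y2 + t2 * ?q ^ (k - v y2)))"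
        using d1 d2 by (rule dvd_diff)
      then have d3: "?q ^ Suc k dvd y2 - (y1 + (t1 - t2) * ?q ^ (k - v y1))"
        unfolding vv by (simp add: algebra_simps)
      obtain u where u: "poly f' y1 = ?q ^ v y1 * u" "\<not> ?q dvd u" using unit[OF RA[OF R(1)]] by blast
      have "?q ^ Suc k dvd poly f y2 - (poly f y1 + (t1 - t2) * ?q ^ (k - v y1) * poly f' y1)"
        by (rule expand[OF RA[OF R(1)] d3])
      moreover have "(t1 - t2) * ?q ^ (k - v y1) * poly f' y1 = ?q ^ k * ((t1 - t2) * u)"
        unfolding u by (simp only: mult.assoc qk[OF RA[OF R(1)]]) (rule mult.left_commute)
      ultimately have e: "?q ^ Suc k dvd poly f y2 - (poly f y1 + ?q ^ k * ((t1 - t2) * u))" by simp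
      have "?q ^ Suc k dvd poly f y2 - poly f y1 - (poly f y2 - (poly f y1 + ?q ^ k * ((t1 - t2) * u)))"
        by (rule dvd_diff[OF dvd_diff e]) (use R in \<open>simp_all add: R_def del: power_Suc\<close>)
      then have "?q ^ k * ?q dvd ?q ^ k * ((t1 - t2) * u)" by (simp add: mult.commute)
      then have "?q dvd (t1 - t2) * u" using p0 by simp
      then have "?q dvd t1 - t2" using u(2) q prime_dvd_mult_iff by blast
      then have tt: "t1 = t2" using t by (metis atLeastLessThan_iff mod_eq_dvd_iff mod_pos_pos_trivial)
      then have "?q ^ Suc k dvd y2 - y1" using d3 by simp
      then have "y1 = y2" using R unfolding R_def
        by (metis (mono_tags, lifting) atLeastLessThan_iff mem_Collect_eq mod_eq_dvd_iff mod_pos_pos_trivial)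
      then show "y1 = y2 \<and> t1 = t2" using tt by simp
    qed
    show "\<phi> ` (R \<times> {0..<?q}) = A"
    proof (intro equalityI subsetI)
      fix z assume "z \<in> \<phi> ` (R \<times> {0..<?q})"
      then obtain y t where y: "y \<in> R" and z: "z = (y + t * ?q ^ (k - v y)) mod ?q ^ Suc k"
        by (auto simp: \<phi>_def)
      obtain u where u: "poly f' y = ?q ^ v y * u" using unit[OF RA[OF y]] by blast
      have "?q ^ Suc k dvd poly f z - (poly f y + t * ?q ^ (k - v y) * poly f' y)"
        by (rule expand[OF RA[OF y]]) (simp only: z dvd_diff_mod_int)
      moreover have "t * ?q ^ (k - v y) * poly f' y = ?q ^ k * (t * u)"
        unfolding u by (simp only: mult.assoc qk[OF RA[OF y]]) (rule mult.left_commute)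
      ultimately have "?q ^ Suc k dvd poly f z - (poly f y + ?q ^ k * (t * u))" by simp
      then have "?q ^ k dvd poly f z - (poly f y + ?q ^ k * (t * u))" by (rule power_le_dvd) simp
      then have "?q ^ k dvd poly f z - (poly f y + ?q ^ k * (t * u)) + (poly f y + ?q ^ k * (t * u))"
        using RA[OF y] by (intro dvd_add) auto
      then show "z \<in> A" using p0 by (simp add: A_def z)
    next
      fix z assume zA: "z \<in> A"
      then have z: "?q ^ k dvd poly f z" "0 \<le> z" "z < ?q ^ Suc k" by (auto simp: A_def)
      obtain u where u: "poly f' z = ?q ^ v z * u" "\<not> ?q dvd u" using unit[OF z(1)] by blast
      obtain c where c: "poly f z = ?q ^ k * c" using z(1) by (rule dvdE)
      have "coprime u ?q" using prime_imp_coprime[OF q u(2)] by (rule coprime_imp_coprime) auto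
      then obtain u' where u': "[u * u' = 1] (mod ?q)" using cong_solve_coprime_int by blast
      define t where "t = (c * u') mod ?q"
      have t: "t \<in> {0..<?q}" using p0 by (simp add: t_def)
      have "[t * u = c * (u * u')] (mod ?q)" by (simp add: t_def cong_def mod_simps algebra_simps)
      then have "[t * u = c] (mod ?q)" using u' by (metis cong_scalar_left cong_trans mult.right_neutral)
      then have ctu: "?q dvd c - t * u" by (simp add: cong_iff_dvd_diff dvd_diff_commute)
      define y where "y = (z - t * ?q ^ (k - v z)) mod ?q ^ Suc k"
      have dy: "?q ^ Suc k dvd y - (z + (- t) * ?q ^ (k - v z))" unfolding y_def using dvd_diff_mod_int by simp
      have "?q ^ (k - v z) dvd y - (z + (- t) * ?q ^ (k - v z))" by (rule power_le_dvd[OF dy]) simp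
      then have "?q ^ (k - v z) dvd y - z" by (rule dvd_diff_shift) simp
      then have vy: "v y = v z" by (rule vshift[OF z(1)])
      have "?q ^ Suc k dvd poly f y - (poly f z + (- t) * ?q ^ (k - v z) * poly f' z)"
        by (rule expand[OF z(1) dy])
      moreover have "(- t) * ?q ^ (k - v z) * poly f' z = - (?q ^ k * (t * u))"
        unfolding u by (simp only: mult.assoc qk[OF z(1)]) simp
      moreover have "?q ^ k * c + - (?q ^ k * (t * u)) = ?q ^ k * (c - t * u)" by (simp add: right_diff_distrib)
      ultimately have "?q ^ Suc k dvd poly f y - ?q ^ k * (c - t * u)" by (simp only: c)
      moreover have "?q ^ Suc k dvd ?q ^ k * (c - t * u)" using ctu by (simp add: mult.commute[of ?q])
      ultimately have "?q ^ Suc k dvd poly f y" by (metis dvd_diff_right_iff dvd_add_left_iff diff_add_cancel)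
      then have yR: "y \<in> R" using p0 by (simp add: R_def y_def)
      have "\<phi> (y, t) = (z - t * ?q ^ (k - v z) + t * ?q ^ (k - v z)) mod ?q ^ Suc k"
        unfolding \<phi>_def prod.case vy unfolding y_def by (rule mod_add_left_eq)
      also have "\<dots> = z" using z by simp
      finally show "z \<in> \<phi> ` (R \<times> {0..<?q})" using yR t by (intro image_eqI[of _ _ "(y, t)"]) auto
    qed
  qed
  then have "card (R \<times> {0..<?q}) = card A" by (rule bij_betw_same_card)
  moreover have "card A = p * root_count f (p ^ k)"
    unfolding A_def root_count_def 
    using card_periodic_mult[of "p ^ k" "\<lambda>x. ?q ^ k dvd poly f x" p] p0 int_poly_dvd_cong[OF dvd_diff_mod_int]
    by (simp add: mult.commute)
  moreover have "card R = root_count f (p ^ Suc k)" by (simp add: R_def root_count_def)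
  ultimately show ?thesis using p0 by (simp add: card_cartesian_product)
qed

lemma root_count_prime_power_eventually:
  assumes "prime p" "f \<noteq> 0" "has_padic_root p f \<Longrightarrow> \<not> has_multiple_padic_root p f"
  shows "\<exists>w. (\<forall>\<^sub>F k in sequentially. root_count f (p ^ k) = w) \<and> (w > 0 \<longleftrightarrow> has_padic_root p f)"
proof (cases "has_padic_root p f")
  case False
  then obtain K where K: "\<And>x. \<not> int p ^ K dvd poly f x" using has_padic_root_iff[OF assms(1,2)] by blast
  have "root_count f (p ^ k) = 0" if "k \<ge> K" for k
  proof -
    have "{x\<in>{0..<int (p ^ k)}. int (p ^ k) dvd poly f x} = {}"
      using K power_le_dvd[OF _ that] by fastforce
    then show ?thesis unfolding root_count_def by (metis card.empty)
  qed
  then have "\<forall>\<^sub>F k in sequentially. root_count f (p ^ k) = 0" unfolding eventually_sequentially by blast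
  then show ?thesis using False by blast
next
  case True
  have p0: "p > 0" using assms(1) prime_gt_0_nat by simp
  obtain J where J: "\<And>x. \<not> (int p ^ J dvd poly f x \<and> int p ^ J dvd poly (pderiv f) x)"
    using no_multiple_root_bound[OF assms(1,2) assms(3)[OF True]] by blast
  define w where "w = root_count f (p ^ (2 * J + 1))"
  have "root_count f (p ^ k) = w" if "k \<ge> 2 * J + 1" for k
    using that by (induction k rule: dec_induct) (use root_count_step[OF assms(1) J] w_def in auto)
  then have "\<forall>\<^sub>F k in sequentially. root_count f (p ^ k) = w" unfolding eventually_sequentially by blast
  moreover have "w > 0"
  proof -
    let ?m = "int (p ^ (2 * J + 1))"
    obtain x where x: "?m dvd poly f x"
      using True has_padic_root_iff[OF assms(1,2)] by (metis of_nat_power)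
    then have "x mod ?m \<in> {x\<in>{0..<?m}. ?m dvd poly f x}"
      using p0 int_poly_dvd_cong[OF dvd_diff_mod_int] by auto
    moreover have "finite {x\<in>{0..<?m}. ?m dvd poly f x}" by (rule finite_subset[of _ "{0..<?m}"]) auto
    ultimately show ?thesis unfolding w_def root_count_def by (metis card_gt_0_iff empty_iff)
  qed
  ultimately show ?thesis using True by blast
qed

section \<open>Functions with prescribed differences\<close>

text \<open>For positive \<open>F\<close> this is Lipschitz continuity of \<open>ln F\<close> with
  constant \<kappa>. The multiplicative form is homogeneous in \<open>F\<close>, so it can be summed
  termwise.\<close>

definition log_lipschitz :: "real \<Rightarrow> (real \<Rightarrow> real) \<Rightarrow> bool" where
  "log_lipschitz \<kappa> F \<longleftrightarrow> (\<forall>s t. F s \<le> exp (\<kappa> * \<bar>s - t\<bar>) * F t)"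

text \<open>A difference equation with step \<open>l\<close> leaves the function free on one
  interval of length \<open>l\<close>; boundedness there starts every induction over the
  steps.\<close>

definition loc_bounded :: "(real \<Rightarrow> real) \<Rightarrow> bool" where
  "loc_bounded D \<longleftrightarrow> (\<forall>a b. \<exists>M. \<forall>v\<in>{a..b}. \<bar>D v\<bar> \<le> M)"

lemma log_lipschitzD: "log_lipschitz \<kappa> F \<Longrightarrow> F s \<le> exp (\<kappa> * \<bar>s - t\<bar>) * F t"
  by (simp add: log_lipschitz_def)

lemma log_lipschitz_shift: "log_lipschitz \<kappa> F \<Longrightarrow> log_lipschitz \<kappa> (\<lambda>v. F (v - c))"
proof -
  assume F: "log_lipschitz \<kappa> F"
  have "F (s - c) \<le> exp (\<kappa> * \<bar>s - t\<bar>) * F (t - c)" for s t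
    using log_lipschitzD[OF F, of "s - c" "t - c"] by simp
  then show ?thesis by (simp add: log_lipschitz_def)
qed

lemma log_lipschitz_has_sum:
  fixes F :: "'a \<Rightarrow> real \<Rightarrow> real"
  assumes "\<And>k. k \<in> A \<Longrightarrow> a k \<ge> 0" "\<And>k. k \<in> A \<Longrightarrow> log_lipschitz \<kappa> (F k)"
    and "\<And>v. ((\<lambda>k. a k * F k v) has_sum H v) A"
  shows "log_lipschitz \<kappa> H"
  unfolding log_lipschitz_def
proof (intro allI)
  fix s t
  have "((\<lambda>k. exp (\<kappa> * \<bar>s - t\<bar>) * (a k * F k t)) has_sum exp (\<kappa> * \<bar>s - t\<bar>) * H t) A"
    by (rule has_sum_cmult_right[OF assms(3)])
  with assms(3)[of s] show "H s \<le> exp (\<kappa> * \<bar>s - t\<bar>) * H t"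
  proof (rule has_sum_mono)
    fix k assume k: "k \<in> A"
    show "a k * F k s \<le> exp (\<kappa> * \<bar>s - t\<bar>) * (a k * F k t)"
      using mult_left_mono[OF log_lipschitzD[OF assms(2)[OF k], of s t] assms(1)[OF k]]
      by (simp add: algebra_simps)
  qed
qed

lemma log_lipschitz_loc_bounded:
  assumes "log_lipschitz \<kappa> F" "\<kappa> \<ge> 0" "\<And>v. F v \<ge> 0"
  shows "loc_bounded F"
  unfolding loc_bounded_def
proof (intro allI)
  fix a b :: real
  have "\<bar>F v\<bar> \<le> exp (\<kappa> * (b - a)) * F a" if "v \<in> {a..b}" for v
  proof -
    have "F v \<le> exp (\<kappa> * \<bar>v - a\<bar>) * F a" by (rule log_lipschitzD[OF assms(1)])
    also have "\<dots> \<le> exp (\<kappa> * (b - a)) * F a"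
      using that assms by (intro mult_right_mono) (auto intro!: mult_left_mono)
    finally show ?thesis using assms(3)[of v] by simp
  qed
  then show "\<exists>M. \<forall>v\<in>{a..b}. \<bar>F v\<bar> \<le> M" by blast
qed

lemma loc_bounded_add: "loc_bounded F \<Longrightarrow> loc_bounded G \<Longrightarrow> loc_bounded (\<lambda>v. F v + G v)"
  unfolding loc_bounded_def
proof (intro allI)
  fix a b
  assume "\<forall>a b. \<exists>M. \<forall>v\<in>{a..b}. \<bar>F v\<bar> \<le> M" "\<forall>a b. \<exists>M. \<forall>v\<in>{a..b}. \<bar>G v\<bar> \<le> M"
  then obtain M N where "\<forall>v\<in>{a..b}. \<bar>F v\<bar> \<le> M" "\<forall>v\<in>{a..b}. \<bar>G v\<bar> \<le> N" by metis
  then have "\<forall>v\<in>{a..b}. \<bar>F v + G v\<bar> \<le> M + N" by (meson abs_triangle_ineq add_mono order_trans)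
  then show "\<exists>M. \<forall>v\<in>{a..b}. \<bar>F v + G v\<bar> \<le> M" ..
qed

lemma loc_bounded_monom: "loc_bounded (\<lambda>v. c * v ^ r)"
  unfolding loc_bounded_def
proof (intro allI)
  fix a b :: real
  have "compact ((\<lambda>v. c * v ^ r) ` {a..b})" by (intro compact_continuous_image continuous_intros) simp
  then obtain M where "\<forall>x\<in>(\<lambda>v. c * v ^ r) ` {a..b}. norm x \<le> M" by (meson bounded_iff compact_imp_bounded)
  then show "\<exists>M. \<forall>v\<in>{a..b}. \<bar>c * v ^ r\<bar> \<le> M" by auto
qed

text \<open>From the initial interval \<open>v\<close> is reached in at most \<open>v / l\<close>
  steps, each of which adds at most \<open>\<kappa> * v ^ r\<close>.\<close>

lemma difference_bound:
  fixes l :: real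
  assumes l: "l > 0" and V: "V \<ge> 0" and kappa: "\<kappa> \<ge> 0"
    and M: "\<And>v. v \<in> {V..V + l} \<Longrightarrow> \<bar>D v\<bar> \<le> M"
    and d: "\<And>v. v \<ge> V + l \<Longrightarrow> \<bar>D v - D (v - l)\<bar> \<le> \<kappa> * v ^ r"
    and v: "v \<ge> V"
  shows "\<bar>D v\<bar> \<le> M + \<kappa> / l * v ^ Suc r"
proof -
  have *: "\<bar>D v\<bar> \<le> M + real m * \<kappa> * v ^ r" if "v \<ge> V + real m * l" "v \<le> V + real (Suc m) * l" for m v
    using that
  proof (induction m arbitrary: v)
    case 0
    then show ?case using M[of v] by simp
  next
    case (Suc m)
    have v0: "v \<ge> V + l" using Suc.prems(1) l V by (simp add: algebra_simps) (smt (verit) mult_nonneg_nonneg of_nat_0_le_iff)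
    have "\<bar>D (v - l)\<bar> \<le> M + real m * \<kappa> * (v - l) ^ r"
      by (rule Suc.IH) (use Suc.prems in \<open>auto simp: algebra_simps\<close>)
    also have "\<dots> \<le> M + real m * \<kappa> * v ^ r"
      using v0 V l kappa by (intro add_left_mono mult_left_mono power_mono) auto
    finally have "\<bar>D v\<bar> \<le> M + real m * \<kappa> * v ^ r + \<kappa> * v ^ r" using d[OF v0] by linarith
    then show ?case by (simp add: algebra_simps)
  qed
  define m where "m = nat \<lfloor>(v - V) / l\<rfloor>"
  have nn: "(v - V) / l \<ge> 0" using l v by simp
  then have m1: "real m \<le> (v - V) / l" "(v - V) / l < real m + 1" by (simp_all add: m_def)
  have "\<bar>D v\<bar> \<le> M + real m * \<kappa> * v ^ r"
    by (rule *) (use m1 l in \<open>auto simp: field_simps\<close>)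
  also have "real m \<le> v / l" using m1 V l by (smt (verit) divide_right_mono)
  then have "real m * \<kappa> * v ^ r \<le> v / l * \<kappa> * v ^ r"
    using kappa v V by (intro mult_right_mono) auto
  finally show ?thesis by (simp add: algebra_simps)
qed

text \<open>A Stolz-Cesaro theorem with a real argument: differences that are small against
  \<open>v ^ r\<close> accumulate to something small against \<open>v ^ Suc r\<close>.\<close>

lemma difference_little_o:
  assumes l: "l > 0" and D: "loc_bounded D"
    and lim: "((\<lambda>v. (D v - D (v - l)) / v ^ r) \<longlongrightarrow> 0) at_top"
  shows "((\<lambda>v. D v / v ^ Suc r) \<longlongrightarrow> 0) at_top"
proof (rule tendstoI)
  fix e :: real assume e: "e > 0"
  define \<kappa> where "\<kappa> = e * l / 2"
  have k: "\<kappa> > 0" using e l by (simp add: \<kappa>_def)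
  have "\<forall>\<^sub>F v in at_top. dist ((D v - D (v - l)) / v ^ r) 0 < \<kappa>" using lim k by (rule tendstoD)
  then obtain V0 where V0: "\<And>v. v \<ge> V0 \<Longrightarrow> \<bar>(D v - D (v - l)) / v ^ r\<bar> < \<kappa>"
    by (auto simp: eventually_at_top_linorder dist_norm)
  define V where "V = max V0 1"
  obtain M where M: "\<And>v. v \<in> {V..V+l} \<Longrightarrow> \<bar>D v\<bar> \<le> M" using D unfolding loc_bounded_def by blast
  have b: "\<bar>D v\<bar> \<le> M + \<kappa> / l * v ^ Suc r" if "v \<ge> V" for v
  proof (rule difference_bound[OF l _ _ M _ that])
    fix v assume v: "v \<ge> V + l"
    then have "v \<ge> V0" "v > 0" using l by (auto simp: V_def)
    then show "\<bar>D v - D (v - l)\<bar> \<le> \<kappa> * v ^ r" using V0[of v] by (simp add: abs_divide field_simps)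
  qed (use k V_def in auto)
  have "((\<lambda>v. M / v ^ Suc r) \<longlongrightarrow> 0) at_top" by real_asymp
  then have "\<forall>\<^sub>F v in at_top. dist (M / v ^ Suc r) 0 < e / 2" using e by (intro tendstoD) auto
  then show "\<forall>\<^sub>F v in at_top. dist (D v / v ^ Suc r) 0 < e"
    using eventually_ge_at_top[of V]
  proof eventually_elim
    case (elim v)
    have v: "v ^ Suc r > 0" "v \<noteq> 0" using elim by (simp_all add: V_def)
    have "\<bar>D v\<bar> / v ^ Suc r \<le> (M + \<kappa> / l * v ^ Suc r) / v ^ Suc r"
      using b[OF elim(2)] v by (intro divide_right_mono) auto
    also have "\<dots> = M / v ^ Suc r + e / 2" using v l by (simp add: add_divide_distrib \<kappa>_def del: power_Suc)
    also have "\<dots> < e" using elim(1) unfolding dist_real_def by linarith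
    finally show ?case using v by (simp add: dist_norm abs_divide)
  qed
qed

lemma power_difference_asymp:
  fixes l :: real
  shows "((\<lambda>v. (v ^ Suc r - (v - l) ^ Suc r) / v ^ r) \<longlongrightarrow> l * real (Suc r)) at_top"
proof -
  have "((\<lambda>v. l * (\<Sum>i<Suc r. ((v - l) / v) ^ i)) \<longlongrightarrow> l * (\<Sum>i<Suc r. 1 ^ i)) at_top"
    by (intro tendsto_intros) real_asymp
  moreover have "\<forall>\<^sub>F v in at_top. l * (\<Sum>i<Suc r. ((v - l) / v) ^ i) = (v ^ Suc r - (v - l) ^ Suc r) / v ^ r"
    using eventually_gt_at_top[of 0]
  proof eventually_elim
    case (elim v)
    have "v ^ Suc r - (v - l) ^ Suc r = (v - (v - l)) * (\<Sum>i<Suc r. v ^ (r - i) * (v - l) ^ i)"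
      using power_diff_sumr2[of "v - l" "Suc r" v] by (simp add: algebra_simps del: sum.lessThan_Suc power_Suc)
    moreover have "v ^ (r - i) * (v - l) ^ i / v ^ r = ((v - l) / v) ^ i" if "i < Suc r" for i
      using that elim by (simp add: power_diff power_divide field_simps)
    then have "(\<Sum>i<Suc r. v ^ (r - i) * (v - l) ^ i) / v ^ r = (\<Sum>i<Suc r. ((v - l) / v) ^ i)"
      unfolding sum_divide_distrib by (intro sum.cong) auto
    ultimately show ?case by (simp only: times_divide_eq_right[symmetric]) simp
  qed
  ultimately show ?thesis by (simp add: filterlim_cong)
qed

text \<open>Subtracting \<open>C * v ^ Suc r\<close>, where \<open>C\<close> is chosen so that the
  differences of this monomial have leading term \<open>c * v ^ r\<close>, reduces the claim to
  \<open>difference_little_o\<close>.\<close>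

lemma growth_step:
  assumes l: "l > 0" and H: "loc_bounded H" and F: "\<And>v. H v - H (v - l) = F v"
    and lim: "((\<lambda>v. F v / v ^ r) \<longlongrightarrow> c) at_top"
  shows "((\<lambda>v. H v / v ^ Suc r) \<longlongrightarrow> c / (l * real (Suc r))) at_top"
proof -
  define C where "C = c / (l * real (Suc r))"
  define D where "D v = H v + (- C) * v ^ Suc r" for v
  have "((\<lambda>v. F v / v ^ r - C * ((v ^ Suc r - (v - l) ^ Suc r) / v ^ r)) \<longlongrightarrow> c - C * (l * real (Suc r))) at_top"
    by (intro tendsto_intros lim power_difference_asymp)
  also have "c - C * (l * real (Suc r)) = 0" using l by (simp add: C_def)
  also have "(\<lambda>v. F v / v ^ r - C * ((v ^ Suc r - (v - l) ^ Suc r) / v ^ r)) = (\<lambda>v. (D v - D (v - l)) / v ^ r)"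
    unfolding D_def F[symmetric] by (auto simp: diff_divide_distrib add_divide_distrib algebra_simps)
  finally have "((\<lambda>v. D v / v ^ Suc r) \<longlongrightarrow> 0) at_top"
    using loc_bounded_add[OF H loc_bounded_monom] unfolding D_def
    by (intro difference_little_o[OF l]) 
  then have "((\<lambda>v. D v / v ^ Suc r + C) \<longlongrightarrow> 0 + C) at_top" by (intro tendsto_intros)
  moreover have "\<forall>\<^sub>F v in at_top. D v / v ^ Suc r + C = H v / v ^ Suc r"
    using eventually_gt_at_top[of 0]
    by eventually_elim (simp add: D_def add_divide_distrib diff_divide_distrib)
  ultimately show ?thesis unfolding C_def by (simp add: filterlim_cong)
qed

text \<open>A Cauchy criterion in which the centre \<open>m\<close> may depend on \<open>e\<close>.
  In \<open>linear_growth_irrational\<close> each denominator \<open>b\<close> supplies its own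
  approximate slope.\<close>

lemma convergent_if_osc_small:
  fixes h :: "real \<Rightarrow> real"
  assumes "\<And>e. e > 0 \<Longrightarrow> \<exists>m. \<forall>\<^sub>F v in at_top. \<bar>h v - m\<bar> \<le> e"
  shows "\<exists>c. (h \<longlongrightarrow> c) at_top"
proof -
  have "\<forall>n. \<exists>m. \<forall>\<^sub>F v in at_top. \<bar>h v - m\<bar> \<le> 1 / real (Suc n)" using assms by simp
  then obtain m where m: "\<And>n. \<forall>\<^sub>F v in at_top. \<bar>h v - m n\<bar> \<le> 1 / real (Suc n)" by metis
  have mm: "\<bar>m i - m j\<bar> \<le> 1 / real (Suc i) + 1 / real (Suc j)" for i j
  proof -
    obtain v where "\<bar>h v - m i\<bar> \<le> 1 / real (Suc i)" "\<bar>h v - m j\<bar> \<le> 1 / real (Suc j)"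
      using eventually_conj[OF m[of i] m[of j]] eventually_happens[of _ "at_top :: real filter"] by auto
    then show ?thesis by linarith
  qed
  have "Cauchy m"
  proof (rule metric_CauchyI)
    fix e :: real assume "e > 0"
    then obtain N where N: "1 / real (Suc N) < e / 2" by (meson half_gt_zero nat_approx_posE)
    have "dist (m i) (m j) < e" if "i \<ge> N" "j \<ge> N" for i j
    proof -
      have "1 / real (Suc i) \<le> 1 / real (Suc N)" "1 / real (Suc j) \<le> 1 / real (Suc N)"
        using that by (auto simp: field_simps)
      then show ?thesis using mm[of i j] N by (simp add: dist_norm)
    qed
    then show "\<exists>M. \<forall>i\<ge>M. \<forall>j\<ge>M. dist (m i) (m j) < e" by blast
  qed
  then obtain c where c: "m \<longlonglongrightarrow> c" by (meson Cauchy_convergent_iff convergent_def)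
  have "(h \<longlongrightarrow> c) at_top"
  proof (rule tendstoI)
    fix e :: real assume "e > 0"
    then have "\<forall>\<^sub>F n in sequentially. dist (m n) c < e / 2" using c by (intro tendstoD) auto
    moreover have "\<forall>\<^sub>F n in sequentially. 1 / real (Suc n) < e / 2" using \<open>e > 0\<close> by real_asymp
    ultimately obtain n where n: "dist (m n) c < e / 2" "1 / real (Suc n) < e / 2"
      using eventually_happens[OF eventually_conj] by (metis (mono_tags, lifting) sequentially_bot)
    show "\<forall>\<^sub>F v in at_top. dist (h v) c < e"
      using m[of n]
    proof eventually_elim
      case (elim v)
      then show ?case using n unfolding dist_real_def by linarith
    qed
  qed
  then show ?thesis ..
qed


section \<open>Asymptotic periodicity and averaging over an irrational step\<close>

text \<open>The forward orbit of \<open>v\<close> under translation by \<open>l\<close> converges, and its limit is the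
  periodic function that \<open>F\<close> approaches.\<close>

lemma asymptotically_periodic:
  assumes l: "l > 0" and d: "\<delta> > 0" and k: "\<kappa> \<ge> 0" and F0: "\<And>v. F v \<ge> 0" and ll: "log_lipschitz \<kappa> F"
    and decay: "\<And>v. \<bar>F v - F (v - l)\<bar> \<le> C * exp (- \<delta> * v)"
  shows "\<exists>G M \<Lambda>. (\<forall>v. G (v + l) = G v) \<and> (\<forall>v. \<bar>G v\<bar> \<le> M) \<and> \<Lambda> \<ge> 0 \<and>
    (\<forall>s t. \<bar>s - t\<bar> \<le> 1 \<longrightarrow> \<bar>G s - G t\<bar> \<le> \<Lambda> * \<bar>s - t\<bar>) \<and> ((\<lambda>v. F v - G v) \<longlongrightarrow> 0) at_top"
proof -
  define x where "x = exp (- \<delta> * l)"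
  have x: "0 < x" "x < 1" using l d by (auto simp: x_def)
  have C0: "C \<ge> 0" using order_trans[OF abs_ge_zero decay[of 0]] by simp
  have dec: "\<bar>F (v + real (Suc m) * l) - F (v + real m * l)\<bar> \<le> C * exp (- \<delta> * v) * x ^ m" for v m
  proof -
    have "\<bar>F (v + real (Suc m) * l) - F (v + real m * l)\<bar> \<le> C * exp (- \<delta> * (v + real (Suc m) * l))"
      using decay[of "v + real (Suc m) * l"] by (simp add: algebra_simps)
    also have "\<dots> \<le> C * exp (- \<delta> * (v + real m * l))"
      using C0 d l by (intro mult_left_mono) (auto simp: algebra_simps)
    also have "\<dots> = C * exp (- \<delta> * v) * x ^ m"
      by (simp add: x_def exp_of_nat_mult[symmetric] exp_add[symmetric] algebra_simps)
    finally show ?thesis .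
  qed
  have geo: "summable (\<lambda>m. C * exp (- \<delta> * v) * x ^ m)" for v
    using x by (intro summable_mult summable_geometric) auto
  have summ: "summable (\<lambda>m. F (v + real (Suc m) * l) - F (v + real m * l))" for v
    by (rule summable_comparison_test'[OF geo, of 0 _ v]) (use dec in auto)
  define G where "G v = lim (\<lambda>m. F (v + real m * l))" for v
  have Glim: "(\<lambda>m. F (v + real m * l)) \<longlonglongrightarrow> G v" for v
  proof -
    have "(\<lambda>n. F v + (\<Sum>m<n. F (v + real (Suc m) * l) - F (v + real m * l))) = (\<lambda>n. F (v + real n * l))"
      by (rule ext) (subst sum_lessThan_telescope, simp)
    moreover have "convergent (\<lambda>n. F v + (\<Sum>m<n. F (v + real (Suc m) * l) - F (v + real m * l)))"
      using summ[of v] by (intro convergent_add convergent_const) (simp add: summable_iff_convergent)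
    ultimately show ?thesis unfolding G_def by (simp add: convergent_LIMSEQ_iff)
  qed
  have G0: "G v \<ge> 0" for v by (rule LIMSEQ_le_const[OF Glim]) (use F0 in auto)
  have per: "G (v + l) = G v" for v
  proof (rule LIMSEQ_unique[OF Glim])
    show "(\<lambda>m. F (v + l + real m * l)) \<longlonglongrightarrow> G v"
      using LIMSEQ_Suc[OF Glim[of v]] by (simp add: algebra_simps)
  qed
  have Gll: "G s \<le> exp (\<kappa> * \<bar>s - t\<bar>) * G t" for s t
  proof (rule LIMSEQ_le[OF Glim tendsto_mult_left[OF Glim]])
    have "F (s + real m * l) \<le> exp (\<kappa> * \<bar>s - t\<bar>) * F (t + real m * l)" for m
      using log_lipschitzD[OF ll, of "s + real m * l" "t + real m * l"] by simp
    then show "\<exists>N. \<forall>n\<ge>N. F (s + real n * l) \<le> exp (\<kappa> * \<bar>s - t\<bar>) * F (t + real n * l)" by blast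
  qed
  define M where "M = exp (\<kappa> * l) * G 0"
  have perm: "G (v + real m * l) = G v" for v m
    by (induction m) (use per in \<open>auto simp: algebra_simps\<close>, metis add.assoc add.commute)
  have perz: "G (v + of_int z * l) = G v" for v and z :: int
  proof (cases "z \<ge> 0")
    case True then show ?thesis using perm[of v "nat z"] by simp
  next
    case False then show ?thesis using perm[of "v + of_int z * l" "nat (- z)"] by (simp add: algebra_simps)
  qed
  have GM: "G v \<le> M" for v
  proof -
    define z where "z = \<lfloor>v / l\<rfloor>"
    define w where "w = v - of_int z * l"
    have "of_int z \<le> v / l" "v / l < of_int z + 1" by (simp_all add: z_def)
    then have w: "0 \<le> w" "w \<le> l" using l by (simp_all add: w_def field_simps)
    have "G v = G w" using perz[of w z] by (simp add: w_def)
    also have "\<dots> \<le> exp (\<kappa> * \<bar>w - 0\<bar>) * G 0" by (rule Gll)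
    also have "\<dots> \<le> M" unfolding M_def
      using w k G0[of 0] by (intro mult_right_mono) (auto intro!: mult_left_mono)
    finally show ?thesis .
  qed
  have M0: "M \<ge> 0" using GM[of 0] G0[of 0] by simp
  \<comment> \<open>For \<open>y = \<kappa> * \<bar>s - t\<bar>\<close> one has
    \<open>exp y - 1 \<le> y * exp y\<close>, and \<open>y \<le> \<kappa>\<close> when
    \<open>s\<close> and \<open>t\<close> are at distance at most 1; the factor \<open>M\<close>
    bounds \<open>G\<close>.\<close>
  define \<Lambda> where "\<Lambda> = M * (\<kappa> * exp \<kappa>)"
  have half: "G s - G t \<le> \<Lambda> * \<bar>s - t\<bar>" if "\<bar>s - t\<bar> \<le> 1" for s t
  proof -
    define y where "y = \<kappa> * \<bar>s - t\<bar>"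
    have y: "0 \<le> y" "y \<le> \<kappa>" using k that by (auto simp: y_def mult_left_le)
    have "exp y - 1 \<le> y * exp y"
      using exp_ge_add_one_self[of "- y"] by (simp add: exp_minus field_simps)
    also have "\<dots> \<le> y * exp \<kappa>" using y by (intro mult_left_mono) auto
    finally have e: "exp y - 1 \<le> y * exp \<kappa>" .
    have "G s - G t \<le> (exp y - 1) * G t" using Gll[of s t] by (simp add: y_def algebra_simps)
    also have "\<dots> \<le> (exp y - 1) * M" using GM y by (intro mult_left_mono) auto
    also have "\<dots> \<le> (y * exp \<kappa>) * M" using e M0 by (intro mult_right_mono)
    finally show ?thesis by (simp add: \<Lambda>_def y_def algebra_simps)
  qed
  have "\<bar>F v - G v\<bar> \<le> C / (1 - x) * exp (- \<delta> * v)" for v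
  proof -
    have "\<bar>F v - F (v + real n * l)\<bar> \<le> C / (1 - x) * exp (- \<delta> * v)" for n
    proof -
      have "F (v + real n * l) - F v = (\<Sum>m<n. F (v + real (Suc m) * l) - F (v + real m * l))"
        by (subst sum_lessThan_telescope) simp
      also have "\<bar>\<dots>\<bar> \<le> (\<Sum>m<n. C * exp (- \<delta> * v) * x ^ m)"
        by (rule order_trans[OF sum_abs sum_mono]) (use dec in blast)
      also have "\<dots> \<le> (\<Sum>m. C * exp (- \<delta> * v) * x ^ m)"
        using C0 x by (intro sum_le_suminf[OF geo]) auto
      also have "\<dots> = C / (1 - x) * exp (- \<delta> * v)"
        using x by (simp add: suminf_mult suminf_geometric summable_geometric)
      finally show ?thesis by (simp add: abs_minus_commute)
    qed
    moreover have "(\<lambda>n. \<bar>F v - F (v + real n * l)\<bar>) \<longlonglongrightarrow> \<bar>F v - G v\<bar>" by (intro tendsto_intros Glim)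
    ultimately show ?thesis by (intro LIMSEQ_le_const2) auto
  qed
  then have near: "norm (F v - G v) \<le> C / (1 - x) * exp (- \<delta> * v)" for v by (simp only: real_norm_def)
  have "((\<lambda>v. C / (1 - x) * exp (- \<delta> * v)) \<longlongrightarrow> 0) at_top" using d by real_asymp
  then have "((\<lambda>v. F v - G v) \<longlongrightarrow> 0) at_top"
    by (rule Lim_null_comparison[OF always_eventually, OF allI, OF near])
  moreover have "\<bar>G s - G t\<bar> \<le> \<Lambda> * \<bar>s - t\<bar>" if "\<bar>s - t\<bar> \<le> 1" for s t
    using half[of s t] half[of t s] that by (simp add: abs_le_iff abs_minus_commute)
  moreover have "\<Lambda> \<ge> 0" using M0 k by (simp add: \<Lambda>_def)
  moreover have "\<bar>G v\<bar> \<le> M" for v using G0 GM by simp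
  ultimately show ?thesis using per by blast
qed


text \<open>Multiplication by \<open>a\<close> permutes the residues modulo \<open>b\<close>, and
  reducing \<open>j * a\<close> modulo \<open>b\<close> moves the argument by whole periods.\<close>

lemma sum_periodic_coprime:
  fixes a b :: int and G :: "real \<Rightarrow> real"
  assumes b: "b > 0" and cop: "coprime a b" and per: "\<And>v. G (v + l) = G v"
  shows "(\<Sum>j\<in>{0..<b}. G (v - of_int (j * a) * l / of_int b)) = (\<Sum>i\<in>{0..<b}. G (v - of_int i * l / of_int b))"
proof -
  have perm: "G (v + real m * l) = G v" for v m
    by (induction m) (use per in \<open>auto simp: algebra_simps\<close>, metis add.assoc add.commute)
  have perz: "G (v + of_int z * l) = G v" for v and z :: int
  proof (cases "z \<ge> 0")
    case True then show ?thesis using perm[of v "nat z"] by simp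
  next
    case False then show ?thesis using perm[of "v + of_int z * l" "nat (- z)"] by (simp add: algebra_simps)
  qed
  have inj: "inj_on (\<lambda>j. j * a mod b) {0..<b}"
  proof (rule inj_onI)
    fix i j assume ij: "i \<in> {0..<b}" "j \<in> {0..<b}" "i * a mod b = j * a mod b"
    then have "b dvd (i - j) * a" by (simp add: mod_eq_dvd_iff left_diff_distrib)
    then have "b dvd i - j" using cop by (simp add: coprime_commute coprime_dvd_mult_left_iff)
    then show "i = j" using ij by (metis atLeastLessThan_iff mod_eq_dvd_iff mod_pos_pos_trivial)
  qed
  have "(\<lambda>j. j * a mod b) ` {0..<b} = {0..<b}"
    by (rule endo_inj_surj) (use inj b in auto)
  then have bij: "bij_betw (\<lambda>j. j * a mod b) {0..<b} {0..<b}" using inj by (simp add: bij_betw_def)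
  have "G (v - of_int (j * a) * l / of_int b) = G (v - of_int (j * a mod b) * l / of_int b)" for j
  proof -
    have "real_of_int (j * a) = of_int b * of_int (j * a div b) + of_int (j * a mod b)"
      by (metis mult_div_mod_eq of_int_add of_int_mult)
    then have "v - of_int (j * a) * l / of_int b = v - of_int (j * a mod b) * l / of_int b + of_int (- (j * a div b)) * l"
      using b by (simp add: field_simps)
    then show ?thesis using perz by metis
  qed
  then have "(\<Sum>j\<in>{0..<b}. G (v - of_int (j * a) * l / of_int b)) = (\<Sum>j\<in>{0..<b}. G (v - of_int (j * a mod b) * l / of_int b))"
    by simp
  also have "\<dots> = (\<Sum>i\<in>{0..<b}. G (v - of_int i * l / of_int b))"
    by (rule sum.reindex_bij_betw[OF bij])
  finally show ?thesis .
qed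

text \<open>By Dirichlet, \<open>l\<^sub>2 / l\<^sub>1\<close> is within \<open>1 / b\<^sup>2\<close> of a reduced fraction \<open>a / b\<close>, so \<open>b\<close> consecutive
  translates by \<open>l\<^sub>2\<close> are, up to a total error that does not depend on \<open>b\<close>, the translates by the
  multiples of \<open>l\<^sub>1 / b\<close>.  Hence \<open>H v - H (v - b l\<^sub>2)\<close> is constant up to a bounded error, while the
  step \<open>b l\<^sub>2\<close> may be taken as large as we like.\<close>

lemma linear_growth_irrational:
  assumes l1: "l1 > 0" and l2: "l2 > 0" and irr: "l2 / l1 \<notin> \<rat>" and d: "\<delta> > 0" and k: "\<kappa> \<ge> 0"
    and F0: "\<And>v. F v \<ge> 0" and ll: "log_lipschitz \<kappa> F"
    and decay: "\<And>v. \<bar>F v - F (v - l1)\<bar> \<le> C * exp (- \<delta> * v)"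
    and H: "loc_bounded H" "\<And>v. H v - H (v - l2) = F v"
  shows "\<exists>c. ((\<lambda>v. H v / v) \<longlongrightarrow> c) at_top"
proof (rule convergent_if_osc_small)
  fix e :: real assume e: "e > 0"
  obtain G \<Lambda> where G: "(\<forall>v. G (v + l1) = G v) \<and> \<Lambda> \<ge> 0
      \<and> (\<forall>s t. \<bar>s - t\<bar> \<le> 1 \<longrightarrow> \<bar>G s - G t\<bar> \<le> \<Lambda> * \<bar>s - t\<bar>) \<and> ((\<lambda>v. F v - G v) \<longlongrightarrow> 0) at_top"
    using asymptotically_periodic[OF l1 d k F0 ll decay] by blast
  then have per: "\<And>v. G (v + l1) = G v" and L0: "\<Lambda> \<ge> 0"
    and lip: "\<And>s t. \<bar>s - t\<bar> \<le> 1 \<Longrightarrow> \<bar>G s - G t\<bar> \<le> \<Lambda> * \<bar>s - t\<bar>"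
    and FG: "((\<lambda>v. F v - G v) \<longlongrightarrow> 0) at_top"
    by blast+
  \<comment> \<open>The total of three errors: \<open>\<Lambda> * l1\<close> from the rational
    approximation, \<open>\<Lambda> * l1\<close> from the variation of \<open>W\<close>, and 1 from
    replacing \<open>F\<close> by its periodic limit \<open>G\<close>.\<close>
  define K where "K = 2 * \<Lambda> * l1 + 1"
  have K: "K > 0" using L0 l1 by (simp add: K_def add_nonneg_pos)
  have "infinite (approx_set (l2 / l1))" using irr rational_iff_finite_approx_set by blast
  \<comment> \<open>Irrationality provides arbitrarily large denominators. The bound
    \<open>l1\<close> gives \<open>h \<le> 1\<close>, the range in which \<open>G\<close> is known
    to be Lipschitz; the other bound makes the error per unit length, \<open>K / L\<close>, at most
    \<open>e / 2\<close>.\<close>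
  from infinite_approx_set[OF this, of "\<lceil>max l1 (2 * K / (e * l2))\<rceil>"]
  obtain a b :: int where ab: "(a, b) \<in> approx_set (l2 / l1)" "b > \<lceil>max l1 (2 * K / (e * l2))\<rceil>" by auto
  then have b: "b > 0" "coprime a b" and app: "\<bar>l2 / l1 - of_int a / of_int b\<bar> < 1 / (of_int b)\<^sup>2"
    by (auto simp: approx_set_def)
  have bl: "real_of_int b \<ge> l1" "real_of_int b \<ge> 2 * K / (e * l2)" using ab(2) by linarith+
  define W where "W v = (\<Sum>i\<in>{0..<b}. G (v - of_int i * l1 / of_int b))" for v
  define h where "h = l1 / of_int b"
  have h: "h > 0" "h \<le> 1" using l1 b bl by (simp_all add: h_def)
  have bh: "of_int b * h = l1" using b by (simp add: h_def)
  have Wn: "W v = (\<Sum>i<nat b. G (v - real i * h))" for v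
    unfolding W_def h_def
    by (rule sum.reindex_bij_witness[of _ int nat]) (auto simp: of_nat_nat)
  have Wper: "W (v + h) = W v" for v
  proof -
    have "W (v + h) - W v = (\<Sum>i<nat b. G (v + h - real i * h) - G (v + h - real (Suc i) * h))"
      unfolding Wn by (simp add: sum_subtractf algebra_simps)
    also have "\<dots> = G (v + h) - G (v + h - real (nat b) * h)"
      using sum_lessThan_telescope'[of "\<lambda>i. G (v + h - real i * h)" "nat b"] by simp
    also have "real (nat b) * h = l1" using b bh by simp
    also have "G (v + h) - G (v + h - l1) = 0" using per[of "v + h - l1"] by simp
    finally show ?thesis by simp
  qed
  have Wperm: "W (v + real m * h) = W v" for v m
    by (induction m) (use Wper in \<open>auto simp: algebra_simps\<close>, metis add.assoc add.commute)
  \<comment> \<open>\<open>W\<close> has the short period \<open>h\<close>, so only arguments in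
    \<open>[0, h]\<close> matter; there each of the \<open>b\<close> summands varies by at most
    \<open>\<Lambda> * h\<close>, and \<open>b * h = l1\<close>.\<close>
  have W0: "\<bar>W v - W 0\<bar> \<le> \<Lambda> * l1" if "v \<ge> 0" for v
  proof -
    define m where "m = nat \<lfloor>v / h\<rfloor>"
    define w where "w = v - real m * h"
    have "v / h \<ge> 0" using that h by simp
    then have "real m \<le> v / h" "v / h < real m + 1" by (simp_all add: m_def)
    then have w: "0 \<le> w" "w \<le> h" using h by (simp_all add: w_def field_simps)
    have "W v = W w" using Wperm[of w m] by (simp add: w_def)
    then have "\<bar>W v - W 0\<bar> = \<bar>\<Sum>i<nat b. G (w - real i * h) - G (0 - real i * h)\<bar>"
      unfolding Wn by (simp add: sum_subtractf)
    also have "\<dots> \<le> (\<Sum>i<nat b. \<Lambda> * h)"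
    proof (rule order_trans[OF sum_abs sum_mono])
      fix i
      have "\<bar>G (w - real i * h) - G (0 - real i * h)\<bar> \<le> \<Lambda> * \<bar>(w - real i * h) - (0 - real i * h)\<bar>"
        using w h by (intro lip) auto
      also have "\<dots> \<le> \<Lambda> * h" using w L0 by (intro mult_left_mono) auto
      finally show "\<bar>G (w - real i * h) - G (0 - real i * h)\<bar> \<le> \<Lambda> * h" .
    qed
    also have "\<dots> = \<Lambda> * (of_int b * h)" using b by simp
    finally show ?thesis unfolding bh .
  qed
  \<comment> \<open>The \<open>j\<close>-th argument is off by at most
    \<open>j * l1 / b ^ 2\<close>, which is at most \<open>h\<close> because \<open>j < b\<close>.
    Summed over \<open>b\<close> terms the error is again
    \<open>\<Lambda> * (b * h)\<close>.\<close>
  have SW: "\<bar>(\<Sum>j<nat b. G (v - real j * l2)) - W v\<bar> \<le> \<Lambda> * l1" for v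
  proof -
    have "(\<Sum>j<nat b. G (v - real j * l2)) = (\<Sum>j\<in>{0..<b}. G (v - of_int j * l2))"
      by (rule sum.reindex_bij_witness[of _ nat int]) (auto simp: of_nat_nat)
    moreover have "W v = (\<Sum>j\<in>{0..<b}. G (v - of_int (j * a) * l1 / of_int b))"
      unfolding W_def by (rule sum_periodic_coprime[where G = G and l = l1, OF b per, symmetric])
    ultimately have "\<bar>(\<Sum>j<nat b. G (v - real j * l2)) - W v\<bar>
        = \<bar>\<Sum>j\<in>{0..<b}. G (v - of_int j * l2) - G (v - of_int (j * a) * l1 / of_int b)\<bar>"
      by (simp add: sum_subtractf)
    also have "\<dots> \<le> (\<Sum>j\<in>{0..<b}. \<Lambda> * h)"
    proof (rule order_trans[OF sum_abs sum_mono])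
      fix j assume j: "j \<in> {0..<b}"
      let ?x = "v - of_int j * l2" and ?y = "v - of_int (j * a) * l1 / of_int b"
      have "?x - ?y = - (of_int j * l1 * (l2 / l1 - of_int a / of_int b))"
        using l1 by (simp add: field_simps)
      then have "\<bar>?x - ?y\<bar> = of_int j * l1 * \<bar>l2 / l1 - of_int a / of_int b\<bar>"
        using j l1 by (simp only: abs_minus_cancel abs_mult) simp
      also have "\<dots> \<le> of_int b * l1 * (1 / (of_int b)\<^sup>2)"
        using j l1 app by (intro mult_mono) auto
      also have "\<dots> = h" using b by (simp add: h_def power2_eq_square)
      finally have xy: "\<bar>?x - ?y\<bar> \<le> h" .
      have "\<bar>G ?x - G ?y\<bar> \<le> \<Lambda> * \<bar>?x - ?y\<bar>" using xy h by (intro lip) auto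
      also have "\<dots> \<le> \<Lambda> * h" using xy L0 by (rule mult_left_mono)
      finally show "\<bar>G ?x - G ?y\<bar> \<le> \<Lambda> * h" .
    qed
    also have "\<dots> = \<Lambda> * (of_int b * h)" using b by simp
    finally show ?thesis unfolding bh .
  qed
  define L where "L = of_int b * l2"
  have L: "L > 0" using b l2 by (simp add: L_def)
  have HF: "H v - H (v - real n * l2) = (\<Sum>j<n. F (v - real j * l2))" for v n
  proof (induction n)
    case (Suc n)
    then show ?case using H(2)[of "v - real n * l2"] by (simp add: algebra_simps)
  qed simp
  have "((\<lambda>v. (\<Sum>j<nat b. F (v - real j * l2) - G (v - real j * l2))) \<longlongrightarrow> (\<Sum>j<nat b. 0)) at_top"
  proof (rule tendsto_sum)
    fix j
    show "((\<lambda>v. F (v - real j * l2) - G (v - real j * l2)) \<longlongrightarrow> 0) at_top"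
      by (rule filterlim_compose[OF FG]) real_asymp
  qed
  then have "\<forall>\<^sub>F v in at_top. dist (\<Sum>j<nat b. F (v - real j * l2) - G (v - real j * l2)) 0 < 1"
    by (intro tendstoD) auto
  then obtain V0 where V0: "\<And>v. v \<ge> V0 \<Longrightarrow> \<bar>\<Sum>j<nat b. F (v - real j * l2) - G (v - real j * l2)\<bar> < 1"
    by (auto simp: eventually_at_top_linorder)
  define V where "V = max V0 1"
  define D where "D v = H v + (- (W 0 / L)) * v ^ 1" for v
  have "loc_bounded D" unfolding D_def by (intro loc_bounded_add H loc_bounded_monom)
  then obtain M where M: "\<And>v. v \<in> {V..V+L} \<Longrightarrow> \<bar>D v\<bar> \<le> M" unfolding loc_bounded_def by blast
  have bound: "\<bar>D v\<bar> \<le> M + K / L * v ^ Suc 0" if "v \<ge> V" for v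
  proof (rule difference_bound[OF L _ _ M _ that])
    fix v assume v: "v \<ge> V + L"
    then have v': "v \<ge> V0" "v \<ge> 0" using L by (auto simp: V_def)
    have nb: "real (nat b) * l2 = L" using b by (simp add: L_def)
    have "D v - D (v - L) = H v - H (v - L) - W 0"
      using L by (simp add: D_def field_simps)
    then have "D v - D (v - L) = (\<Sum>j<nat b. F (v - real j * l2)) - W 0"
      using HF[of v "nat b"] unfolding nb by simp
    then have "D v - D (v - L) = (\<Sum>j<nat b. F (v - real j * l2) - G (v - real j * l2))
        + ((\<Sum>j<nat b. G (v - real j * l2)) - W v) + (W v - W 0)"
      by (simp add: sum_subtractf)
    then show "\<bar>D v - D (v - L)\<bar> \<le> K * v ^ 0"
      using V0[OF v'(1)] SW[of v] W0[OF v'(2)] unfolding K_def power_0 mult_1_right by linarith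
  qed (use K V_def in auto)
  have "K / L \<le> e / 2"
  proof -
    have "2 * K \<le> of_int b * (e * l2)" using bl(2) e l2 by (simp add: field_simps)
    then show ?thesis using L by (simp add: L_def field_simps)
  qed
  have "((\<lambda>v. M / v) \<longlongrightarrow> 0) at_top" by real_asymp
  then have "\<forall>\<^sub>F v in at_top. dist (M / v) 0 < e / 2" using e by (intro tendstoD) auto
  then have "\<forall>\<^sub>F v in at_top. \<bar>H v / v - W 0 / L\<bar> \<le> e"
    using eventually_ge_at_top[of V]
  proof eventually_elim
    case (elim v)
    have v: "v > 0" using elim by (simp add: V_def)
    have "H v / v - W 0 / L = D v / v" using v by (simp add: D_def field_simps)
    then have "\<bar>H v / v - W 0 / L\<bar> = \<bar>D v\<bar> / v" using v by (simp add: abs_divide)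
    also have "\<dots> \<le> (M + K / L * v) / v" using bound[OF elim(2)] v by (intro divide_right_mono) auto
    also have "\<dots> = M / v + K / L" using v by (simp add: add_divide_distrib)
    finally show ?case using elim(1) \<open>K / L \<le> e / 2\<close> unfolding dist_real_def by linarith
  qed
  then show "\<exists>m. \<forall>\<^sub>F v in at_top. \<bar>H v / v - m\<bar> \<le> e" by blast
qed

section \<open>Iterated discrete convolutions\<close>

text \<open>Only finitely many coefficients differ from \<open>w\<close>. Up to finitely many
  translates of \<open>F\<close> the sum is thus \<open>w\<close> times the convolution with
  constant weight 1, which telescopes under the difference with step \<open>l\<close>.\<close>

lemma conv_decompose:
  fixes a :: "nat \<Rightarrow> real"
  assumes w: "w > 0" and a: "\<And>k. k \<ge> K \<Longrightarrow> a k = w"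
    and F0: "\<And>v. F v \<ge> 0" and k: "\<kappa> \<ge> 0" and ll: "log_lipschitz \<kappa> F"
    and hs: "\<And>v. ((\<lambda>k. a k * F (v - real k * l)) has_sum H v) UNIV"
  shows "\<exists>P. loc_bounded P \<and> (\<forall>v. P v - P (v - l) = F v) \<and> (\<forall>v. P v \<ge> 0)
    \<and> (\<forall>v. H v = w * P v + (\<Sum>k<K. (a k - w) * F (v - real k * l)))"
proof -
  \<comment> \<open>Solving the intended identity for \<open>P\<close> transfers the convergence of
    the series of \<open>H\<close> to the series with weight 1.\<close>
  define P where "P v = (H v - (\<Sum>k<K. (a k - w) * F (v - real k * l))) / w" for v
  have sm: "(\<lambda>k. F (v - real k * l)) sums P v" for v
  proof -
    have "(\<lambda>k. a k * F (v - real k * l)) sums H v" by (rule has_sum_imp_sums[OF hs])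
    moreover have "(\<lambda>k. if k \<in> {..<K} then (a k - w) * F (v - real k * l) else 0) sums (\<Sum>k<K. (a k - w) * F (v - real k * l))"
      by (rule sums_If_finite_set) simp
    ultimately have "(\<lambda>k. a k * F (v - real k * l) - (if k \<in> {..<K} then (a k - w) * F (v - real k * l) else 0)) sums (w * P v)"
      using sums_diff w by (fastforce simp: P_def)
    also have "(\<lambda>k. a k * F (v - real k * l) - (if k \<in> {..<K} then (a k - w) * F (v - real k * l) else 0))
       = (\<lambda>k. w * F (v - real k * l))"
      using a by (auto simp: algebra_simps not_less)
    finally show ?thesis using w sums_mult_D[of w "\<lambda>k. F (v - real k * l)"] by fastforce
  qed
  have hsP: "((\<lambda>k. 1 * F (v - real k * l)) has_sum P v) UNIV" for v
    using sums_nonneg_imp_has_sum[OF sm] F0 by simp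
  have P0: "P v \<ge> 0" for v by (rule has_sum_nonneg[OF hsP]) (use F0 in auto)
  have "log_lipschitz \<kappa> P"
    by (rule log_lipschitz_has_sum[OF _ log_lipschitz_shift[OF ll] hsP]) auto
  then have "loc_bounded P" using k P0 by (rule log_lipschitz_loc_bounded)
  moreover have "P v - P (v - l) = F v" for v
  proof -
    have "(\<lambda>k. F (v - real (Suc k) * l)) sums P (v - l)"
      using sm[of "v - l"] by (simp add: algebra_simps)
    then have "(\<lambda>k. F (v - real k * l)) sums (P (v - l) + F (v - real 0 * l))"
      by (subst (asm) sums_Suc_iff)
    then show ?thesis using sums_unique2[OF sm[of v]] by simp
  qed
  moreover have "H v = w * P v + (\<Sum>k<K. (a k - w) * F (v - real k * l))" for v
    using w by (simp add: P_def)
  ultimately show ?thesis using P0 by blast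
qed

text \<open>The case of a prime without a root in Z_p: the convolution is a finite sum of
  translates, and translation changes an exponential bound only by a constant factor.\<close>

lemma conv_decaying:
  fixes a :: "nat \<Rightarrow> real"
  assumes a: "\<And>k. a k \<ge> 0" "\<And>k. k \<ge> K \<Longrightarrow> a k = 0"
    and F: "\<And>v. F v \<le> C * exp (- \<delta> * v)"
    and hs: "\<And>v. ((\<lambda>k. a k * F (v - real k * l)) has_sum H v) UNIV"
  shows "\<exists>C. \<forall>v. H v \<le> C * exp (- \<delta> * v)"
proof -
  have "H v \<le> (\<Sum>k<K. a k * C * exp (\<delta> * (real k * l))) * exp (- \<delta> * v)" for v
  proof -
    have "((\<lambda>k. a k * F (v - real k * l)) has_sum (\<Sum>k<K. a k * F (v - real k * l))) {..<K}"
      by (rule has_sum_finite) simp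
    then have "((\<lambda>k. a k * F (v - real k * l)) has_sum (\<Sum>k<K. a k * F (v - real k * l))) UNIV"
      by (rule has_sum_cong_neutral[THEN iffD1, rotated -1]) (use a in auto)
    then have "H v = (\<Sum>k<K. a k * F (v - real k * l))" using hs has_sum_unique by blast
    also have "\<dots> \<le> (\<Sum>k<K. a k * (C * exp (- \<delta> * (v - real k * l))))"
      by (intro sum_mono mult_left_mono F a)
    also have "\<dots> = (\<Sum>k<K. a k * C * exp (\<delta> * (real k * l))) * exp (- \<delta> * v)"
      unfolding sum_distrib_right by (intro sum.cong refl) (simp add: exp_add[symmetric] algebra_simps)
    finally show ?thesis .
  qed
  then show ?thesis by blast
qed

text \<open>The difference with step \<open>l\<close> leaves \<open>w * F\<close> and finitely many
  translates of \<open>F\<close>, all decaying. For the lower bound one term suffices: the translate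
  whose argument lies in \<open>[0, l]\<close>, where the log-Lipschitz property bounds
  \<open>F\<close> below by \<open>exp (- \<kappa> * l) * F 0\<close>.\<close>

lemma conv_of_decaying:
  fixes a :: "nat \<Rightarrow> real"
  assumes w: "w > 0" and a: "\<And>k. k \<ge> K \<Longrightarrow> a k = w" "\<And>k. a k \<ge> 0"
    and F0: "\<And>v. F v > 0" and k: "\<kappa> \<ge> 0" and ll: "log_lipschitz \<kappa> F" and l: "l > 0"
    and F: "\<And>v. F v \<le> C * exp (- \<delta> * v)"
    and hs: "\<And>v. ((\<lambda>k. a k * F (v - real k * l)) has_sum H v) UNIV"
  shows "\<exists>C. \<forall>v. \<bar>H v - H (v - l)\<bar> \<le> C * exp (- \<delta> * v)"
    and "\<exists>c>0. \<forall>\<^sub>F v in at_top. c \<le> H v"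
proof -
  have F0': "F v \<ge> 0" for v using F0[of v] by simp
  obtain P where "(\<forall>v. P v - P (v - l) = F v) \<and> (\<forall>v. H v = w * P v + (\<Sum>k<K. (a k - w) * F (v - real k * l)))"
    using conv_decompose[OF w a(1) F0' k ll hs] by blast
  then have P: "\<And>v. P v - P (v - l) = F v" "\<And>v. H v = w * P v + (\<Sum>k<K. (a k - w) * F (v - real k * l))"
    by blast+
  have "\<bar>H v - H (v - l)\<bar> \<le> (w * C + (\<Sum>k<K. \<bar>a k - w\<bar> * (C * exp (\<delta> * (real k * l)) + C * exp (\<delta> * (l + real k * l))))) * exp (- \<delta> * v)" for v
  proof -
    have e: "C * exp (- \<delta> * (v - c)) = C * exp (\<delta> * c) * exp (- \<delta> * v)" for c
      by (simp add: exp_add[symmetric] algebra_simps)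
    have ring: "w * x + A - (w * y + B) = w * (x - y) + (A - B)" for x y A B
      by (simp add: algebra_simps)
    have sub: "(\<Sum>k<K. (a k - w) * (F (v - real k * l) - F (v - (l + real k * l)))) =
        (\<Sum>k<K. (a k - w) * F (v - real k * l)) - (\<Sum>k<K. (a k - w) * F (v - l - real k * l))"
      by (simp only: right_diff_distrib sum_subtractf diff_diff_eq)
    have "H v - H (v - l) = w * (P v - P (v - l)) + (\<Sum>k<K. (a k - w) * (F (v - real k * l) - F (v - (l + real k * l))))"
      unfolding sub P(2)[of v] P(2)[of "v - l"] by (rule ring)
    then have "\<bar>H v - H (v - l)\<bar> = \<bar>w * F v + (\<Sum>k<K. (a k - w) * (F (v - real k * l) - F (v - (l + real k * l))))\<bar>"
      by (simp only: P(1))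
    also have "\<dots> \<le> \<bar>w * F v\<bar> + \<bar>\<Sum>k<K. (a k - w) * (F (v - real k * l) - F (v - (l + real k * l)))\<bar>"
      by (rule abs_triangle_ineq)
    also have "\<bar>w * F v\<bar> = w * F v" using w F0'[of v] by (intro abs_of_nonneg mult_nonneg_nonneg) auto
    also have "w * F v + \<bar>\<Sum>k<K. (a k - w) * (F (v - real k * l) - F (v - (l + real k * l)))\<bar> \<le> w * (C * exp (- \<delta> * v)) + (\<Sum>k<K. \<bar>a k - w\<bar> * (C * exp (- \<delta> * (v - real k * l)) + C * exp (- \<delta> * (v - (l + real k * l)))))"
    proof (rule add_mono[OF mult_left_mono[OF F] order_trans[OF sum_abs sum_mono]])
      fix j
      have "\<bar>F (v - real j * l) - F (v - (l + real j * l))\<bar> \<le> C * exp (- \<delta> * (v - real j * l)) + C * exp (- \<delta> * (v - (l + real j * l)))"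
        using F[of "v - real j * l"] F[of "v - (l + real j * l)"] F0'[of "v - real j * l"] F0'[of "v - (l + real j * l)"] by linarith
      then show "\<bar>(a j - w) * (F (v - real j * l) - F (v - (l + real j * l)))\<bar> \<le> \<bar>a j - w\<bar> * (C * exp (- \<delta> * (v - real j * l)) + C * exp (- \<delta> * (v - (l + real j * l))))"
        unfolding abs_mult by (rule mult_left_mono) simp
    qed (use w in auto)
    also have "\<dots> = (w * C + (\<Sum>k<K. \<bar>a k - w\<bar> * (C * exp (\<delta> * (real k * l)) + C * exp (\<delta> * (l + real k * l))))) * exp (- \<delta> * v)"
      unfolding e distrib_right sum_distrib_right by (simp only: distrib_right distrib_left mult.assoc)
    finally show ?thesis .
  qed
  then show "\<exists>C. \<forall>v. \<bar>H v - H (v - l)\<bar> \<le> C * exp (- \<delta> * v)" by blast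
  define c where "c = w * (exp (- \<kappa> * l) * F 0)"
  have "c > 0" using w F0 by (simp add: c_def)
  moreover have "c \<le> H v" if v: "v \<ge> real K * l" for v
  proof -
    define m where "m = nat \<lfloor>v / l\<rfloor>"
    have vl: "v / l \<ge> real K" using v l by (simp add: field_simps)
    then have m: "real m \<le> v / l" "v / l < real m + 1" by (simp_all add: m_def)
    then have mK: "m \<ge> K" using vl by linarith
    have r: "0 \<le> v - real m * l" "v - real m * l \<le> l" using m l by (simp_all add: field_simps)
    have "F 0 \<le> exp (\<kappa> * \<bar>0 - (v - real m * l)\<bar>) * F (v - real m * l)" by (rule log_lipschitzD[OF ll])
    also have "\<dots> \<le> exp (\<kappa> * l) * F (v - real m * l)"
      using r k F0' by (intro mult_right_mono) (auto intro!: mult_left_mono)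
    finally have "exp (- \<kappa> * l) * F 0 \<le> exp (- \<kappa> * l) * (exp (\<kappa> * l) * F (v - real m * l))"
      by (intro mult_left_mono) auto
    also have "\<dots> = F (v - real m * l)" by (simp add: mult.assoc[symmetric] exp_add[symmetric])
    finally have "c \<le> a m * F (v - real m * l)" using w a(1)[OF mK] by (simp add: c_def)
    also have "\<dots> = (\<Sum>k\<in>{m}. a k * F (v - real k * l))" by simp
    also have "\<dots> \<le> H v"
      by (rule has_sum_mono_neutral[OF has_sum_finite hs]) (use a(2) F0' in auto)
    finally show ?thesis .
  qed
  then have "\<forall>\<^sub>F v in at_top. c \<le> H v" unfolding eventually_at_top_linorder by blast
  ultimately show "\<exists>c>0. \<forall>\<^sub>F v in at_top. c \<le> H v" by blast
qed

lemma tendsto_shift_divide_power: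
  fixes F :: "real \<Rightarrow> real"
  assumes "((\<lambda>v. F v / v ^ r) \<longlongrightarrow> c) at_top"
  shows "((\<lambda>v. F (v - d) / v ^ r) \<longlongrightarrow> c) at_top"
proof -
  have "((\<lambda>v. (F (v - d) / (v - d) ^ r) * ((v - d) / v) ^ r) \<longlongrightarrow> c * 1 ^ r) at_top"
  proof (intro tendsto_intros)
    show "((\<lambda>v. F (v - d) / (v - d) ^ r) \<longlongrightarrow> c) at_top"
      by (rule filterlim_compose[OF assms]) real_asymp
    show "((\<lambda>v. (v - d) / v) \<longlongrightarrow> 1) at_top" by real_asymp
  qed
  moreover have "\<forall>\<^sub>F v in at_top. (F (v - d) / (v - d) ^ r) * ((v - d) / v) ^ r = F (v - d) / v ^ r"
    using eventually_gt_at_top[of d] by eventually_elim (simp add: power_divide)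
  ultimately show ?thesis by (simp add: filterlim_cong)
qed

text \<open>\<open>growth_step\<close> handles the constant-weight part; the finitely many
  corrections grow only like \<open>v ^ r\<close> and disappear after division by
  \<open>v ^ Suc r\<close>.\<close>

lemma conv_growth:
  fixes a :: "nat \<Rightarrow> real"
  assumes w: "w > 0" and a: "\<And>k. k \<ge> K \<Longrightarrow> a k = w"
    and F0: "\<And>v. F v \<ge> 0" and k: "\<kappa> \<ge> 0" and ll: "log_lipschitz \<kappa> F" and l: "l > 0"
    and lim: "((\<lambda>v. F v / v ^ r) \<longlongrightarrow> c) at_top"
    and hs: "\<And>v. ((\<lambda>k. a k * F (v - real k * l)) has_sum H v) UNIV"
  shows "((\<lambda>v. H v / v ^ Suc r) \<longlongrightarrow> w * (c / (l * real (Suc r)))) at_top"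
proof -
  obtain P where "loc_bounded P \<and> (\<forall>v. P v - P (v - l) = F v)
      \<and> (\<forall>v. H v = w * P v + (\<Sum>k<K. (a k - w) * F (v - real k * l)))"
    using conv_decompose[OF w a F0 k ll hs] by blast
  then have P: "loc_bounded P" "\<And>v. P v - P (v - l) = F v" 
      "\<And>v. H v = w * P v + (\<Sum>k<K. (a k - w) * F (v - real k * l))"
    by blast+
  have "((\<lambda>v. w * (P v / v ^ Suc r) + (\<Sum>k<K. (a k - w) * (F (v - real k * l) / v ^ r)) * (1 / v))
      \<longlongrightarrow> w * (c / (l * real (Suc r))) + (\<Sum>k<K. (a k - w) * c) * 0) at_top"
    by (intro tendsto_intros growth_step[OF l P(1,2) lim] tendsto_shift_divide_power[OF lim]) real_asymp
  moreover have "\<forall>\<^sub>F v in at_top. w * (P v / v ^ Suc r) + (\<Sum>k<K. (a k - w) * (F (v - real k * l) / v ^ r)) * (1 / v)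
     = H v / v ^ Suc r"
    using eventually_gt_at_top[of 0]
    by eventually_elim (simp add: P(3) add_divide_distrib sum_divide_distrib sum_distrib_right mult.commute)
  ultimately show ?thesis by (simp add: filterlim_cong)
qed

text \<open>Rules out a vanishing growth rate: along an arithmetic progression with step
  \<open>l\<close> the function gains at least \<open>c\<close> per step, so the limit is at least
  \<open>c / l\<close>.\<close>

lemma difference_limit_pos:
  fixes P :: "real \<Rightarrow> real"
  assumes l: "l > 0" and c: "c > 0" and P0: "\<And>v. P v \<ge> 0"
    and d: "\<forall>\<^sub>F v in at_top. c \<le> P v - P (v - l)" and lim: "((\<lambda>v. P v / v) \<longlongrightarrow> x) at_top"
  shows "x > 0"
proof -
  obtain V0 where V0: "\<And>v. v \<ge> V0 \<Longrightarrow> c \<le> P v - P (v - l)" using d by (auto simp: eventually_at_top_linorder)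
  define V where "V = max V0 1"
  have b: "real m * c \<le> P (V + real m * l)" for m
  proof (induction m)
    case (Suc m)
    have "c \<le> P (V + real (Suc m) * l) - P (V + real (Suc m) * l - l)"
      using l by (intro V0) (auto simp: V_def add_increasing2)
    then show ?case using Suc by (simp add: algebra_simps)
  qed (use P0 in simp)
  have "filterlim (\<lambda>m. V + real m * l) at_top sequentially" using l by real_asymp
  then have "(\<lambda>m. P (V + real m * l) / (V + real m * l)) \<longlonglongrightarrow> x" by (rule filterlim_compose[OF lim])
  moreover have "(\<lambda>m. real m * c / (V + real m * l)) \<longlonglongrightarrow> c * inverse l" using l c by real_asymp
  moreover have "real m * c / (V + real m * l) \<le> P (V + real m * l) / (V + real m * l)" for m
    using b l by (intro divide_right_mono) (auto simp: V_def)
  ultimately have "c * inverse l \<le> x" by (intro LIMSEQ_le) auto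
  moreover have "0 < c * inverse l" using l c by simp
  ultimately show ?thesis by linarith
qed

text \<open>The analytic content without arithmetic: \<open>U T\<close> models the bump convolved
  with the weights of the primes in \<open>T\<close>. Because \<open>step\<close> may insert any new
  element into any \<open>T\<close>, the order of insertion can be chosen; the sign of the eventual
  weight \<open>w p\<close> decides which of the convolution lemmas applies.\<close>

locale iterated_convolution =
  fixes S :: "nat set" and a :: "nat \<Rightarrow> nat \<Rightarrow> real" and L w :: "nat \<Rightarrow> real"
    and U :: "nat set \<Rightarrow> real \<Rightarrow> real" and \<kappa> \<delta> C :: real
  assumes fin: "finite S" and L: "\<And>p. p \<in> S \<Longrightarrow> L p > 0" and a0: "\<And>p k. p \<in> S \<Longrightarrow> a p k \<ge> 0"
    and a_pos: "\<And>p. p \<in> S \<Longrightarrow> \<exists>k. a p k > 0"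
    and a_ev: "\<And>p. p \<in> S \<Longrightarrow> \<forall>\<^sub>F k in sequentially. a p k = w p"
    and irr: "\<And>p q. p \<in> S \<Longrightarrow> q \<in> S \<Longrightarrow> p \<noteq> q \<Longrightarrow> L q / L p \<notin> \<rat>"
    and k0: "\<kappa> \<ge> 0" and d0: "\<delta> > 0"
    and U_empty: "\<And>v. U {} v > 0" "\<And>v. U {} v \<le> C * exp (- \<delta> * v)"
    and ll: "\<And>T. T \<subseteq> S \<Longrightarrow> log_lipschitz \<kappa> (U T)"
    and step: "\<And>T p v. T \<subseteq> S \<Longrightarrow> p \<in> S \<Longrightarrow> p \<notin> T \<Longrightarrow>
      ((\<lambda>k. a p k * U T (v - real k * L p)) has_sum U (insert p T) v) UNIV"
begin

lemma w0: "p \<in> S \<Longrightarrow> w p \<ge> 0"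
proof -
  assume "p \<in> S"
  then obtain k where "a p k = w p" using eventually_happens[OF a_ev] by force
  then show "w p \<ge> 0" using a0[OF \<open>p \<in> S\<close>, of k] by simp
qed

lemma a_evD:
  assumes "p \<in> S"
  obtains K where "\<And>k. k \<ge> K \<Longrightarrow> a p k = w p"
  using a_ev[OF assms] unfolding eventually_sequentially by blast

lemma U_pos:
  assumes "T \<subseteq> S"
  shows "U T v > 0"
proof -
  have "finite T" using assms fin finite_subset by blast
  then show ?thesis using assms
  proof (induction T arbitrary: v rule: finite_induct)
    case empty
    then show ?case using U_empty by simp
  next
    case (insert p T)
    obtain k where k: "a p k > 0" using a_pos insert by blast
    have "0 < (\<Sum>k\<in>{k}. a p k * U T (v - real k * L p))" using k insert by simp
    also have "\<dots> \<le> U (insert p T) v"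
      by (rule has_sum_mono_neutral[OF has_sum_finite step])
        (use insert a0 in \<open>auto simp: less_imp_le\<close>)
    finally show ?case .
  qed
qed

lemma U_nonneg: "T \<subseteq> S \<Longrightarrow> U T v \<ge> 0"
  using U_pos less_imp_le by blast

lemma U_decaying:
  assumes "T \<subseteq> S" "\<And>p. p \<in> T \<Longrightarrow> w p = 0"
  shows "\<exists>C. \<forall>v. U T v \<le> C * exp (- \<delta> * v)"
proof -
  have "finite T" using assms fin finite_subset by blast
  then show ?thesis using assms
  proof (induction T rule: finite_induct)
    case empty
    then show ?case using U_empty by blast
  next
    case (insert p T)
    then obtain C where C: "\<And>v. U T v \<le> C * exp (- \<delta> * v)" by auto
    have p: "p \<in> S" "w p = 0" "T \<subseteq> S" using insert by auto
    obtain K where "\<And>k. k \<ge> K \<Longrightarrow> a p k = w p" using a_evD[OF p(1)] by blast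
    then show ?case
      using conv_decaying[of "a p" K "U T" C \<delta> "L p" "U (insert p T)"] a0 C step[OF p(3,1)] insert.hyps p by simp
  qed
qed

lemma U_one:
  assumes "T \<subseteq> S" "\<And>p. p \<in> T \<Longrightarrow> w p = 0" "q \<in> S" "w q > 0"
  shows "\<exists>C. \<forall>v. \<bar>U (insert q T) v - U (insert q T) (v - L q)\<bar> \<le> C * exp (- \<delta> * v)"
    and "\<exists>c>0. \<forall>\<^sub>F v in at_top. c \<le> U (insert q T) v"
proof -
  have q: "q \<notin> T" using assms by fastforce
  obtain K where K: "\<And>k. k \<ge> K \<Longrightarrow> a q k = w q" using a_evD[OF assms(3)] by blast
  obtain C where C: "\<And>v. U T v \<le> C * exp (- \<delta> * v)" using U_decaying[OF assms(1,2)] by blast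
  note * = conv_of_decaying[OF assms(4) K a0[OF assms(3)] U_pos[OF assms(1)] k0 ll[OF assms(1)]
      L[OF assms(3)] C step[OF assms(1,3) q]]
  show "\<exists>C. \<forall>v. \<bar>U (insert q T) v - U (insert q T) (v - L q)\<bar> \<le> C * exp (- \<delta> * v)" by (rule *(1))
  show "\<exists>c>0. \<forall>\<^sub>F v in at_top. c \<le> U (insert q T) v" by (rule *(2))
qed

lemma U_one_bounds:
  assumes "T \<subseteq> S" "\<And>p. p \<in> T \<Longrightarrow> w p = 0" "q \<in> S" "w q > 0"
  shows "\<exists>c1>0. \<exists>c2>0. \<forall>\<^sub>F v in at_top. c1 \<le> U (insert q T) v \<and> U (insert q T) v \<le> c2"
proof -
  have qT: "insert q T \<subseteq> S" using assms by blast
  obtain C where C: "\<And>v. \<bar>U (insert q T) v - U (insert q T) (v - L q)\<bar> \<le> C * exp (- \<delta> * v)"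
    using U_one(1)[OF assms] by blast
  obtain G M where G: "\<forall>v. \<bar>G v\<bar> \<le> M" "((\<lambda>v. U (insert q T) v - G v) \<longlongrightarrow> 0) at_top"
    using asymptotically_periodic[OF L[OF assms(3)] d0 k0 U_nonneg[OF qT] ll[OF qT] C] by blast
  have "\<forall>\<^sub>F v in at_top. dist (U (insert q T) v - G v) 0 < 1" using G(2) by (rule tendstoD) simp
  then have "\<forall>\<^sub>F v in at_top. U (insert q T) v \<le> M + 1"
  proof eventually_elim
    case (elim v)
    then show ?case using G(1)[rule_format, of v] unfolding dist_real_def by linarith
  qed
  moreover have "M \<ge> 0" using G(1)[rule_format, of 0] by linarith
  moreover obtain c where "c > 0" "\<forall>\<^sub>F v in at_top. c \<le> U (insert q T) v" using U_one(2)[OF assms] by blast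
  ultimately show ?thesis
    by (intro exI[of _ c] conjI exI[of _ "M + 1"] eventually_conj) auto
qed

text \<open>Existence of the limit comes from the irrational step and positivity from the lower
  bound for one prime. The corrections in the decomposition are translates of a function that is
  eventually bounded, hence vanish after division by \<open>v\<close>.\<close>

lemma U_two:
  assumes "T \<subseteq> S" "\<And>p. p \<in> T \<Longrightarrow> w p = 0" "q \<in> S" "w q > 0" "r \<in> S" "w r > 0" "q \<noteq> r"
  shows "\<exists>c>0. ((\<lambda>v. U (insert r (insert q T)) v / v ^ 1) \<longlongrightarrow> c) at_top"
proof -
  have qT: "insert q T \<subseteq> S" and r: "r \<notin> insert q T" using assms by fastforce+
  obtain K where K: "\<And>k. k \<ge> K \<Longrightarrow> a r k = w r" using a_evD[OF assms(5)] by blast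
  obtain C where C: "\<And>v. \<bar>U (insert q T) v - U (insert q T) (v - L q)\<bar> \<le> C * exp (- \<delta> * v)"
    using U_one(1)[OF assms(1-4)] by blast
  obtain P where "loc_bounded P \<and> (\<forall>v. P v - P (v - L r) = U (insert q T) v) \<and> (\<forall>v. P v \<ge> 0)
      \<and> (\<forall>v. U (insert r (insert q T)) v = w r * P v + (\<Sum>k<K. (a r k - w r) * U (insert q T) (v - real k * L r)))"
    using conv_decompose[OF assms(6) K U_nonneg[OF qT] k0 ll[OF qT] step[OF qT assms(5) r]] by blast
  then have P: "loc_bounded P" "\<And>v. P v - P (v - L r) = U (insert q T) v" "\<And>v. P v \<ge> 0"
      "\<And>v. U (insert r (insert q T)) v = w r * P v + (\<Sum>k<K. (a r k - w r) * U (insert q T) (v - real k * L r))"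
    by blast+
  obtain x where x: "((\<lambda>v. P v / v) \<longlongrightarrow> x) at_top"
    using linear_growth_irrational[OF L[OF assms(3)] L[OF assms(5)] irr[OF assms(3,5,7)] d0 k0
        U_nonneg[OF qT] ll[OF qT] C P(1,2)] by blast
  obtain c1 c2 where c: "c1 > 0" "c2 > 0" 
    and ev: "\<forall>\<^sub>F v in at_top. c1 \<le> U (insert q T) v \<and> U (insert q T) v \<le> c2"
    using U_one_bounds[OF assms(1-4)] by blast
  have "x > 0"
    by (rule difference_limit_pos[OF L[OF assms(5)] c(1) P(3) _ x])
      (use ev in \<open>auto simp: P(2) elim: eventually_mono\<close>)
  have small: "((\<lambda>v. U (insert q T) v / v ^ 1) \<longlongrightarrow> 0) at_top"
  proof (rule Lim_null_comparison)
    show "\<forall>\<^sub>F v in at_top. norm (U (insert q T) v / v ^ 1) \<le> c2 / v"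
      using ev eventually_gt_at_top[of 0]
      by eventually_elim (use U_nonneg[OF qT] in \<open>auto intro!: divide_right_mono\<close>)
    show "((\<lambda>v. c2 / v) \<longlongrightarrow> 0) at_top" by real_asymp
  qed
  have "((\<lambda>v. w r * (P v / v) + (\<Sum>k<K. (a r k - w r) * (U (insert q T) (v - real k * L r) / v ^ 1)))
     \<longlongrightarrow> w r * x + (\<Sum>k<K. (a r k - w r) * 0)) at_top"
    by (intro tendsto_intros x tendsto_shift_divide_power[OF small])
  then have "((\<lambda>v. U (insert r (insert q T)) v / v ^ 1) \<longlongrightarrow> w r * x) at_top"
    by (simp add: P(4) add_divide_distrib sum_divide_distrib)
  then show ?thesis using \<open>x > 0\<close> assms(6) by (intro exI[of _ "w r * x"]) auto
qed

lemma U_growth_extend: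
  assumes "T0 \<subseteq> S" "((\<lambda>v. U T0 v / v ^ m) \<longlongrightarrow> c) at_top" "c > 0"
    and "finite T" "T \<subseteq> S" "T \<inter> T0 = {}" "\<And>p. p \<in> T \<Longrightarrow> w p > 0"
  shows "\<exists>c>0. ((\<lambda>v. U (T \<union> T0) v / v ^ (m + card T)) \<longlongrightarrow> c) at_top"
  using assms(4-)
proof (induction T rule: finite_induct)
  case empty
  then show ?case using assms(2,3) by auto
next
  case (insert p T)
  then obtain c where c: "c > 0" "((\<lambda>v. U (T \<union> T0) v / v ^ (m + card T)) \<longlongrightarrow> c) at_top" by auto
  have T: "T \<union> T0 \<subseteq> S" "p \<in> S" "p \<notin> T \<union> T0" "w p > 0" using insert assms(1) by auto
  obtain K where K: "\<And>k. k \<ge> K \<Longrightarrow> a p k = w p" using a_evD[OF T(2)] by blast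
  have "((\<lambda>v. U (insert p (T \<union> T0)) v / v ^ Suc (m + card T)) \<longlongrightarrow> w p * (c / (L p * real (Suc (m + card T))))) at_top"
    by (rule conv_growth[OF T(4) K U_nonneg[OF T(1)] k0 ll[OF T(1)] L[OF T(2)] c(2) step[OF T(1-3)]])
  moreover have "w p * (c / (L p * real (Suc (m + card T)))) > 0"
    using T c L[OF T(2)] by (intro mult_pos_pos divide_pos_pos) auto
  ultimately show ?case using insert.hyps by auto
qed

theorem U_asymptotics:
  assumes S': "S' = {p \<in> S. w p > 0}"
  shows "card S' = 1 \<Longrightarrow> \<exists>c1>0. \<exists>c2>0. \<forall>\<^sub>F v in at_top. c1 \<le> U S v \<and> U S v \<le> c2"
    and "card S' \<ge> 2 \<Longrightarrow> \<exists>c>0. ((\<lambda>v. U S v / v ^ (card S' - 1)) \<longlongrightarrow> c) at_top"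
proof -
  define T where "T = S - S'"
  have T: "T \<subseteq> S" "\<And>p. p \<in> T \<Longrightarrow> w p = 0" using w0 by (force simp: T_def S')+
  have fin': "finite S'" using fin by (simp add: S')
  {
    assume "card S' = 1"
    then obtain q where q: "S' = {q}" by (rule card_1_singletonE)
    then have "q \<in> S" "w q > 0" "S = insert q T" by (auto simp: S' T_def)
    then show "\<exists>c1>0. \<exists>c2>0. \<forall>\<^sub>F v in at_top. c1 \<le> U S v \<and> U S v \<le> c2"
      using U_one_bounds[OF T, of q] by simp
  }
  {
    assume c2: "card S' \<ge> 2"
    then obtain q where q: "q \<in> S'" by (metis card.empty ex_in_conv not_numeral_le_zero)
    then have "card (S' - {q}) \<ge> 1" using c2 fin' by simp
    then obtain r where r: "r \<in> S' - {q}" by (metis card.empty ex_in_conv not_one_le_zero)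
    define T0 where "T0 = insert r (insert q T)"
    obtain c where c: "c > 0" "((\<lambda>v. U T0 v / v ^ 1) \<longlongrightarrow> c) at_top"
      using U_two[OF T, of q r] q r by (auto simp: S' T0_def)
    define R where "R = S' - {q, r}"
    have R: "finite R" "R \<subseteq> S" "R \<inter> T0 = {}" "\<And>p. p \<in> R \<Longrightarrow> w p > 0"
      using fin' by (auto simp: R_def S' T0_def T_def)
    have "T0 \<subseteq> S" using T q r by (auto simp: T0_def S')
    then obtain c' where c': "c' > 0" "((\<lambda>v. U (R \<union> T0) v / v ^ (1 + card R)) \<longlongrightarrow> c') at_top"
      using U_growth_extend[OF _ c(2,1) R] by blast
    have "R \<union> T0 = S" using q r by (auto simp: R_def T0_def T_def S')
    moreover have "card R = card S' - 2" using q r fin' by (simp add: R_def card_Diff_subset)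
    then have "1 + card R = card S' - 1" using c2 by simp
    ultimately show "\<exists>c>0. ((\<lambda>v. U S v / v ^ (card S' - 1)) \<longlongrightarrow> c) at_top"
      using c' by metis
  }
qed

end

section \<open>Sums over smooth numbers\<close>

definition smooth_nats :: "nat set \<Rightarrow> nat set" where
  "smooth_nats S = {Q. Q > 0 \<and> prime_factors Q \<subseteq> S}"

lemma smooth_nats_empty: "smooth_nats {} = {1}"
  by (auto simp: smooth_nats_def prime_factorization_empty_iff)

lemma prime_factors_power_mult:
  assumes "prime p" "(Q::nat) > 0"
  shows "prime_factors (p ^ k * Q) = (if k = 0 then {} else {p}) \<union> prime_factors Q"
  using assms
  by (auto simp: prime_factors_dvd prime_dvd_mult_iff prime_dvd_power_iff primes_dvd_imp_eq dest: prime_dvd_power)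

lemma multiplicity_power_mult:
  fixes p q Q :: nat
  assumes "prime p" "prime q" "Q > 0"
  shows "multiplicity q (p ^ k * Q) = (if q = p then k else 0) + multiplicity q Q"
  using assms by (auto simp: prime_elem_multiplicity_mult_distrib multiplicity_distinct_prime_power
      prime_elem_multiplicity_power_distrib prime_multiplicity_other)

lemma smooth_nats_insert_bij:
  assumes "prime p" "p \<notin> S"
  shows "bij_betw (\<lambda>(k, Q). p ^ k * Q) (UNIV \<times> smooth_nats S) (smooth_nats (insert p S))"
proof -
  have p0: "p > 0" using assms(1) prime_gt_0_nat by simp
  have mult0: "multiplicity p Q = 0" if "Q \<in> smooth_nats S" for Q
    using that assms by (auto simp: smooth_nats_def prime_factors_dvd intro!: not_dvd_imp_multiplicity_0)
  have mult: "multiplicity p (p ^ k * Q) = k" if "Q \<in> smooth_nats S" for k Q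
    using multiplicity_power_mult[OF assms(1,1), of Q k] mult0[OF that] that by (simp add: smooth_nats_def)
  show ?thesis
  proof (rule bij_betw_byWitness[where f' = "\<lambda>n. (multiplicity p n, n div p ^ multiplicity p n)"])
    show "\<forall>a\<in>UNIV \<times> smooth_nats S. (\<lambda>n. (multiplicity p n, n div p ^ multiplicity p n)) ((\<lambda>(k, Q). p ^ k * Q) a) = a"
      using mult p0 by auto
    show "\<forall>n\<in>smooth_nats (insert p S). (\<lambda>(k, Q). p ^ k * Q) (multiplicity p n, n div p ^ multiplicity p n) = n"
      by (auto simp: multiplicity_dvd)
    show "(\<lambda>(k, Q). p ^ k * Q) ` (UNIV \<times> smooth_nats S) \<subseteq> smooth_nats (insert p S)"
      using p0 assms(1) by (auto simp: smooth_nats_def prime_factors_power_mult split: if_splits)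
    show "(\<lambda>n. (multiplicity p n, n div p ^ multiplicity p n)) ` smooth_nats (insert p S) \<subseteq> UNIV \<times> smooth_nats S"
    proof clarsimp
      fix n assume n: "n \<in> smooth_nats (insert p S)"
      then have n0: "n > 0" "prime_factors n \<subseteq> insert p S" by (auto simp: smooth_nats_def)
      define k where "k = multiplicity p n"
      obtain y where y: "n = p ^ k * y" "\<not> p dvd y"
        using multiplicity_decompose'[of n p] n0 assms(1) unfolding k_def by (metis not_prime_unit not_gr_zero)
      have y0: "y > 0" using n0 y by (cases "y = 0") auto
      have "prime_factors y \<subseteq> S"
        using n0(2) y(2) unfolding y(1) prime_factors_power_mult[OF assms(1) y0] by (auto simp: prime_factors_dvd)
      moreover have "n div p ^ k = y" using y p0 by simp
      ultimately show "n div p ^ multiplicity p n \<in> smooth_nats S"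
        using y0 by (simp add: smooth_nats_def k_def[symmetric])
    qed
  qed
qed

text \<open>The Euler product over \<open>S\<close>: each prime contributes a geometric series with
  ratio \<open>p powr - \<eta>\<close>.\<close>

lemma summable_smooth_nats_powr:
  assumes "finite S" "\<forall>p\<in>S. prime p" "\<eta> > 0"
  shows "(\<lambda>Q. real Q powr - \<eta>) summable_on smooth_nats S"
  using assms(1,2)
proof (induction S rule: finite_induct)
  case empty
  then show ?case by (simp add: smooth_nats_empty)
next
  case (insert p S)
  then have p: "prime p" "p > 1" using prime_gt_1_nat by auto
  define x where "x = real p powr - \<eta>"
  have x: "0 < x" "x < 1" using p assms(3) by (auto simp: x_def powr_less_one)
  define Z where "Z = infsum (\<lambda>Q. real Q powr - \<eta>) (smooth_nats S)"
  have "(\<lambda>(k, Q). x ^ k * real Q powr - \<eta>) summable_on (UNIV \<times> smooth_nats S)"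
  proof (rule summable_on_SigmaI)
    show "((\<lambda>Q. case (k, Q) of (k, Q) \<Rightarrow> x ^ k * real Q powr - \<eta>) has_sum (x ^ k * Z)) (smooth_nats S)" for k :: nat
      using insert unfolding Z_def by (auto intro!: has_sum_cmult_right has_sum_infsum)
    have "summable (\<lambda>k. x ^ k)" using x by (intro summable_geometric) auto
    then have "(\<lambda>k. x ^ k) summable_on UNIV"
      using x by (subst summable_on_UNIV_nonneg_real_iff) auto
    then show "(\<lambda>k. x ^ k * Z) summable_on UNIV" by (rule summable_on_cmult_left)
  qed (use x in auto)
  also have "(\<lambda>(k, Q). x ^ k * real Q powr - \<eta>) = (\<lambda>z. (\<lambda>n. real n powr - \<eta>) ((\<lambda>(k, Q). p ^ k * Q) z))"
    using p by (auto simp: fun_eq_iff x_def powr_mult powr_realpow[symmetric] powr_powr mult.commute)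
  finally show ?case
    using summable_on_reindex_bij_betw[OF smooth_nats_insert_bij[OF p(1) insert.hyps(2)]] by blast
qed

lemma ln_prime_ratio_irrational:
  fixes p q :: nat
  assumes "prime p" "prime q" "p \<noteq> q"
  shows "ln (real q) / ln (real p) \<notin> \<rat>"
proof
  assume rat: "ln (real q) / ln (real p) \<in> \<rat>"
  have pq: "p > 1" "q > 1" using assms prime_gt_1_nat by auto
  then have pos: "ln (real p) > 0" "ln (real q) > 0" by auto
  obtain m n :: nat where mn: "n \<noteq> 0" "\<bar>ln (real q) / ln (real p)\<bar> = real m / real n"
    using Rats_abs_nat_div_natE[OF rat] by metis
  then have "ln (real q) / ln (real p) = real m / real n" using pos by simp
  then have "real n * ln (real q) = real m * ln (real p)" using pos mn(1) by (simp add: field_simps)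
  then have "ln (real (q ^ n)) = ln (real (p ^ m))" using pq by (simp add: ln_realpow)
  then have "real (q ^ n) = real (p ^ m)" using pq by (subst (asm) ln_inj_iff) auto
  then have "q ^ n = p ^ m" by (simp only: of_nat_eq_iff)
  then have "q dvd p ^ m" using mn(1) by (metis dvd_power gr0I)
  then have "q dvd p" using assms prime_dvd_power by blast
  then show False using assms primes_dvd_imp_eq by blast
qed

text \<open>\<open>capped \<theta> (ln Q - v)\<close> is \<open>min B (Q\<^sup>\<theta>)\<close> up to the factor that makes it a function of
  the difference \<open>ln Q - v\<close> alone, where \<open>B = exp (\<theta> * v)\<close>.\<close>

definition capped :: "real \<Rightarrow> real \<Rightarrow> real" where
  "capped \<theta> t = min (exp (- t)) (exp ((\<theta> - 1) * t))"

lemma capped_pos: "capped \<theta> t > 0"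
  by (simp add: capped_def)

lemma capped_le: "capped \<theta> t \<le> exp (- t)" "capped \<theta> t \<le> exp ((\<theta> - 1) * t)"
  by (simp_all add: capped_def)

text \<open>The constant is the larger of the two absolute slopes, 1 and
  \<open>\<theta> - 1\<close>, of the exponents of which \<open>capped\<close> takes the
  minimum.\<close>

lemma log_lipschitz_capped:
  assumes "\<theta> > 1"
  shows "log_lipschitz (max 1 (\<theta> - 1)) (\<lambda>v. capped \<theta> (c - v))"
  unfolding log_lipschitz_def
proof (intro allI)
  fix s t :: real
  let ?k = "max 1 (\<theta> - 1)"
  have "s - t \<le> 1 * \<bar>s - t\<bar>" "1 * \<bar>s - t\<bar> \<le> ?k * \<bar>s - t\<bar>" by (simp, intro mult_right_mono) auto
  then have "s - c \<le> ?k * \<bar>s - t\<bar> + (t - c)" by linarith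
  then have 1: "exp (- (c - s)) \<le> exp (?k * \<bar>s - t\<bar>) * exp (- (c - t))"
    by (simp add: exp_add[symmetric])
  have "(\<theta> - 1) * (t - s) \<le> (\<theta> - 1) * \<bar>s - t\<bar>" "(\<theta> - 1) * \<bar>s - t\<bar> \<le> ?k * \<bar>s - t\<bar>"
    using assms by (intro mult_left_mono mult_right_mono; simp)+
  then have "(\<theta> - 1) * (c - s) \<le> ?k * \<bar>s - t\<bar> + (\<theta> - 1) * (c - t)" by (simp add: algebra_simps)
  then have 2: "exp ((\<theta> - 1) * (c - s)) \<le> exp (?k * \<bar>s - t\<bar>) * exp ((\<theta> - 1) * (c - t))"
    unfolding exp_add[symmetric] by simp
  have "min (exp (- (c - s))) (exp ((\<theta> - 1) * (c - s)))
      \<le> min (exp (?k * \<bar>s - t\<bar>) * exp (- (c - t))) (exp (?k * \<bar>s - t\<bar>) * exp ((\<theta> - 1) * (c - t)))"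
    using 1 2 by (rule min.mono)
  then show "capped \<theta> (c - s) \<le> exp (?k * \<bar>s - t\<bar>) * capped \<theta> (c - t)"
    unfolding capped_def by (simp add: min_mult_distrib_left)
qed

locale prime_weights =
  fixes S :: "nat set" and a :: "nat \<Rightarrow> nat \<Rightarrow> real" and w :: "nat \<Rightarrow> real" and \<theta> :: real
  assumes fin: "finite S" and primes: "\<forall>p\<in>S. prime p"
    and a0: "\<And>p k. p \<in> S \<Longrightarrow> a p k \<ge> 0"
    and a_pos: "\<And>p. p \<in> S \<Longrightarrow> \<exists>k. a p k > 0"
    and a_ev: "\<And>p. p \<in> S \<Longrightarrow> \<forall>\<^sub>F k in sequentially. a p k = w p"
    and theta: "\<theta> > 1"
begin

definition weight :: "nat set \<Rightarrow> nat \<Rightarrow> real" where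
  "weight T Q = (\<Prod>p\<in>T. a p (multiplicity p Q))"

definition U :: "nat set \<Rightarrow> real \<Rightarrow> real" where
  "U T v = (\<Sum>\<^sub>\<infinity>Q\<in>smooth_nats T. weight T Q * capped \<theta> (ln (real Q) - v))"

lemma weight_nonneg: "T \<subseteq> S \<Longrightarrow> weight T Q \<ge> 0"
  unfolding weight_def by (intro prod_nonneg) (use a0 in auto)

lemma a_bounded:
  assumes "p \<in> S"
  shows "\<exists>B. \<forall>k. a p k \<le> B"
proof -
  obtain K where K: "\<And>k. k \<ge> K \<Longrightarrow> a p k = w p"
    using a_ev[OF assms] unfolding eventually_sequentially by blast
  have "a p k \<le> Max (insert (w p) (a p ` {..<K}))" for k
    using K[of k] by (cases "k < K") (auto intro!: Max_ge)
  then show ?thesis by blast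
qed

lemma weight_bounded: "T \<subseteq> S \<Longrightarrow> \<exists>A\<ge>0. \<forall>Q. weight T Q \<le> A"
proof -
  assume T: "T \<subseteq> S"
  obtain B where B: "\<And>p k. p \<in> S \<Longrightarrow> a p k \<le> B p" using a_bounded by metis
  have "weight T Q \<le> (\<Prod>p\<in>T. B p)" for Q
    unfolding weight_def by (intro prod_mono) (use T B a0 in auto)
  moreover have "weight T 1 \<ge> 0" by (rule weight_nonneg[OF T])
  ultimately show ?thesis by (meson order_trans)
qed

lemma U_summable:
  assumes "T \<subseteq> S"
  shows "(\<lambda>Q. weight T Q * capped \<theta> (ln (real Q) - v)) summable_on smooth_nats T"
proof -
  obtain A where A: "A \<ge> 0" "\<And>Q. weight T Q \<le> A" using weight_bounded[OF assms] by blast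
  have "(\<lambda>Q. A * exp v * real Q powr - 1) summable_on smooth_nats T"
    by (intro summable_on_cmult_right summable_smooth_nats_powr) (use assms fin primes finite_subset in auto)
  then show ?thesis
  proof (rule summable_on_comparison_test)
    fix Q assume "Q \<in> smooth_nats T"
    then have Q: "Q > 0" by (simp add: smooth_nats_def)
    have "weight T Q * capped \<theta> (ln (real Q) - v) \<le> A * exp (- (ln (real Q) - v))"
      by (intro mult_mono A capped_le less_imp_le[OF capped_pos])
    also have "exp (- (ln (real Q) - v)) = exp v * real Q powr - 1"
      using Q by (simp add: powr_def exp_diff exp_minus field_simps)
    finally show "weight T Q * capped \<theta> (ln (real Q) - v) \<le> A * exp v * real Q powr - 1" by simp
    show "0 \<le> weight T Q * capped \<theta> (ln (real Q) - v)"
      by (intro mult_nonneg_nonneg weight_nonneg[OF assms] less_imp_le[OF capped_pos])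
  qed
qed

lemma U_has_sum:
  "T \<subseteq> S \<Longrightarrow> ((\<lambda>Q. weight T Q * capped \<theta> (ln (real Q) - v)) has_sum U T v) (smooth_nats T)"
  unfolding U_def by (rule has_sum_infsum[OF U_summable])

text \<open>Multiplying \<open>Q\<close> by \<open>p ^ k\<close> adds \<open>k * ln p\<close> to
  \<open>ln Q\<close>, which amounts to translating \<open>v\<close>. Summing over the exponent of
  \<open>p\<close> separately is therefore a discrete convolution.\<close>

lemma U_step:
  assumes "T \<subseteq> S" "p \<in> S" "p \<notin> T"
  shows "((\<lambda>k. a p k * U T (v - real k * ln (real p))) has_sum U (insert p T) v) UNIV"
proof (rule has_sum_SigmaD)
  have p: "prime p" using assms primes by blast
  have finT: "finite T" using assms fin finite_subset by blast
  let ?f = "\<lambda>Q. weight (insert p T) Q * capped \<theta> (ln (real Q) - v)"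
  have iT: "insert p T \<subseteq> S" using assms by auto
  show "((\<lambda>z. ?f ((\<lambda>(k, Q). p ^ k * Q) z)) has_sum U (insert p T) v) (UNIV \<times> smooth_nats T)"
    by (rule iffD2[OF has_sum_reindex_bij_betw[OF smooth_nats_insert_bij[OF p assms(3)]] U_has_sum[OF iT]])
  fix k :: nat
  have "((\<lambda>Q. a p k * (weight T Q * capped \<theta> (ln (real Q) - (v - real k * ln (real p))))) has_sum
      a p k * U T (v - real k * ln (real p))) (smooth_nats T)"
    by (rule has_sum_cmult_right[OF U_has_sum[OF assms(1)]])
  moreover have eq: "?f (p ^ k * Q) = a p k * (weight T Q * capped \<theta> (ln (real Q) - (v - real k * ln (real p))))"
    if Q: "Q \<in> smooth_nats T" for Q
  proof -
    have Q0: "Q > 0" using Q by (simp add: smooth_nats_def)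
    have pp: "p > 0" using p prime_gt_0_nat by simp
    have "p \<notin> prime_factors Q" using Q assms by (auto simp: smooth_nats_def)
    then have "multiplicity p Q = 0"
      using p Q0 by (auto simp: prime_factors_dvd intro!: not_dvd_imp_multiplicity_0)
    then have "multiplicity p (p ^ k * Q) = k" using multiplicity_power_mult[OF p p Q0] by simp
    moreover have "weight T (p ^ k * Q) = weight T Q"
      unfolding weight_def
    proof (rule prod.cong[OF refl])
      fix q assume "q \<in> T"
      then have "q \<noteq> p" "prime q" using assms primes by auto
      then show "a q (multiplicity q (p ^ k * Q)) = a q (multiplicity q Q)"
        using multiplicity_power_mult[OF p _ Q0] by simp
    qed
    ultimately have "weight (insert p T) (p ^ k * Q) = a p k * weight T Q"
      using finT assms(3) by (simp add: weight_def)
    moreover have "ln (real (p ^ k * Q)) - v = ln (real Q) - (v - real k * ln (real p))"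
      using pp Q0 by (simp add: ln_mult ln_realpow)
    ultimately show ?thesis by (simp only: mult.assoc)
  qed
  moreover have "((\<lambda>Q. ?f (p ^ k * Q)) has_sum a p k * U T (v - real k * ln (real p))) (smooth_nats T) \<longleftrightarrow>
      ((\<lambda>Q. a p k * (weight T Q * capped \<theta> (ln (real Q) - (v - real k * ln (real p))))) has_sum
        a p k * U T (v - real k * ln (real p))) (smooth_nats T)"
    by (rule has_sum_cong) (rule eq)
  ultimately show "((\<lambda>Q. ?f ((\<lambda>(k, Q). p ^ k * Q) (k, Q))) has_sum a p k * U T (v - real k * ln (real p))) (smooth_nats T)"
    by (simp only: prod.case)
qed

lemma U_log_lipschitz: "T \<subseteq> S \<Longrightarrow> log_lipschitz (max 1 (\<theta> - 1)) (U T)"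
  by (rule log_lipschitz_has_sum[OF weight_nonneg log_lipschitz_capped[OF theta] U_has_sum])

text \<open>The only smooth number over the empty set is 1, so \<open>U {}\<close> is the bump
  itself; its branch \<open>exp ((\<theta> - 1) * t)\<close> at \<open>t = - v\<close> supplies the
  decay rate \<open>\<theta> - 1\<close> and the constant 1.\<close>

sublocale iterated_convolution S a "\<lambda>p. ln (real p)" w U "max 1 (\<theta> - 1)" "\<theta> - 1" 1
proof
  show "ln (real p) > 0" if "p \<in> S" for p
  proof -
    have "p > 1" using that primes prime_gt_1_nat by blast
    then show ?thesis by simp
  qed
  show "ln (real q) / ln (real p) \<notin> \<rat>" if "p \<in> S" "q \<in> S" "p \<noteq> q" for p q
    using that primes ln_prime_ratio_irrational by blast
  have U0: "U {} v = capped \<theta> (- v)" for v by (simp add: U_def smooth_nats_empty weight_def)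
  show "U {} v > 0" for v unfolding U0 by (rule capped_pos)
  show "U {} v \<le> 1 * exp (- (\<theta> - 1) * v)" for v
    using capped_le(2)[of \<theta> "- v"] by (simp only: U0 mult_1 minus_mult_commute)
qed (use fin a0 a_pos a_ev theta U_log_lipschitz U_step in auto)

end

section \<open>Integers with prescribed S-part\<close>

lemma smooth_nats_eq_prod:
  assumes "finite S" "\<forall>p\<in>S. prime p" "Q \<in> smooth_nats S"
  shows "(\<Prod>p\<in>S. p ^ multiplicity p Q) = Q"
proof -
  have Q: "Q > 0" "prime_factors Q \<subseteq> S" using assms(3) by (auto simp: smooth_nats_def)
  have "(\<Prod>p\<in>S. p ^ multiplicity p Q) = (\<Prod>p\<in>prime_factors Q. p ^ multiplicity p Q)"
    using assms(1,2) Q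
    by (intro prod.mono_neutral_right) (auto simp: prime_factors_multiplicity)
  also have "\<dots> = Q" using Q(1) by (simp add: prod_prime_factors)
  finally show ?thesis .
qed

lemma multiplicity_prime_power_prod:
  fixes e :: "nat \<Rightarrow> nat"
  assumes "finite S" "\<forall>p\<in>S. prime p" "q \<in> S"
  shows "multiplicity q (\<Prod>p\<in>S. p ^ e p) = e q"
  using assms by (subst multiplicity_prod_prime_powers) auto

lemma prime_power_prod_smooth:
  assumes "finite S" "\<forall>p\<in>S. prime p"
  shows "(\<Prod>p\<in>S. p ^ e p) \<in> smooth_nats S"
proof -
  have pos: "(\<Prod>p\<in>S. p ^ e p) > 0" using assms prime_gt_0_nat by (auto intro!: prod_pos)
  have "q \<in> S" if q: "q \<in> prime_factors (\<Prod>p\<in>S. p ^ e p)" for q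
  proof -
    have "prime q" "q dvd (\<Prod>p\<in>S. p ^ e p)" using q by auto
    then obtain p where p: "p \<in> S" "q dvd p ^ e p"
      using prime_dvd_prod_iff[OF assms(1) \<open>prime q\<close>, of "\<lambda>p. p ^ e p"] by auto
    then have "q dvd p" using prime_dvd_power[OF \<open>prime q\<close>] by simp
    then have "q = p" using \<open>prime q\<close> p(1) assms(2) by (intro primes_dvd_imp_eq) auto
    then show ?thesis using p by simp
  qed
  then show ?thesis using pos by (auto simp: smooth_nats_def)
qed

lemma S_part_smooth: "finite S \<Longrightarrow> \<forall>p\<in>S. prime p \<Longrightarrow> S_part S y \<in> smooth_nats S"
  unfolding S_part_def by (rule prime_power_prod_smooth)

lemma S_part_eq_iff:
  assumes "finite S" "\<forall>p\<in>S. prime p" "Q \<in> smooth_nats S"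
  shows "S_part S y = Q \<longleftrightarrow> (\<forall>p\<in>S. multiplicity (int p) y = multiplicity p Q)"
proof
  assume "S_part S y = Q"
  then show "\<forall>p\<in>S. multiplicity (int p) y = multiplicity p Q"
    using multiplicity_prime_power_prod[OF assms(1,2)] by (auto simp: S_part_def)
next
  assume "\<forall>p\<in>S. multiplicity (int p) y = multiplicity p Q"
  then have "S_part S y = (\<Prod>p\<in>S. p ^ multiplicity p Q)" by (simp add: S_part_def)
  then show "S_part S y = Q" using smooth_nats_eq_prod[OF assms] by simp
qed

lemma S_part_dvd:
  assumes "finite S" "\<forall>p\<in>S. prime p"
  shows "int (S_part S y) dvd y"
proof -
  have "(\<Prod>p\<in>S. int p ^ multiplicity (int p) y) dvd y"
    using assms
  proof (induction S rule: finite_induct)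
    case (insert p S)
    have "coprime (int p ^ multiplicity (int p) y) (\<Prod>q\<in>S. int q ^ multiplicity (int q) y)"
    proof (rule prod_coprime_right)
      fix q assume "q \<in> S"
      then have "coprime p q" using insert primes_coprime[of p q] by auto
      then have "coprime (int p) (int q)" by simp
      then show "coprime (int p ^ multiplicity (int p) y) (int q ^ multiplicity (int q) y)" by simp
    qed
    then show ?case using insert by (simp add: divides_mult multiplicity_dvd)
  qed simp
  then show ?thesis by (simp add: S_part_def)
qed

lemma multiplicity_eq_iff_int:
  fixes y :: int
  assumes "prime p" "y \<noteq> 0"
  shows "multiplicity (int p) y = k \<longleftrightarrow> int p ^ k dvd y \<and> \<not> int p ^ Suc k dvd y"
proof
  assume k: "multiplicity (int p) y = k"
  have "\<not> is_unit (int p)" using prime_gt_1_nat[OF assms(1)] by simp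
  then have "\<not> int p ^ Suc k dvd y"
    using assms(2) k multiplicity_geI[of y "int p" "Suc k"] by auto
  then show "int p ^ k dvd y \<and> \<not> int p ^ Suc k dvd y" using multiplicity_dvd[of "int p" y] k by simp
qed (auto intro: multiplicity_eqI)

lemma finite_int_abs_le: "finite {x::int. \<bar>real_of_int x\<bar> \<le> B}"
proof -
  have "{x::int. \<bar>real_of_int x\<bar> \<le> B} \<subseteq> {- \<lceil>B\<rceil>..\<lceil>B\<rceil>}" by (auto; linarith)
  then show ?thesis using finite_subset by blast
qed

text \<open>Each \<open>Q \<le> R\<close> contributes at least 1 to the sum of
  \<open>(R / Q) powr \<eta>\<close>.\<close>

lemma card_smooth_nats_le:
  assumes "finite S" "\<forall>p\<in>S. prime p" "\<eta> > 0" "R > 0"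
  shows "finite {Q\<in>smooth_nats S. real Q \<le> R}"
    and "real (card {Q\<in>smooth_nats S. real Q \<le> R}) \<le> R powr \<eta> * (infsum (\<lambda>Q. real Q powr - \<eta>) (smooth_nats S))"
proof -
  let ?A = "{Q\<in>smooth_nats S. real Q \<le> R}"
  have "?A \<subseteq> {..nat \<lfloor>R\<rfloor>}" by (auto simp: le_nat_floor)
  then show fin: "finite ?A" using finite_subset by blast
  have "real (card ?A) = (\<Sum>Q\<in>?A. 1)" by simp
  also have "\<dots> \<le> (\<Sum>Q\<in>?A. R powr \<eta> * real Q powr - \<eta>)"
  proof (rule sum_mono)
    fix Q assume "Q \<in> ?A"
    then have Q: "Q > 0" "real Q \<le> R" by (auto simp: smooth_nats_def)
    have "real Q powr \<eta> \<le> R powr \<eta>" using Q assms(3) by (intro powr_mono2) auto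
    then have "real Q powr \<eta> * real Q powr - \<eta> \<le> R powr \<eta> * real Q powr - \<eta>" by (intro mult_right_mono) auto
    then show "1 \<le> R powr \<eta> * real Q powr - \<eta>" using Q by (simp add: powr_add[symmetric])
  qed
  also have "\<dots> = R powr \<eta> * (\<Sum>Q\<in>?A. real Q powr - \<eta>)" by (simp add: sum_distrib_left)
  also have "\<dots> \<le> R powr \<eta> * (infsum (\<lambda>Q. real Q powr - \<eta>) (smooth_nats S))"
    by (intro mult_left_mono finite_sum_le_infsum summable_smooth_nats_powr[OF assms(1-3)] fin) auto
  finally show "real (card ?A) \<le> R powr \<eta> * (infsum (\<lambda>Q. real Q powr - \<eta>) (smooth_nats S))" .
qed

text \<open>Take the least divisor of \<open>E\<close> above \<open>B\<close>: removing one prime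
  factor brings it down to at most \<open>B\<close>, so it exceeds \<open>B\<close> by no more than
  that prime.\<close>

lemma smooth_divisor_in_range:
  assumes "finite S" "\<forall>p\<in>S. prime p" "E \<in> smooth_nats S" "real E > B" "B \<ge> 1"
  shows "\<exists>D\<in>smooth_nats S. D dvd E \<and> B < real D \<and> real D \<le> B * real (\<Prod>p\<in>S. p)"
proof -
  let ?P = "\<lambda>D. D dvd E \<and> B < real D"
  define D where "D = (LEAST D. ?P D)"
  have D: "?P D" unfolding D_def by (rule LeastI[of ?P E]) (use assms in auto)
  have E: "E > 0" "prime_factors E \<subseteq> S" using assms(3) by (auto simp: smooth_nats_def)
  have D0: "D > 0" "D \<noteq> 1" using D E assms(5) by (auto intro!: Nat.gr0I)
  then obtain p where p: "prime p" "p dvd D" using prime_factor_nat by blast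
  have pf: "prime_factors D \<subseteq> S" using D E dvd_prime_factors[of E D] by auto
  then have pS: "p \<in> S" using p D0 by (auto simp: prime_factors_dvd)
  obtain D' where D': "D = p * D'" using p(2) by (rule dvdE)
  have "D' < D" using D0 D' p prime_gt_1_nat[of p] by simp
  moreover have "D' dvd E" using D D' by (meson dvd_mult_right dvd_trans)
  ultimately have "\<not> B < real D'" using not_less_Least[of D' ?P] unfolding D_def by blast
  then have "real D \<le> B * real p" using D' by (simp add: mult.commute mult_right_mono)
  also have "p dvd (\<Prod>p\<in>S. p)" using assms(1) pS by (rule dvd_prodI)
  then have "p \<le> (\<Prod>p\<in>S. p)" using assms prime_gt_0_nat by (intro dvd_imp_le prod_pos) auto
  then have "real p \<le> real (\<Prod>p\<in>S. p)" by (simp only: of_nat_le_iff)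
  then have "B * real p \<le> B * real (\<Prod>p\<in>S. p)" using assms(5) by (intro mult_left_mono) auto
  finally show ?thesis using D pf D0 by (intro bexI[of _ D]) (auto simp: smooth_nats_def)
qed

locale S_part_count =
  fixes f :: "int poly" and S :: "nat set" and \<beta> :: real
  assumes f0: "f \<noteq> 0" and finS: "finite S" and primeS: "\<forall>p\<in>S. prime p" and S_ne: "S \<noteq> {}"
    and beta: "0 < \<beta>" "\<beta> < 1"
    and simple: "\<And>p. p \<in> S \<Longrightarrow> has_padic_root p f \<Longrightarrow> \<not> has_multiple_padic_root p f"
begin

text \<open>Valuation exactly \<open>k\<close> is a condition periodic modulo
  \<open>p ^ Suc k\<close>, hence the range one power beyond \<open>k\<close>.\<close>

definition exact_count :: "nat \<Rightarrow> nat \<Rightarrow> nat" where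
  "exact_count p k = card {x\<in>{0..<int (p ^ Suc k)}. int p ^ k dvd poly f x \<and> \<not> int p ^ Suc k dvd poly f x}"

text \<open>Normalized so that \<open>a p k / p ^ k\<close> is the density of the integers
  \<open>x\<close> for which \<open>f x\<close> has valuation \<open>k\<close> at
  \<open>p\<close>.\<close>

definition a :: "nat \<Rightarrow> nat \<Rightarrow> real" where
  "a p k = real (exact_count p k) / real p"

definition roots_limit :: "nat \<Rightarrow> nat" where
  "roots_limit p = (SOME r. (\<forall>\<^sub>F k in sequentially. root_count f (p ^ k) = r) \<and> (r > 0 \<longleftrightarrow> has_padic_root p f))"

text \<open>What \<open>a_eq\<close> gives once both root counts in it have reached
  \<open>roots_limit p\<close>.\<close>

definition w :: "nat \<Rightarrow> real" where
  "w p = real (roots_limit p) * (real p - 1) / real p"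

lemma roots_limit:
  assumes "p \<in> S"
  shows "\<forall>\<^sub>F k in sequentially. root_count f (p ^ k) = roots_limit p" "roots_limit p > 0 \<longleftrightarrow> has_padic_root p f"
  using someI_ex[OF root_count_prime_power_eventually[OF _ f0 simple]] assms primeS
  unfolding roots_limit_def by blast+

lemma exact_count_eq:
  assumes "p \<in> S"
  shows "exact_count p k + root_count f (p ^ Suc k) = p * root_count f (p ^ k)"
proof -
  have p: "p > 0" using assms primeS prime_gt_0_nat by blast
  let ?A = "{x\<in>{0..<int (p ^ Suc k)}. int p ^ k dvd poly f x}"
  let ?R = "{x\<in>{0..<int (p ^ Suc k)}. int (p ^ Suc k) dvd poly f x}"
  let ?N = "{x\<in>{0..<int (p ^ Suc k)}. int p ^ k dvd poly f x \<and> \<not> int p ^ Suc k dvd poly f x}"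
  have fin: "finite {0..<int (p ^ Suc k)}" by simp
  have "int p ^ k dvd poly f x" if "int p ^ Suc k dvd poly f x" for x
    using power_le_dvd[OF that, of k] by simp
  then have un: "?N \<union> ?R = ?A" unfolding of_nat_power by blast
  have "finite ?N" "finite ?R" by (rule finite_subset[OF _ fin], blast)+
  then have "card (?N \<union> ?R) = card ?N + card ?R" by (rule card_Un_disjoint) auto
  then have "card ?A = card ?N + card ?R" by (simp only: un)
  moreover have "card ?A = p * card {x\<in>{0..<int (p ^ k)}. int p ^ k dvd poly f x}"
    using card_periodic_mult[of "p ^ k" "\<lambda>x. int p ^ k dvd poly f x" p] p int_poly_dvd_cong[OF dvd_diff_mod_int]
    by (simp add: mult.commute)
  ultimately show ?thesis by (simp add: exact_count_def root_count_def)
qed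

lemma a_eq: "p \<in> S \<Longrightarrow> a p k = real (root_count f (p ^ k)) - real (root_count f (p ^ Suc k)) / real p"
proof -
  assume p: "p \<in> S"
  then have "p > 0" using primeS prime_gt_0_nat by blast
  moreover have "real (exact_count p k) = real p * real (root_count f (p ^ k)) - real (root_count f (p ^ Suc k))"
    using exact_count_eq[OF p, of k] by (metis add_diff_cancel_right' of_nat_add of_nat_mult)
  ultimately show ?thesis by (simp add: a_def diff_divide_distrib)
qed

lemma a_eventually:
  assumes "p \<in> S"
  shows "\<forall>\<^sub>F k in sequentially. a p k = w p"
proof -
  have "p > 0" using assms primeS prime_gt_0_nat by blast
  have "\<forall>\<^sub>F k in sequentially. root_count f (p ^ Suc k) = roots_limit p"
    by (rule iffD2[OF eventually_sequentially_Suc roots_limit(1)[OF assms]])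
  then show ?thesis using roots_limit(1)[OF assms]
    by eventually_elim (use \<open>p > 0\<close> in \<open>simp add: a_eq[OF assms] w_def field_simps\<close>)
qed

text \<open>If no valuation occurred with positive density, every residue modulo every
  \<open>p ^ k\<close> would be a root, and the root counts \<open>p ^ k\<close> would not
  stabilize.\<close>

lemma a_positive:
  assumes "p \<in> S"
  shows "\<exists>k. a p k > 0"
proof (rule ccontr)
  have p: "p > 1" using assms primeS prime_gt_1_nat by blast
  assume "\<not> ?thesis"
  then have "a p k = 0" for k by (metis a_def divide_nonneg_nonneg less_eq_real_def of_nat_0_le_iff)
  then have z: "exact_count p k = 0" for k using p by (simp add: a_def)
  have r: "root_count f (p ^ k) = p ^ k" for k
  proof (induction k)
    case 0
    have "{x::int. 0 \<le> x \<and> x < 1} = {0}" by auto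
    then show ?case by (simp add: root_count_def)
  next
    case (Suc k)
    then show ?case using exact_count_eq[OF assms, of k] z[of k] by simp
  qed
  obtain K where "\<And>k. k \<ge> K \<Longrightarrow> p ^ k = roots_limit p"
    using roots_limit(1)[OF assms] unfolding r eventually_sequentially by blast
  then have "p ^ K = p ^ Suc K" by (metis le_Suc_eq order_refl)
  then show False using p by simp
qed

sublocale prime_weights S a w "1 / \<beta>"
  by standard (use finS primeS a_eventually a_positive beta in \<open>auto simp: a_def\<close>)

lemma w_pos_iff: "p \<in> S \<Longrightarrow> w p > 0 \<longleftrightarrow> has_padic_root p f"
proof -
  assume p: "p \<in> S"
  then have "p > 1" using primeS prime_gt_1_nat by blast
  then show ?thesis using roots_limit(2)[OF p] by (simp add: w_def zero_less_mult_iff zero_less_divide_iff)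
qed

abbreviation E :: "int \<Rightarrow> nat" where "E x \<equiv> S_part S (poly f x)"

definition level :: "nat \<Rightarrow> real \<Rightarrow> int set" where
  "level Q Y = {x. \<bar>real_of_int x\<bar> \<le> Y \<and> poly f x \<noteq> 0 \<and> E x = Q}"

text \<open>The condition is a product of local conditions with joint modulus \<open>Q\<close> times
  the product of \<open>S\<close>, and the Chinese remainder theorem makes the number of admissible
  classes \<open>weight S Q\<close> times that same product. This number is bounded in
  \<open>Q\<close>, hence so is the error.\<close>

lemma level_count:
  "\<exists>C\<ge>0. \<forall>Q\<in>smooth_nats S. \<forall>Y\<ge>0. \<bar>real (card (level Q Y)) - 2 * Y * weight S Q / real Q\<bar> \<le> C"
proof -
  obtain A where A: "A \<ge> 0" "\<And>Q. weight S Q \<le> A" using weight_bounded[of S] by auto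
  define P where "P = real (\<Prod>p\<in>S. p)"
  have "\<bar>real (card (level Q Y)) - 2 * Y * weight S Q / real Q\<bar> \<le> A * P" if Q: "Q \<in> smooth_nats S" and Y: "Y \<ge> 0" for Q Y
  proof -
    define k where "k p = multiplicity p Q" for p
    define m where "m = (\<Prod>p\<in>S. p ^ Suc (k p))"
    define R where "R p x \<longleftrightarrow> int p ^ k p dvd poly f x \<and> \<not> int p ^ Suc (k p) dvd poly f x" for p x
    have m0: "m > 0" unfolding m_def using primeS prime_gt_0_nat by (auto intro!: prod_pos)
    have per: "R p (x mod int (p ^ Suc (k p))) = R p x" for p x
    proof -
      have d: "int p ^ Suc (k p) dvd x mod int (p ^ Suc (k p)) - x" using dvd_diff_mod_int by simp
      then have "int p ^ k p dvd x mod int (p ^ Suc (k p)) - x" by (rule power_le_dvd) simp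
      then show ?thesis unfolding R_def using int_poly_dvd_cong[OF d] int_poly_dvd_cong by blast
    qed
    have lev: "level Q Y = {x. \<bar>real_of_int x\<bar> \<le> Y \<and> (\<forall>p\<in>S. R p x)}"
    proof -
      have "poly f x \<noteq> 0 \<and> E x = Q \<longleftrightarrow> (\<forall>p\<in>S. R p x)" for x
      proof (cases "poly f x = 0")
        case True
        \<comment> \<open>Zero is divisible by every prime power, so an integer root of
          \<open>f\<close> violates \<open>R\<close> at any prime of \<open>S\<close>; with
          \<open>S\<close> empty there would be no prime to exclude it.\<close>
        then show ?thesis using S_ne by (auto simp: R_def)
      next
        case False
        then show ?thesis
          unfolding S_part_eq_iff[OF finS primeS Q] R_def k_def using multiplicity_eq_iff_int primeS by auto
      qed
      then show ?thesis by (auto simp: level_def)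
    qed
    have "card {x\<in>{0..<int m}. \<forall>p\<in>S. R p x} = (\<Prod>p\<in>S. card {x\<in>{0..<int (p ^ Suc (k p))}. R p x})"
      unfolding m_def
    proof (rule card_periodic_prod[OF finS])
      fix p q assume "p \<in> S" "q \<in> S" "p \<noteq> q"
      then have "coprime p q" using primeS primes_coprime by blast
      then show "coprime (p ^ Suc (k p)) (q ^ Suc (k q))" by (simp only: coprime_power_left_iff coprime_power_right_iff) simp
    qed (use per primeS prime_gt_0_nat in auto)
    also have "\<dots> = (\<Prod>p\<in>S. exact_count p (k p))" by (simp add: exact_count_def R_def)
    finally have card_m: "card {x\<in>{0..<int m}. \<forall>p\<in>S. R p x} = (\<Prod>p\<in>S. exact_count p (k p))" .
    have wP: "real (\<Prod>p\<in>S. exact_count p (k p)) = weight S Q * P"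
      unfolding weight_def a_def P_def k_def of_nat_prod prod.distrib[symmetric]
      by (intro prod.cong refl) (use primeS prime_gt_0_nat in force)
    have mQ: "m = Q * (\<Prod>p\<in>S. p)"
      unfolding m_def using smooth_nats_eq_prod[OF finS primeS Q] by (simp add: k_def prod.distrib mult.commute)
    have "\<bar>real (card (level Q Y)) - 2 * Y * (weight S Q * P) / real m\<bar> \<le> weight S Q * P"
      unfolding lev wP[symmetric] card_m[symmetric]
    proof (rule card_periodic_interval[OF m0 Y])
      fix x
      have "R p (x mod int m) = R p x" if "p \<in> S" for p
      proof -
        have "p ^ Suc (k p) dvd m" unfolding m_def using finS that by (rule dvd_prodI)
        then have "x mod int m mod int (p ^ Suc (k p)) = x mod int (p ^ Suc (k p))"
          by (intro mod_mod_cancel) (simp only: of_nat_dvd_iff)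
        then show ?thesis using per by metis
      qed
      then show "(\<forall>p\<in>S. R p (x mod int m)) = (\<forall>p\<in>S. R p x)" by blast
    qed
    moreover have "P > 0" using primeS prime_gt_0_nat by (auto simp: P_def intro!: prod_pos)
    then have "2 * Y * (weight S Q * P) / real m = 2 * Y * weight S Q / real Q"
      unfolding mQ by (simp add: P_def)
    moreover have "weight S Q * P \<le> A * P" using A \<open>P > 0\<close> by (intro mult_right_mono) auto
    ultimately show ?thesis by linarith
  qed
  moreover have "A * P \<ge> 0" using A by (auto simp: P_def intro!: mult_nonneg_nonneg prod_nonneg)
  ultimately show ?thesis by blast
qed

text \<open>Each prime has bounded root counts because they are eventually constant; the Chinese
  remainder theorem turns these bounds into their product.\<close>

lemma root_count_bounded: "\<exists>C\<ge>0. \<forall>Q\<in>smooth_nats S. real (root_count f Q) \<le> C"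
proof -
  have "\<exists>B. \<forall>k. root_count f (p ^ k) \<le> B" if p: "p \<in> S" for p
  proof -
    obtain K where K: "\<And>k. k \<ge> K \<Longrightarrow> root_count f (p ^ k) = roots_limit p"
      using roots_limit(1)[OF p] unfolding eventually_sequentially by blast
    have "root_count f (p ^ k) \<le> Max (insert (roots_limit p) ((\<lambda>k. root_count f (p ^ k)) ` {..<K}))" for k
      using K[of k] by (cases "k < K") (auto intro!: Max_ge)
    then show ?thesis by blast
  qed
  then obtain B where B: "\<And>p k. p \<in> S \<Longrightarrow> root_count f (p ^ k) \<le> B p" by metis
  have "root_count f Q \<le> (\<Prod>p\<in>S. B p)" if Q: "Q \<in> smooth_nats S" for Q
  proof -
    define k where "k p = multiplicity p Q" for p
    have Qk: "(\<Prod>p\<in>S. p ^ k p) = Q" using smooth_nats_eq_prod[OF finS primeS Q] by (simp add: k_def)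
    have "int Q dvd y \<Longrightarrow> p \<in> S \<Longrightarrow> int (p ^ k p) dvd y" for y p
    proof -
      assume y: "int Q dvd y" and p: "p \<in> S"
      have "p ^ k p dvd Q" unfolding Qk[symmetric] using finS p by (rule dvd_prodI)
      then have "int (p ^ k p) dvd int Q" by (simp only: of_nat_dvd_iff)
      then show ?thesis using y dvd_trans by blast
    qed
    then have "{x\<in>{0..<int Q}. int Q dvd poly f x} \<subseteq> {x\<in>{0..<int (\<Prod>p\<in>S. p ^ k p)}. \<forall>p\<in>S. int (p ^ k p) dvd poly f x}"
      unfolding Qk by blast
    then have "root_count f Q \<le> card {x\<in>{0..<int (\<Prod>p\<in>S. p ^ k p)}. \<forall>p\<in>S. int (p ^ k p) dvd poly f x}"
      unfolding root_count_def by (rule card_mono[rotated]) (rule finite_subset[of _ "{0..<int (\<Prod>p\<in>S. p ^ k p)}"], auto)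
    also have "\<dots> = (\<Prod>p\<in>S. card {x\<in>{0..<int (p ^ k p)}. int (p ^ k p) dvd poly f x})"
    proof (rule card_periodic_prod[OF finS])
      fix p q assume "p \<in> S" "q \<in> S" "p \<noteq> q"
      then have "coprime p q" using primeS primes_coprime by blast
      then show "coprime (p ^ k p) (q ^ k q)" by simp
    next
      fix p x show "(int (p ^ k p) dvd poly f (x mod int (p ^ k p))) = (int (p ^ k p) dvd poly f x)"
        by (rule int_poly_dvd_cong[OF dvd_diff_mod_int])
    qed (use primeS prime_gt_0_nat in auto)
    also have "\<dots> = (\<Prod>p\<in>S. root_count f (p ^ k p))" by (simp only: root_count_def)
    also have "\<dots> \<le> (\<Prod>p\<in>S. B p)" by (intro prod_mono) (use B in auto)
    finally show ?thesis .
  qed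
  then have "\<forall>Q\<in>smooth_nats S. real (root_count f Q) \<le> real (\<Prod>p\<in>S. B p)" by (simp only: of_nat_le_iff) blast
  then show ?thesis by (intro exI[of _ "real (\<Prod>p\<in>S. B p)"] conjI of_nat_0_le_iff)
qed

text \<open>A large \<open>S\<close>-part has a divisor in \<open>(B, B P]\<close>, where \<open>P\<close> is the product of \<open>S\<close>;
  for each such divisor the congruence has boundedly many solutions in \<open>[-B, B]\<close>.\<close>

lemma large_S_part_count:
  assumes "\<eta> > 0"
  shows "\<exists>C\<ge>0. \<forall>B\<ge>1. real (card {x. \<bar>real_of_int x\<bar> \<le> B \<and> poly f x \<noteq> 0 \<and> real (E x) > B}) \<le> C * B powr \<eta>"
proof -
  obtain C where C: "C \<ge> 0" "\<And>Q. Q \<in> smooth_nats S \<Longrightarrow> real (root_count f Q) \<le> C"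
    using root_count_bounded by blast
  define P where "P = real (\<Prod>p\<in>S. p)"
  define Z where "Z = (infsum (\<lambda>Q. real Q powr - \<eta>) (smooth_nats S))"
  have P: "P > 0" using primeS prime_gt_0_nat by (auto simp: P_def intro!: prod_pos)
  have "real (card {x. \<bar>real_of_int x\<bar> \<le> B \<and> poly f x \<noteq> 0 \<and> real (E x) > B}) \<le> 3 * C * (P powr \<eta> * Z) * B powr \<eta>"
    if B: "B \<ge> 1" for B
  proof -
    let ?D = "{D\<in>smooth_nats S. real D \<le> B * P}"
    let ?D' = "{D\<in>?D. B < real D}"
    let ?R = "\<lambda>D. {x. \<bar>real_of_int x\<bar> \<le> B \<and> int D dvd poly f x}"
    have BP: "B * P > 0" using B P by simp
    have finD: "finite ?D" by (rule card_smooth_nats_le(1)[OF finS primeS assms BP])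
    have finX: "finite (?R D)" for D by (rule finite_subset[OF _ finite_int_abs_le[of B]]) auto
    \<comment> \<open>Since \<open>D > B\<close>, the main term \<open>2 * B * r / D\<close> is at
      most \<open>2 * r\<close>, and the residue error adds another \<open>r\<close>.\<close>
    have XD: "real (card (?R D)) \<le> 3 * C" if D: "D \<in> ?D'" for D
    proof -
      have D0: "D > 0" using D B by (auto intro!: Nat.gr0I)
      let ?r = "real (root_count f D)"
      have "\<bar>real (card (?R D)) - 2 * B * ?r / real D\<bar> \<le> ?r"
        unfolding root_count_def
        by (rule card_periodic_interval) (use D0 B int_poly_dvd_cong[OF dvd_diff_mod_int] in auto)
      moreover have "2 * B * ?r / real D \<le> 2 * ?r"
      proof -
        have "B * ?r \<le> real D * ?r" using D by (intro mult_right_mono) auto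
        then show ?thesis using D0 by (simp add: field_simps)
      qed
      moreover have "?r \<le> C" using C D by blast
      ultimately show ?thesis by linarith
    qed
    have "{x. \<bar>real_of_int x\<bar> \<le> B \<and> poly f x \<noteq> 0 \<and> real (E x) > B} \<subseteq> (\<Union>D\<in>?D'. ?R D)"
    proof
      fix x assume x: "x \<in> {x. \<bar>real_of_int x\<bar> \<le> B \<and> poly f x \<noteq> 0 \<and> real (E x) > B}"
      then obtain D where D: "D \<in> smooth_nats S" "D dvd E x" "B < real D" "real D \<le> B * P"
        using smooth_divisor_in_range[OF finS primeS S_part_smooth[OF finS primeS]] B unfolding P_def by blast
      have "int D dvd int (E x)" using D(2) by (simp only: of_nat_dvd_iff)
      then have "int D dvd poly f x" using S_part_dvd[OF finS primeS] dvd_trans by blast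
      then show "x \<in> (\<Union>D\<in>?D'. ?R D)" using D x by blast
    qed
    moreover have finD': "finite ?D'" using finD by (rule rev_finite_subset) blast
    then have "finite (\<Union>D\<in>?D'. ?R D)" by (rule finite_UN_I) (rule finX)
    ultimately have "card {x. \<bar>real_of_int x\<bar> \<le> B \<and> poly f x \<noteq> 0 \<and> real (E x) > B} \<le> card (\<Union>D\<in>?D'. ?R D)"
      by (intro card_mono)
    also have "\<dots> \<le> (\<Sum>D\<in>?D'. card (?R D))" by (rule card_UN_le[OF finD'])
    finally have "real (card {x. \<bar>real_of_int x\<bar> \<le> B \<and> poly f x \<noteq> 0 \<and> real (E x) > B}) \<le> (\<Sum>D\<in>?D'. real (card (?R D)))"
      unfolding of_nat_sum[symmetric] of_nat_le_iff .
    also have "\<dots> \<le> (\<Sum>D\<in>?D'. 3 * C)" by (rule sum_mono) (rule XD)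
    also have "\<dots> = 3 * C * real (card ?D')" by simp
    also have "\<dots> \<le> 3 * C * real (card ?D)"
      using C finD by (intro mult_left_mono of_nat_mono card_mono) auto
    also have "\<dots> \<le> 3 * C * ((B * P) powr \<eta> * Z)"
      unfolding Z_def using C by (intro mult_left_mono card_smooth_nats_le(2)[OF finS primeS assms BP]) auto
    also have "(B * P) powr \<eta> = B powr \<eta> * P powr \<eta>" using B P by (simp add: powr_mult)
    finally show ?thesis by (simp add: algebra_simps)
  qed
  moreover have "3 * C * (P powr \<eta> * Z) \<ge> 0" using C by (auto simp: Z_def intro!: mult_nonneg_nonneg infsum_nonneg)
  ultimately show ?thesis by blast
qed

end

section \<open>The truncated sum and its second difference\<close>

text \<open>The two exponentials in \<open>capped\<close> cross at
  \<open>ln Q = ln c + ln B / \<theta>\<close>, which is exactly where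
  \<open>(Q / c) powr \<theta>\<close> equals \<open>B\<close>.\<close>

lemma capped_eq:
  fixes B c \<theta> :: real and Q :: nat
  assumes "B > 0" "c > 0" "Q > 0" "\<theta> > 0"
  shows "B powr (1 - 1 / \<theta>) / c * capped \<theta> (ln (real Q) - (ln c + 1 / \<theta> * ln B))
       = min B ((real Q / c) powr \<theta>) / real Q"
proof -
  define v where "v = ln c + 1 / \<theta> * ln B"
  define e where "e = exp (\<theta> * (ln (real Q) - v))"
  define u where "u = exp (v - ln (real Q))"
  have "\<theta> * (ln (real Q) - v) = \<theta> * ln (real Q / c) - ln B"
    using assms by (simp add: v_def ln_div field_simps)
  then have "e = exp (\<theta> * ln (real Q / c)) / exp (ln B)" by (simp add: e_def exp_diff)
  then have e: "e = (real Q / c) powr \<theta> / B" using assms by (simp add: powr_def)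
  have "u = exp (1 / \<theta> * ln B) * exp (ln c) / exp (ln (real Q))" by (simp add: u_def v_def exp_diff exp_add)
  then have u: "u = B powr (1 / \<theta>) * c / real Q" using assms by (simp add: powr_def)
  have "(\<theta> - 1) * (ln (real Q) - v) = \<theta> * (ln (real Q) - v) + (v - ln (real Q))" by (simp add: algebra_simps)
  then have "exp ((\<theta> - 1) * (ln (real Q) - v)) = u * e" by (simp add: u_def e_def exp_add)
  then have "capped \<theta> (ln (real Q) - v) = min (u * 1) (u * e)" by (simp add: capped_def u_def)
  also have "\<dots> = u * min 1 e" using min_mult_distrib_left[of u 1 e] by (simp add: u_def)
  finally have "B powr (1 - 1 / \<theta>) / c * capped \<theta> (ln (real Q) - v)
      = (B powr (1 - 1 / \<theta>) * B powr (1 / \<theta>)) / real Q * min 1 e"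
    using assms by (simp add: u)
  also have "B powr (1 - 1 / \<theta>) * B powr (1 / \<theta>) = B" using assms by (simp add: powr_add[symmetric])
  also have "B / real Q * min 1 e = min B (B * e) / real Q"
    using assms min_mult_distrib_left[of B 1 e] by simp
  finally show ?thesis using assms by (simp add: v_def e)
qed

context prime_weights
begin

lemma truncated_sum:
  assumes "B > 0" "c > 0"
  shows "((\<lambda>Q. weight S Q * min B ((real Q / c) powr \<theta>) / real Q) has_sum
     B powr (1 - 1 / \<theta>) / c * U S (ln c + 1 / \<theta> * ln B)) (smooth_nats S)"
proof -
  have "((\<lambda>Q. B powr (1 - 1 / \<theta>) / c * (weight S Q * capped \<theta> (ln (real Q) - (ln c + 1 / \<theta> * ln B)))) has_sum
     B powr (1 - 1 / \<theta>) / c * U S (ln c + 1 / \<theta> * ln B)) (smooth_nats S)"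
    by (rule has_sum_cmult_right[OF U_has_sum]) simp
  moreover have "B powr (1 - 1 / \<theta>) / c * (weight S Q * capped \<theta> (ln (real Q) - (ln c + 1 / \<theta> * ln B)))
     = weight S Q * min B ((real Q / c) powr \<theta>) / real Q" if "Q \<in> smooth_nats S" for Q
  proof -
    have "Q > 0" using that by (simp add: smooth_nats_def)
    then show ?thesis using capped_eq[OF assms, of Q \<theta>] theta
      by (metis (no_types, lifting) less_trans mult.left_commute times_divide_eq_right zero_less_one)
  qed
  ultimately show ?thesis by (simp cong: has_sum_cong)
qed

text \<open>As a function of \<open>y\<close>, the sum \<open>y powr (1 - 1/\<theta>) * U S (ln y / \<theta>)\<close> is concave with a kink at
  \<open>Q powr \<theta>\<close>, so its second difference there is at most a negative constant times the step.\<close>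

lemma U_second_difference:
  assumes Q0: "Q0 \<in> smooth_nats S" and h: "0 < h" "h < 1"
  defines "s \<equiv> 1 - 1 / \<theta>" and "v \<equiv> ln (real Q0)"
  shows "(1 + h) powr s * U S (v + 1 / \<theta> * ln (1 + h)) + (1 - h) powr s * U S (v + 1 / \<theta> * ln (1 - h))
     - 2 * U S v \<le> - (weight S Q0 * h)"
proof -
  have q: "Q0 > 0" using Q0 by (simp add: smooth_nats_def)
  define y where "y = real Q0 powr \<theta>"
  have y: "y > 0" using q by (simp add: y_def)
  have lny: "1 / \<theta> * ln (y * t) = v + 1 / \<theta> * ln t" if "t > 0" for t
    using that y q theta by (simp add: ln_mult y_def ln_powr v_def field_simps)
  have sm: "((\<lambda>Q. weight S Q * min (y * t) (real Q powr \<theta>) / real Q) has_sum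
      y powr s * (t powr s * U S (v + 1 / \<theta> * ln t))) (smooth_nats S)" if "t > 0" for t
    using truncated_sum[of "y * t" 1] that y lny[OF that] by (simp add: s_def powr_mult mult.assoc)
  let ?V = "\<lambda>t. y powr s * (t powr s * U S (v + 1 / \<theta> * ln t))"
  let ?m = "\<lambda>t Q. weight S Q * min (y * t) (real Q powr \<theta>) / real Q"
  have "((\<lambda>Q. ?m (1 + h) Q + ?m (1 - h) Q + (- 2) * ?m 1 Q) has_sum (?V (1 + h) + ?V (1 - h) + (- 2) * ?V 1)) (smooth_nats S)"
    by (intro has_sum_add has_sum_cmult_right sm) (use h in auto)
  moreover have "((\<lambda>Q. if Q = Q0 then - (weight S Q0 * h * y / real Q0) else 0) has_sum
      - (weight S Q0 * h * y / real Q0)) (smooth_nats S)"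
    by (rule has_sum_finite_neutralI[of "{Q0}"]) (use Q0 in auto)
  ultimately have "?V (1 + h) + ?V (1 - h) + (- 2) * ?V 1 \<le> - (weight S Q0 * h * y / real Q0)"
  proof (rule has_sum_mono)
    fix Q assume "Q \<in> smooth_nats S"
    then have Q: "Q > 0" by (simp add: smooth_nats_def)
    define z where "z = real Q powr \<theta>"
    have hy: "h * y > 0" using h y by simp
    \<comment> \<open>The bracket is the second difference of the concave map
      \<open>y \<mapsto> min y z\<close>. It is never positive, and at the kink \<open>z = y\<close>
      it equals \<open>- (h * y)\<close>.\<close>
    have eq: "?m (1 + h) Q + ?m (1 - h) Q + (- 2) * ?m 1 Q
        = weight S Q / real Q * (min (y + h * y) z + min (y - h * y) z - 2 * min y z)"
      by (simp add: z_def algebra_simps add_divide_distrib diff_divide_distrib)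
    have wn: "weight S Q / real Q \<ge> 0" using weight_nonneg[of S Q] by simp
    show "?m (1 + h) Q + ?m (1 - h) Q + (- 2) * ?m 1 Q \<le> (if Q = Q0 then - (weight S Q0 * h * y / real Q0) else 0)"
    proof (cases "Q = Q0")
      case True
      then have "min (y + h * y) z + min (y - h * y) z - 2 * min y z = - (h * y)"
        using hy by (simp add: z_def y_def)
      then show ?thesis unfolding eq using True by simp
    next
      case False
      have "min (y + h * y) z + min (y - h * y) z - 2 * min y z \<le> 0" using hy by linarith
      then have "weight S Q / real Q * (min (y + h * y) z + min (y - h * y) z - 2 * min y z) \<le> 0"
        using wn by (rule mult_nonneg_nonpos[rotated])
      then show ?thesis unfolding eq using False by simp
    qed
  qed
  moreover have "?V (1 + h) + ?V (1 - h) + (- 2) * ?V 1 = y powr s * ((1 + h) powr s * U S (v + 1 / \<theta> * ln (1 + h))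
      + (1 - h) powr s * U S (v + 1 / \<theta> * ln (1 - h)) - 2 * U S v)"
    by (simp add: algebra_simps)
  \<comment> \<open>Because \<open>Q0 = y powr (1 / \<theta>)\<close>, the kink carries the same
    factor \<open>y powr s\<close> as the other terms, and this factor cancels.\<close>
  moreover have "y / real Q0 = y powr s"
  proof -
    have "y powr s = real Q0 powr (\<theta> - 1)"
      using theta by (simp add: y_def s_def powr_powr right_diff_distrib)
    also have "\<dots> = y / real Q0" using q by (simp add: y_def powr_diff)
    finally show ?thesis by simp
  qed
  then have "weight S Q0 * h * y / real Q0 = y powr s * (weight S Q0 * h)"
    by (metis (no_types, lifting) mult.commute times_divide_eq_right)
  ultimately have "y powr s * ((1 + h) powr s * U S (v + 1 / \<theta> * ln (1 + h))
      + (1 - h) powr s * U S (v + 1 / \<theta> * ln (1 - h)) - 2 * U S v) \<le> y powr s * (- (weight S Q0 * h))"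
    by simp
  then show ?thesis by (rule mult_left_le_imp_le) (use y in simp)
qed

text \<open>Along smooth numbers of bounded-below weight, \<open>U_second_difference\<close> passes
  to the limit as \<open>L * ((1 + h) powr s + (1 - h) powr s - 2) \<le> - (\<alpha> * h)\<close>
  with \<alpha> > 0. The left side is quadratic in \<open>h\<close> near 0, which contradicts the
  linear bound.\<close>

lemma U_not_convergent:
  assumes p: "p \<in> S" "w p > 0" and lim: "(U S \<longlongrightarrow> L) at_top"
  shows False
proof -
  obtain e where e: "\<And>q. q \<in> S \<Longrightarrow> a q (e q) > 0" using a_pos by metis
  \<comment> \<open>Only the exponent of \<open>p\<close> grows; the others stay at values of
    positive weight, so that the total weight is eventually the positive constant \<alpha>.\<close>
  define Q where "Q k = (\<Prod>q\<in>S. q ^ (if q = p then k else e q))" for k :: nat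
  define \<alpha> where "\<alpha> = w p * (\<Prod>q\<in>S - {p}. a q (e q))"
  have alpha: "\<alpha> > 0" using p e by (auto simp: \<alpha>_def intro!: mult_pos_pos prod_pos)
  have Qs: "Q k \<in> smooth_nats S" for k unfolding Q_def by (rule prime_power_prod_smooth[OF fin primes])
  have wt: "weight S (Q k) = a p k * (\<Prod>q\<in>S - {p}. a q (e q))" for k
  proof -
    have "weight S (Q k) = (\<Prod>q\<in>S. a q (if q = p then k else e q))"
      unfolding weight_def Q_def
      by (intro prod.cong refl) (simp only: multiplicity_prime_power_prod[OF fin primes])
    also have "\<dots> = a p k * (\<Prod>q\<in>S - {p}. a q (if q = p then k else e q))"
      using prod.remove[OF fin p(1), of "\<lambda>q. a q (if q = p then k else e q)"] by simp
    finally show ?thesis by simp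
  qed
  have wt_ev: "\<forall>\<^sub>F k in sequentially. weight S (Q k) = \<alpha>"
    using a_ev[OF p(1)] by eventually_elim (simp add: wt \<alpha>_def)
  have Qk: "2 ^ k \<le> Q k" for k
  proof -
    have "p > 1" using p primes prime_gt_1_nat by blast
    then have "2 ^ k \<le> p ^ k" by (intro power_mono) auto
    moreover have "p ^ k dvd Q k"
      using dvd_prodI[OF fin p(1), of "\<lambda>q. q ^ (if q = p then k else e q)"] by (simp add: Q_def)
    then have "p ^ k \<le> Q k" using Qs[of k] by (intro dvd_imp_le) (auto simp: smooth_nats_def)
    ultimately show ?thesis by linarith
  qed
  have ln_top: "filterlim (\<lambda>k. ln (real (Q k))) at_top sequentially"
  proof (rule filterlim_at_top_mono)
    show "filterlim (\<lambda>k::nat. real k * ln 2) at_top sequentially" by real_asymp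
    have "real k * ln 2 \<le> ln (real (Q k))" for k
    proof -
      have "real (2 ^ k) \<le> real (Q k)" using Qk of_nat_le_iff by blast
      then have "ln (real (2 ^ k)) \<le> ln (real (Q k))" by (intro ln_mono) auto
      then show ?thesis by (simp add: ln_realpow)
    qed
    then show "\<forall>\<^sub>F k in sequentially. real k * ln 2 \<le> ln (real (Q k))" by simp
  qed
  define s where "s = 1 - 1 / \<theta>"
  have key: "L * ((1 + h) powr s + (1 - h) powr s - 2) \<le> - (\<alpha> * h)" if h: "0 < h" "h < 1" for h
  proof (rule tendsto_le[OF trivial_limit_sequentially])
    have shift: "(\<lambda>k. U S (ln (real (Q k)) + c)) \<longlonglongrightarrow> L" for c
      using filterlim_compose[OF lim filterlim_tendsto_add_at_top[OF tendsto_const ln_top]]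
      by (simp add: add.commute)
    have "(\<lambda>k. (1 + h) powr s * U S (ln (real (Q k)) + 1 / \<theta> * ln (1 + h))
        + (1 - h) powr s * U S (ln (real (Q k)) + 1 / \<theta> * ln (1 - h)) - 2 * U S (ln (real (Q k)) + 0))
        \<longlonglongrightarrow> (1 + h) powr s * L + (1 - h) powr s * L - 2 * L"
      by (intro tendsto_intros shift)
    then show "(\<lambda>k. (1 + h) powr s * U S (ln (real (Q k)) + 1 / \<theta> * ln (1 + h))
        + (1 - h) powr s * U S (ln (real (Q k)) + 1 / \<theta> * ln (1 - h)) - 2 * U S (ln (real (Q k))))
        \<longlonglongrightarrow> L * ((1 + h) powr s + (1 - h) powr s - 2)"
      by (simp add: algebra_simps)
    show "(\<lambda>k. - (\<alpha> * h)) \<longlonglongrightarrow> - (\<alpha> * h)" by (rule tendsto_const)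
    show "\<forall>\<^sub>F k in sequentially. (1 + h) powr s * U S (ln (real (Q k)) + 1 / \<theta> * ln (1 + h))
        + (1 - h) powr s * U S (ln (real (Q k)) + 1 / \<theta> * ln (1 - h)) - 2 * U S (ln (real (Q k))) \<le> - (\<alpha> * h)"
      using wt_ev
    proof eventually_elim
      case (elim k)
      show ?case using U_second_difference[OF Qs[of k] h] unfolding elim s_def .
    qed
  qed
  have "L * 0 \<le> - \<alpha>"
  proof (rule tendsto_le)
    show "at_right (0::real) \<noteq> bot" by simp
    have "((\<lambda>h. ((1 + h) powr s + (1 - h) powr s - 2) / h) \<longlongrightarrow> 0) (at_right 0)" by real_asymp
    then show "((\<lambda>h. L * (((1 + h) powr s + (1 - h) powr s - 2) / h)) \<longlongrightarrow> L * 0) (at_right 0)"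
      by (rule tendsto_mult_left)
    show "((\<lambda>h. - \<alpha>) \<longlongrightarrow> - \<alpha>) (at_right 0)" by (rule tendsto_const)
    have "\<forall>\<^sub>F h in at_right 0. (0::real) < h \<and> h < 1"
      by (rule eventually_at_right_real[of 0 1, simplified, THEN eventually_mono]) auto
    then show "\<forall>\<^sub>F h in at_right 0. L * (((1 + h) powr s + (1 - h) powr s - 2) / h) \<le> - \<alpha>"
    proof eventually_elim
      case (elim h)
      then have "L * ((1 + h) powr s + (1 - h) powr s - 2) / h \<le> - (\<alpha> * h) / h"
        using key[of h] by (intro divide_right_mono) auto
      then show ?case using elim by simp
    qed
  qed
  then show False using alpha by simp
qed

end

section \<open>Asymptotics of the count\<close>

lemma powr_le_iff_le_powr:
  fixes t q b :: real
  assumes "t \<ge> 0" "q > 0" "b > 0"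
  shows "t powr b \<le> q \<longleftrightarrow> t \<le> q powr (1 / b)"
proof
  assume "t powr b \<le> q"
  then have "(t powr b) powr (1 / b) \<le> q powr (1 / b)" using assms by (intro powr_mono2) auto
  then show "t \<le> q powr (1 / b)" using assms by (simp add: powr_powr)
next
  assume "t \<le> q powr (1 / b)"
  then have "t powr b \<le> (q powr (1 / b)) powr b" using assms by (intro powr_mono2) auto
  then show "t powr b \<le> q" using assms by (simp add: powr_powr)
qed

context S_part_count
begin

text \<open>The counting problem with |f(x)|^\<epsilon> replaced by
  \<open>c * \<bar>x\<bar> powr \<beta>\<close> while the S-part is kept. For a fixed S-part the
  inequality then merely restricts \<open>x\<close> to a symmetric interval.\<close>

definition threshold_set :: "real \<Rightarrow> real \<Rightarrow> int set" where
  "threshold_set c B = {x. \<bar>real_of_int x\<bar> \<le> B \<and> poly f x \<noteq> 0 \<and> c * \<bar>real_of_int x\<bar> powr \<beta> \<le> real (E x)}"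

lemma finite_threshold_set: "finite (threshold_set c B)"
  by (rule finite_subset[OF _ finite_int_abs_le[of B]]) (auto simp: threshold_set_def)

lemma threshold_set_level:
  assumes "c > 0" "Q > 0"
  shows "{x \<in> threshold_set c B. E x = Q} = level Q (min B ((real Q / c) powr (1 / \<beta>)))"
proof -
  have "c * \<bar>real_of_int x\<bar> powr \<beta> \<le> real Q \<longleftrightarrow> \<bar>real_of_int x\<bar> \<le> (real Q / c) powr (1 / \<beta>)" for x :: int
    using powr_le_iff_le_powr[of "\<bar>real_of_int x\<bar>" "real Q / c" \<beta>] assms beta
    by (simp add: field_simps)
  then show ?thesis by (auto simp: threshold_set_def level_def)
qed

text \<open>Three errors of order \<open>B powr \<eta>\<close>: a bounded one for each smooth
  \<open>Q \<le> B\<close>, the integers with S-part above \<open>B\<close>, and the tail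
  \<open>Q > B\<close> of the main series. The constant does not depend on \<open>c\<close>, so one
  constant serves both sides of the sandwich.\<close>

lemma threshold_count:
  assumes eta: "0 < \<eta>" "\<eta> \<le> 1"
  shows "\<exists>C\<ge>0. \<forall>c>0. \<forall>B\<ge>1. \<bar>real (card (threshold_set c B)) - 2 * (B powr (1 - \<beta>) / c * U S (ln c + \<beta> * ln B))\<bar>
     \<le> C * B powr \<eta>"
proof -
  obtain C1 where C1: "C1 \<ge> 0" "\<And>Q Y. Q \<in> smooth_nats S \<Longrightarrow> Y \<ge> 0 \<Longrightarrow>
      \<bar>real (card (level Q Y)) - 2 * Y * weight S Q / real Q\<bar> \<le> C1"
    using level_count by blast
  obtain C2 where C2: "C2 \<ge> 0" "\<And>B. B \<ge> 1 \<Longrightarrow>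
      real (card {x. \<bar>real_of_int x\<bar> \<le> B \<and> poly f x \<noteq> 0 \<and> real (E x) > B}) \<le> C2 * B powr \<eta>"
    using large_S_part_count[OF eta(1)] by blast
  obtain A where A: "A \<ge> 0" "\<And>Q. weight S Q \<le> A" using weight_bounded[of S] by auto
  define Z where "Z = infsum (\<lambda>Q. real Q powr - \<eta>) (smooth_nats S)"
  have Z: "Z \<ge> 0" unfolding Z_def by (rule infsum_nonneg) simp
  have "\<bar>real (card (threshold_set c B)) - 2 * (B powr (1 - \<beta>) / c * U S (ln c + \<beta> * ln B))\<bar>
      \<le> (C1 * Z + C2 + 2 * A * Z) * B powr \<eta>" if c: "c > 0" and B: "B \<ge> 1" for c B
  proof -
    define Y where "Y Q = min B ((real Q / c) powr (1 / \<beta>))" for Q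
    define F where "F = {Q\<in>smooth_nats S. real Q \<le> B}"
    define m where "m Q = 2 * (weight S Q * Y Q / real Q)" for Q
    define Main where "Main = 2 * (B powr (1 - \<beta>) / c * U S (ln c + \<beta> * ln B))"
    have Y: "0 \<le> Y Q" "Y Q \<le> B" for Q using B by (auto simp: Y_def)
    have m0: "m Q \<ge> 0" for Q using Y(1)[of Q] weight_nonneg[of S Q] by (simp add: m_def)
    have finF: "finite F" and cardF: "real (card F) \<le> B powr \<eta> * Z"
      unfolding F_def Z_def using card_smooth_nats_le[OF finS primeS eta(1), of B] B by auto
    let ?Lg = "{x \<in> threshold_set c B. real (E x) > B}"
    have thr: "threshold_set c B = (\<Union>Q\<in>F. level Q (Y Q)) \<union> ?Lg"
    proof -
      have "(\<Union>Q\<in>F. level Q (Y Q)) = (\<Union>Q\<in>F. {x \<in> threshold_set c B. E x = Q})"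
        unfolding Y_def by (intro SUP_cong refl threshold_set_level[OF c, symmetric]) (auto simp: F_def smooth_nats_def)
      also have "\<dots> = {x \<in> threshold_set c B. real (E x) \<le> B}"
        using S_part_smooth[OF finS primeS] by (auto simp: F_def)
      finally show ?thesis by auto
    qed
    have fin_lev: "finite (level Q (Y Q))" for Q
      by (rule finite_subset[OF _ finite_int_abs_le[of "Y Q"]]) (auto simp: level_def)
    have finU: "finite (\<Union>Q\<in>F. level Q (Y Q))" using finF fin_lev by blast
    have finL: "finite ?Lg" using finite_threshold_set[of c B] by simp
    have "card ((\<Union>Q\<in>F. level Q (Y Q)) \<union> ?Lg) = card (\<Union>Q\<in>F. level Q (Y Q)) + card ?Lg"
      by (rule card_Un_disjoint[OF finU finL]) (auto simp: F_def level_def)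
    moreover have "card (\<Union>Q\<in>F. level Q (Y Q)) = (\<Sum>Q\<in>F. card (level Q (Y Q)))"
      by (rule card_UN_disjoint) (use finF fin_lev in \<open>auto simp: level_def\<close>)
    ultimately have card_thr: "real (card (threshold_set c B)) = (\<Sum>Q\<in>F. real (card (level Q (Y Q)))) + real (card ?Lg)"
      using thr by simp
    have "\<bar>(\<Sum>Q\<in>F. real (card (level Q (Y Q)))) - (\<Sum>Q\<in>F. m Q)\<bar> \<le> (\<Sum>Q\<in>F. \<bar>real (card (level Q (Y Q))) - m Q\<bar>)"
      unfolding sum_subtractf[symmetric] by (rule sum_abs)
    also have "\<dots> \<le> (\<Sum>Q\<in>F. C1)"
    proof (rule sum_mono)
      fix Q assume "Q \<in> F"
      then have "\<bar>real (card (level Q (Y Q))) - 2 * Y Q * weight S Q / real Q\<bar> \<le> C1"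
        using C1(2) Y by (auto simp: F_def)
      then show "\<bar>real (card (level Q (Y Q))) - m Q\<bar> \<le> C1" by (simp add: m_def mult_ac)
    qed
    also have "\<dots> = C1 * real (card F)" by simp
    also have "\<dots> \<le> C1 * (B powr \<eta> * Z)" using cardF C1(1) by (rule mult_left_mono)
    finally have 1: "\<bar>(\<Sum>Q\<in>F. real (card (level Q (Y Q)))) - (\<Sum>Q\<in>F. m Q)\<bar> \<le> C1 * Z * B powr \<eta>"
      by (simp add: mult_ac)
    have "card ?Lg \<le> card {x. \<bar>real_of_int x\<bar> \<le> B \<and> poly f x \<noteq> 0 \<and> real (E x) > B}"
      by (rule card_mono[OF finite_subset[OF _ finite_int_abs_le[of B]]]) (auto simp: threshold_set_def)
    then have 2: "real (card ?Lg) \<le> C2 * B powr \<eta>" using C2(2)[OF B] by linarith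
    have hs: "(m has_sum Main) (smooth_nats S)"
      using has_sum_cmult_right[OF truncated_sum[of B c], of 2] B c unfolding m_def Y_def Main_def by simp
    have 3: "(\<Sum>Q\<in>F. m Q) \<le> Main"
      by (rule finite_sum_le_has_sum[OF hs finF]) (use m0 in \<open>auto simp: F_def\<close>)
    have "((\<lambda>Q. (if Q \<in> F then m Q else 0) + 2 * A * B powr \<eta> * real Q powr - \<eta>) has_sum ((\<Sum>Q\<in>F. m Q) + 2 * A * B powr \<eta> * Z)) (smooth_nats S)"
    proof (rule has_sum_add)
      show "((\<lambda>Q. if Q \<in> F then m Q else 0) has_sum (\<Sum>Q\<in>F. m Q)) (smooth_nats S)"
        by (rule has_sum_finite_neutralI[OF finF]) (auto simp: F_def)
      show "((\<lambda>Q. 2 * A * B powr \<eta> * real Q powr - \<eta>) has_sum 2 * A * B powr \<eta> * Z) (smooth_nats S)"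
        unfolding Z_def by (rule has_sum_cmult_right[OF has_sum_infsum[OF summable_smooth_nats_powr[OF finS primeS eta(1)]]])
    qed
    then have 4: "Main \<le> (\<Sum>Q\<in>F. m Q) + 2 * A * B powr \<eta> * Z"
    proof (rule has_sum_mono[OF hs])
      fix Q assume Q: "Q \<in> smooth_nats S"
      then have Q0: "Q > 0" by (simp add: smooth_nats_def)
      show "m Q \<le> (if Q \<in> F then m Q else 0) + 2 * A * B powr \<eta> * real Q powr - \<eta>"
      proof (cases "Q \<in> F")
        case True then show ?thesis using A(1) by simp
      next
        case False
        then have BQ: "B \<le> real Q" using Q by (simp add: F_def)
        have "m Q \<le> 2 * (A * B / real Q)"
          unfolding m_def using A Y weight_nonneg[of S Q]
          by (intro mult_left_mono divide_right_mono mult_mono) auto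
        \<comment> \<open>Rankin's trick for the tail: write \<open>B\<close> as
          \<open>B powr \<eta> * B powr (1 - \<eta>)\<close> and enlarge the second factor using
          \<open>B \<le> Q\<close> and \<open>\<eta> \<le> 1\<close>.\<close>
        also have "B / real Q \<le> B powr \<eta> * real Q powr - \<eta>"
        proof -
          have "B powr (1 - \<eta>) \<le> real Q powr (1 - \<eta>)" using BQ B eta by (intro powr_mono2) auto
          then have "B powr \<eta> * B powr (1 - \<eta>) * real Q powr - 1 \<le> B powr \<eta> * real Q powr (1 - \<eta>) * real Q powr - 1"
            by (intro mult_right_mono mult_left_mono) auto
          also have "B powr \<eta> * B powr (1 - \<eta>) = B" using B by (simp add: powr_add[symmetric])
          also have "B powr \<eta> * real Q powr (1 - \<eta>) * real Q powr - 1 = B powr \<eta> * real Q powr - \<eta>"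
            unfolding mult.assoc by (subst powr_add[symmetric]) simp
          finally show ?thesis using Q0 by (simp add: powr_minus_divide)
        qed
        then have "2 * (A * B / real Q) \<le> 2 * (A * (B powr \<eta> * real Q powr - \<eta>))"
          using A by (simp add: times_divide_eq_right[symmetric] mult_left_mono del: times_divide_eq_right)
        finally show ?thesis using False by (simp add: mult_ac)
      qed
    qed
    have e: "(C1 * Z + C2 + 2 * A * Z) * B powr \<eta> = C1 * Z * B powr \<eta> + C2 * B powr \<eta> + 2 * A * B powr \<eta> * Z"
      by (simp add: algebra_simps)
    have nn: "0 \<le> 2 * A * B powr \<eta> * Z" "0 \<le> C2 * B powr \<eta>" "real (card ?Lg) \<ge> 0" using A Z C2 by auto
    show ?thesis
      unfolding Main_def[symmetric] card_thr e using 1 2 3 4 nn unfolding abs_le_iff by linarith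
  qed
  moreover have "C1 * Z + C2 + 2 * A * Z \<ge> 0" using A C1 C2 Z by auto
  ultimately show ?thesis by blast
qed

end

lemma int_poly_powr_growth:
  fixes f :: "int poly"
  assumes f: "f \<noteq> 0" and eps: "\<epsilon> > 0" and d: "0 < \<delta>" "\<delta> < 1"
  defines "c \<equiv> \<bar>real_of_int (Polynomial.lead_coeff f)\<bar> powr \<epsilon>" and "\<beta> \<equiv> real (Polynomial.degree f) * \<epsilon>"
  shows "\<exists>K. \<forall>x. \<bar>real_of_int x\<bar> > K \<longrightarrow>
    (1 - \<delta>) * c * \<bar>real_of_int x\<bar> powr \<beta> \<le> \<bar>real_of_int (poly f x)\<bar> powr \<epsilon> \<and>
    \<bar>real_of_int (poly f x)\<bar> powr \<epsilon> \<le> (1 + \<delta>) * c * \<bar>real_of_int x\<bar> powr \<beta>"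
proof -
  let ?n = "Polynomial.degree f"
  define F where "F = map_poly real_of_int f"
  have F: "poly F (real_of_int x) = real_of_int (poly f x)" for x
    unfolding F_def by (induction f) (simp_all add: map_poly_pCons)
  have deg: "Polynomial.degree F = ?n" unfolding F_def by (rule degree_map_poly) simp
  then have lc: "Polynomial.lead_coeff F = real_of_int (Polynomial.lead_coeff f)"
    by (simp add: F_def coeff_map_poly)
  have lc0: "\<bar>Polynomial.lead_coeff F\<bar> > 0" using f unfolding lc by simp
  have c0: "c > 0" using f by (simp add: c_def)
  have "((\<lambda>x. \<bar>poly F x / x ^ Polynomial.degree F\<bar> powr \<epsilon>) \<longlongrightarrow> \<bar>Polynomial.lead_coeff F\<bar> powr \<epsilon>) at_infinity"
    by (intro tendsto_powr tendsto_rabs poly_divide_tendsto_aux tendsto_const) (use lc0 in auto)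
  then have "((\<lambda>x. \<bar>poly F x / x ^ ?n\<bar> powr \<epsilon>) \<longlongrightarrow> c) at_infinity"
    unfolding deg unfolding lc c_def by (simp add: F_def coeff_map_poly)
  then have "\<forall>\<^sub>F x in at_infinity. dist (\<bar>poly F x / x ^ ?n\<bar> powr \<epsilon>) c < \<delta> * c"
    using d c0 by (intro tendstoD) auto
  then obtain b where b: "\<And>x. norm x \<ge> b \<Longrightarrow> dist (\<bar>poly F x / x ^ ?n\<bar> powr \<epsilon>) c < \<delta> * c"
    unfolding eventually_at_infinity by blast
  show ?thesis
  proof (intro exI allI impI)
    fix x :: int assume x: "\<bar>real_of_int x\<bar> > max b 0"
    let ?x = "real_of_int x"
    have d1: "dist (\<bar>poly F ?x / ?x ^ ?n\<bar> powr \<epsilon>) c < \<delta> * c" using x by (intro b) auto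
    have "\<bar>poly F ?x / ?x ^ ?n\<bar> powr \<epsilon> = \<bar>real_of_int (poly f x)\<bar> powr \<epsilon> / (\<bar>?x\<bar> ^ ?n) powr \<epsilon>"
      unfolding F by (simp add: abs_divide power_abs powr_divide)
    also have "(\<bar>?x\<bar> ^ ?n) powr \<epsilon> = \<bar>?x\<bar> powr \<beta>"
      using x by (simp add: \<beta>_def powr_realpow[symmetric] powr_powr)
    finally have r: "\<bar>poly F ?x / ?x ^ ?n\<bar> powr \<epsilon> = \<bar>real_of_int (poly f x)\<bar> powr \<epsilon> / \<bar>?x\<bar> powr \<beta>" .
    have p: "\<bar>?x\<bar> powr \<beta> > 0" using x by simp
    have "(1 - \<delta>) * c \<le> \<bar>real_of_int (poly f x)\<bar> powr \<epsilon> / \<bar>?x\<bar> powr \<beta>"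
      "\<bar>real_of_int (poly f x)\<bar> powr \<epsilon> / \<bar>?x\<bar> powr \<beta> \<le> (1 + \<delta>) * c"
      using d1 unfolding r dist_real_def by (auto simp: abs_less_iff algebra_simps)
    then show "(1 - \<delta>) * c * \<bar>?x\<bar> powr \<beta> \<le> \<bar>real_of_int (poly f x)\<bar> powr \<epsilon> \<and>
      \<bar>real_of_int (poly f x)\<bar> powr \<epsilon> \<le> (1 + \<delta>) * c * \<bar>?x\<bar> powr \<beta>"
      using p by (simp add: pos_le_divide_eq pos_divide_le_eq)
  qed
qed

context S_part_count
begin

text \<open>A larger constant makes the threshold harder to meet, so \<open>1 + \<delta>\<close>
  belongs to the lower bound. The additive constant counts the small \<open>x\<close> at which the
  leading term does not yet dominate.\<close>

lemma N_count_sandwich: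
  assumes eps: "\<epsilon> > 0" and beta_eq: "\<beta> = real (Polynomial.degree f) * \<epsilon>" and d: "0 < \<delta>" "\<delta> < 1"
  defines "c \<equiv> \<bar>real_of_int (Polynomial.lead_coeff f)\<bar> powr \<epsilon>"
  shows "\<exists>K\<ge>0. \<forall>B. real (card (threshold_set ((1 + \<delta>) * c) B)) \<le> real (N_count f S \<epsilon> B) + K \<and>
     real (N_count f S \<epsilon> B) \<le> real (card (threshold_set ((1 - \<delta>) * c) B)) + K"
proof -
  obtain K where K: "\<And>x. \<bar>real_of_int x\<bar> > K \<Longrightarrow>
    (1 - \<delta>) * c * \<bar>real_of_int x\<bar> powr \<beta> \<le> \<bar>real_of_int (poly f x)\<bar> powr \<epsilon> \<and>
    \<bar>real_of_int (poly f x)\<bar> powr \<epsilon> \<le> (1 + \<delta>) * c * \<bar>real_of_int x\<bar> powr \<beta>"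
    using int_poly_powr_growth[OF f0 eps d] unfolding c_def beta_eq by blast
  define A where "A B = {x::int. \<bar>real_of_int x\<bar> \<le> B
             \<and> 0 < \<bar>real_of_int (poly f x)\<bar> powr \<epsilon>
             \<and> \<bar>real_of_int (poly f x)\<bar> powr \<epsilon> \<le> real (S_part S (poly f x))}" for B
  let ?T = "{x::int. \<bar>real_of_int x\<bar> \<le> K}"
  have N: "N_count f S \<epsilon> B = card (A B)" for B by (simp add: N_count_def A_def)
  have finA: "finite (A B)" for B
    by (rule finite_subset[OF _ finite_int_abs_le[of B]]) (auto simp: A_def)
  have 1: "threshold_set ((1 + \<delta>) * c) B \<subseteq> A B \<union> ?T" for B
  proof
    fix x assume x: "x \<in> threshold_set ((1 + \<delta>) * c) B"
    then show "x \<in> A B \<union> ?T"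
      using K[of x] by (cases "\<bar>real_of_int x\<bar> \<le> K") (auto simp: threshold_set_def A_def)
  qed
  have 2: "A B \<subseteq> threshold_set ((1 - \<delta>) * c) B \<union> ?T" for B
  proof
    fix x assume x: "x \<in> A B"
    then show "x \<in> threshold_set ((1 - \<delta>) * c) B \<union> ?T"
      using K[of x] by (cases "\<bar>real_of_int x\<bar> \<le> K") (auto simp: threshold_set_def A_def)
  qed
  have "card (threshold_set ((1 + \<delta>) * c) B) \<le> card (A B) + card ?T" for B
    by (rule order_trans[OF card_mono[OF finite_UnI[OF finA finite_int_abs_le] 1] card_Un_le])
  moreover have "card (A B) \<le> card (threshold_set ((1 - \<delta>) * c) B) + card ?T" for B
    by (rule order_trans[OF card_mono[OF finite_UnI[OF finite_threshold_set finite_int_abs_le] 2] card_Un_le])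
  ultimately have "\<forall>B. real (card (threshold_set ((1 + \<delta>) * c) B)) \<le> real (N_count f S \<epsilon> B) + real (card ?T) \<and>
     real (N_count f S \<epsilon> B) \<le> real (card (threshold_set ((1 - \<delta>) * c) B)) + real (card ?T)"
    unfolding N of_nat_add[symmetric] of_nat_le_iff by blast
  then show ?thesis by (intro exI[of _ "real (card ?T)"] conjI of_nat_0_le_iff)
qed

text \<open>Multiplying \<open>c\<close> by \<open>t\<close> divides the main term by
  \<open>t\<close> and shifts the argument of \<open>U\<close> by \<open>ln t\<close>, which costs
  at most a power of \<open>t\<close> with exponent \<kappa> up to sign. Both effects together give
  the exponent \<open>k = 1 + \<kappa>\<close>.\<close>

lemma main_term_perturb:
  assumes c: "c > 0" and B: "B > 0" and d: "0 < \<delta>" "\<delta> < 1"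
  defines "M \<equiv> \<lambda>c. 2 * (B powr (1 - \<beta>) / c * U S (ln c + \<beta> * ln B))"
    and "k \<equiv> 1 + max 1 (1 / \<beta> - 1)"
  shows "(1 + \<delta>) powr - k * M c \<le> M ((1 + \<delta>) * c)"
    and "M ((1 - \<delta>) * c) \<le> (1 - \<delta>) powr - k * M c"
proof -
  define v where "v = ln c + \<beta> * ln B"
  define \<kappa> where "\<kappa> = max 1 (1 / \<beta> - 1)"
  have ll: "U S s \<le> exp (\<kappa> * \<bar>s - t\<bar>) * U S t" for s t
    unfolding \<kappa>_def by (rule log_lipschitzD[OF U_log_lipschitz]) simp
  have k: "k = 1 + \<kappa>" by (simp add: k_def \<kappa>_def)
  define X0 where "X0 = 2 * B powr (1 - \<beta>) / c"
  have X0: "X0 \<ge> 0" using c by (simp add: X0_def)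
  have Mt: "M (t * c) = X0 * (U S (v + ln t) / t)" if "t > 0" for t
    using that c by (simp add: M_def v_def X0_def ln_mult add_ac mult_ac)
  have M1: "M c = X0 * U S v" using Mt[of 1] by simp
  have p: "t powr - k = t powr - \<kappa> / t" if "t > 0" for t
  proof -
    have "- k = - \<kappa> - 1" by (simp add: k)
    then show ?thesis using that by (simp only: powr_diff) simp
  qed
  have "U S v \<le> exp (\<kappa> * \<bar>v - (v + ln (1 + \<delta>))\<bar>) * U S (v + ln (1 + \<delta>))" by (rule ll)
  also have "exp (\<kappa> * \<bar>v - (v + ln (1 + \<delta>))\<bar>) = (1 + \<delta>) powr \<kappa>"
    using d by (simp add: powr_def)
  finally have "(1 + \<delta>) powr - \<kappa> * U S v \<le> (1 + \<delta>) powr - \<kappa> * ((1 + \<delta>) powr \<kappa> * U S (v + ln (1 + \<delta>)))"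
    by (intro mult_left_mono) auto
  also have "\<dots> = U S (v + ln (1 + \<delta>))"
    using d unfolding mult.assoc[symmetric] powr_add[symmetric] by simp
  finally have "X0 * ((1 + \<delta>) powr - \<kappa> * U S v / (1 + \<delta>)) \<le> X0 * (U S (v + ln (1 + \<delta>)) / (1 + \<delta>))"
    using d X0 by (intro mult_left_mono divide_right_mono) auto
  then show "(1 + \<delta>) powr - k * M c \<le> M ((1 + \<delta>) * c)"
    using d Mt[of "1 + \<delta>"] p[of "1 + \<delta>"] by (simp add: M1 mult_ac)
  have "U S (v + ln (1 - \<delta>)) \<le> exp (\<kappa> * \<bar>(v + ln (1 - \<delta>)) - v\<bar>) * U S v" by (rule ll)
  also have "exp (\<kappa> * \<bar>(v + ln (1 - \<delta>)) - v\<bar>) = (1 - \<delta>) powr - \<kappa>"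
    using d by (simp add: powr_def)
  finally have "X0 * (U S (v + ln (1 - \<delta>)) / (1 - \<delta>)) \<le> X0 * ((1 - \<delta>) powr - \<kappa> * U S v / (1 - \<delta>))"
    using d X0 by (intro mult_left_mono divide_right_mono) auto
  then show "M ((1 - \<delta>) * c) \<le> (1 - \<delta>) powr - k * M c"
    using d Mt[of "1 - \<delta>"] p[of "1 - \<delta>"] by (simp add: M1 mult_ac)
qed

text \<open>The lower bound \<open>u\<close> keeps the main term at least of order
  \<open>B powr (1 - \<beta>)\<close>, which makes all errors relatively small even when
  \<open>U\<close> itself has no limit. This covers both parts of the theorem.\<close>

lemma N_count_asymptotics:
  assumes eps: "\<epsilon> > 0" and beta_eq: "\<beta> = real (Polynomial.degree f) * \<epsilon>"
    and u: "u > 0" "\<forall>\<^sub>F v in at_top. u \<le> U S v"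
  defines "c \<equiv> \<bar>real_of_int (Polynomial.lead_coeff f)\<bar> powr \<epsilon>"
  shows "((\<lambda>B. real (N_count f S \<epsilon> B) / (2 * (B powr (1 - \<beta>) / c * U S (ln c + \<beta> * ln B)))) \<longlongrightarrow> 1) at_top"
proof (rule tendstoI)
  fix e :: real assume e: "e > 0"
  have c: "c > 0" using f0 by (simp add: c_def)
  define M where "M c B = 2 * (B powr (1 - \<beta>) / c * U S (ln c + \<beta> * ln B))" for c B
  define k where "k = 1 + max 1 (1 / \<beta> - 1)"
  have lim: "((\<lambda>d. (1 + d) powr - k) \<longlongrightarrow> 1) (at_right (0::real))" "((\<lambda>d. (1 - d) powr - k) \<longlongrightarrow> 1) (at_right (0::real))"
    by real_asymp+
  have "\<forall>\<^sub>F d in at_right (0::real). dist ((1 + d) powr - k) 1 < e / 2"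
    by (rule tendstoD[OF lim(1) half_gt_zero[OF e]])
  moreover have "\<forall>\<^sub>F d in at_right (0::real). dist ((1 - d) powr - k) 1 < e / 2"
    by (rule tendstoD[OF lim(2) half_gt_zero[OF e]])
  moreover have "\<forall>\<^sub>F d in at_right (0::real). 0 < d \<and> d < 1"
    by (rule eventually_at_right_real[of 0 1, simplified, THEN eventually_mono]) auto
  ultimately have "\<forall>\<^sub>F d in at_right (0::real). (0 < d \<and> d < 1) \<and> dist ((1 + d) powr - k) 1 < e / 2 \<and> dist ((1 - d) powr - k) 1 < e / 2"
    by eventually_elim auto
  then obtain \<delta> :: real where d: "0 < \<delta>" "\<delta> < 1" and d1: "dist ((1 + \<delta>) powr - k) 1 < e / 2"
    and d2: "dist ((1 - \<delta>) powr - k) 1 < e / 2"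
    using eventually_happens[of _ "at_right (0::real)"] by force
  obtain K where K: "K \<ge> 0" "\<And>B. real (card (threshold_set ((1 + \<delta>) * c) B)) \<le> real (N_count f S \<epsilon> B) + K"
     "\<And>B. real (N_count f S \<epsilon> B) \<le> real (card (threshold_set ((1 - \<delta>) * c) B)) + K"
    using N_count_sandwich[OF eps beta_eq d] unfolding c_def by blast
  \<comment> \<open>An error exponent strictly between 0 and \<open>1 - \<beta>\<close>.\<close>
  define g where "g = (1 - \<beta>) / 2"
  have g: "0 < g" "g \<le> 1" "1 - \<beta> = 2 * g" using beta by (auto simp: g_def)
  obtain C where C: "C \<ge> 0" "\<And>c B. c > 0 \<Longrightarrow> B \<ge> 1 \<Longrightarrow> \<bar>real (card (threshold_set c B)) - M c B\<bar> \<le> C * B powr g"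
    using threshold_count[OF g(1,2)] unfolding M_def by blast
  \<comment> \<open>The total error \<open>C * B powr g + K\<close> relative to the lower bound
    \<open>2 * (B powr (2 * g) / c * u)\<close> of the main term.\<close>
  define err where "err B = (C * B powr - g + K * B powr - (2 * g)) * (c / (2 * u))" for B
  have "(err \<longlongrightarrow> (C * 0 + K * 0) * (c / (2 * u))) at_top"
    unfolding err_def by (intro tendsto_intros tendsto_neg_powr filterlim_ident) (use g in auto)
  then have ev_err: "\<forall>\<^sub>F B in at_top. dist (err B) 0 < e / 2" using e by (intro tendstoD) auto
  have "filterlim (\<lambda>B. ln c + \<beta> * ln B) at_top at_top"
    by (intro filterlim_tendsto_add_at_top[OF tendsto_const] filterlim_tendsto_pos_mult_at_top[OF tendsto_const] beta ln_at_top)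
  then have ev_u: "\<forall>\<^sub>F B in at_top. u \<le> U S (ln c + \<beta> * ln B)"
    by (rule eventually_compose_filterlim[OF u(2)])
  show "\<forall>\<^sub>F B in at_top. dist (real (N_count f S \<epsilon> B) / (2 * (B powr (1 - \<beta>) / c * U S (ln c + \<beta> * ln B)))) 1 < e"
    unfolding M_def[symmetric]
    using ev_err ev_u eventually_ge_at_top[of 1]
  proof eventually_elim
    case (elim B)
    have B: "B > 0" using elim by simp
    have Mu: "2 * (B powr (2 * g) / c * u) \<le> M c B"
      unfolding M_def g(3) using elim(2) c by (intro mult_left_mono) auto
    have pos: "2 * (B powr (2 * g) / c * u) > 0" using B c u by simp
    then have M0: "M c B > 0" using Mu by linarith
    have "C * B powr g + K = err B * (2 * (B powr (2 * g) / c * u))"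
    proof -
      have "err B * (2 * (B powr (2 * g) / c * u)) = (C * B powr - g + K * B powr - (2 * g)) * B powr (2 * g)"
        using c u by (simp add: err_def)
      also have "\<dots> = C * (B powr - g * B powr (2 * g)) + K * (B powr - (2 * g) * B powr (2 * g))"
        by (simp only: distrib_right mult.assoc)
      also have "\<dots> = C * B powr g + K" using B unfolding powr_add[symmetric] by simp
      finally show ?thesis by simp
    qed
    moreover have "err B \<ge> 0" using C K c u by (auto simp: err_def)
    ultimately have E: "C * B powr g + K \<le> err B * M c B" using Mu by (metis mult_left_mono)
    have "err B * M c B < e / 2 * M c B" using elim(1) M0 by (intro mult_strict_right_mono) (auto simp: dist_real_def)
    have "real (N_count f S \<epsilon> B) \<le> M ((1 - \<delta>) * c) B + C * B powr g + K"
      using K(3)[of B] C(2)[of "(1 - \<delta>) * c" B] c d elim(3) by (auto simp: abs_le_iff)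
    also have "M ((1 - \<delta>) * c) B \<le> (1 - \<delta>) powr - k * M c B"
      unfolding M_def k_def by (rule main_term_perturb(2)[OF c B d])
    also have "(1 - \<delta>) powr - k * M c B \<le> (1 + e / 2) * M c B"
    proof (rule mult_right_mono)
      show "(1 - \<delta>) powr - k \<le> 1 + e / 2" using d2 unfolding dist_real_def by linarith
    qed (use M0 in simp)
    finally have up: "real (N_count f S \<epsilon> B) < (1 + e) * M c B"
      using E \<open>err B * M c B < e / 2 * M c B\<close> by (simp add: algebra_simps)
    have "(1 - e / 2) * M c B \<le> (1 + \<delta>) powr - k * M c B"
    proof (rule mult_right_mono)
      show "1 - e / 2 \<le> (1 + \<delta>) powr - k" using d1 unfolding dist_real_def by linarith
    qed (use M0 in simp)
    also have "\<dots> \<le> M ((1 + \<delta>) * c) B"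
      unfolding M_def k_def by (rule main_term_perturb(1)[OF c B d])
    also have "\<dots> \<le> real (N_count f S \<epsilon> B) + (C * B powr g + K)"
      using K(2)[of B] C(2)[of "(1 + \<delta>) * c" B] c d elim(3) by (auto simp: abs_le_iff)
    finally have lo: "(1 - e) * M c B < real (N_count f S \<epsilon> B)"
      using E \<open>err B * M c B < e / 2 * M c B\<close> by (simp add: algebra_simps)
    have "real (N_count f S \<epsilon> B) / M c B < 1 + e" "1 - e < real (N_count f S \<epsilon> B) / M c B"
      using up lo M0 by (simp_all add: pos_divide_less_eq pos_less_divide_eq)
    then show ?case unfolding dist_real_def by linarith
  qed
qed

end

theorem theorem1:
  fixes f :: "int poly" and n s' :: nat and \<epsilon> :: real and S S' :: "nat set"
  assumes "n = Polynomial.degree f" and "n \<ge> 1"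
    and "0 < \<epsilon>" and "\<epsilon> < 1 / real n"
    and "finite S" and "\<forall>p\<in>S. prime p"
    and "S' = {p \<in> S. has_padic_root p f}" and "s' = card S'"
    and "\<forall>p\<in>S'. \<not> has_multiple_padic_root p f"
  shows
    "(s' \<ge> 2 \<longrightarrow>
        (\<exists>C>0. (\<lambda>B. real (N_count f S \<epsilon> B))
            \<sim>[at_top] (\<lambda>B. C * B powr (1 - real n * \<epsilon>) * ln B ^ (s' - 1))))
     \<and> (s' = 1 \<longrightarrow>
        (\<exists>c1>0. \<exists>c2>0. \<forall>\<^sub>F B in at_top.
            c1 * B powr (1 - real n * \<epsilon>) \<le> real (N_count f S \<epsilon> B)
            \<and> real (N_count f S \<epsilon> B) \<le> c2 * B powr (1 - real n * \<epsilon>))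
        \<and> \<not> (\<exists>L. ((\<lambda>B. real (N_count f S \<epsilon> B) / B powr (1 - real n * \<epsilon>)) \<longlongrightarrow> L) at_top))"
proof (cases "S = {}")
  \<comment> \<open>Here \<open>s' = 0\<close> and both implications are vacuous; the other case can
    then use \<open>S_part_count\<close>, which assumes a nonempty \<open>S\<close>.\<close>
  case True
  then show ?thesis using assms(7,8) by simp
next
  case False
  define \<beta> where "\<beta> = real n * \<epsilon>"
  have beta: "0 < \<beta>" "\<beta> < 1" using assms(2-4) by (auto simp: \<beta>_def field_simps)
  have f0: "f \<noteq> 0" using assms(1,2) by auto
  interpret S_part_count f S \<beta>
    by unfold_locales (use f0 False beta assms(5-7,9) in auto)
  have S'_eq: "S' = {p \<in> S. w p > 0}" using assms(7) w_pos_iff by auto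
  define c where "c = \<bar>real_of_int (Polynomial.lead_coeff f)\<bar> powr \<epsilon>"
  have c: "c > 0" using f0 by (simp add: c_def)
  define v where "v B = ln c + \<beta> * ln B" for B
  define N where "N B = real (N_count f S \<epsilon> B)" for B
  have v_top: "filterlim v at_top at_top" unfolding v_def
    by (intro filterlim_tendsto_add_at_top[OF tendsto_const] filterlim_tendsto_pos_mult_at_top[OF tendsto_const] beta ln_at_top)
  have asymp: "((\<lambda>B. N B / (2 * (B powr (1 - \<beta>) / c * U S (v B)))) \<longlongrightarrow> 1) at_top"
    if "u > 0" "\<forall>\<^sub>F v in at_top. u \<le> U S v" for u
    using N_count_asymptotics[OF assms(3) _ that] unfolding N_def v_def c_def \<beta>_def assms(1) by simp
  have U0: "U S x > 0" for x by (rule U_pos) simp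
  have i: "\<exists>C>0. N \<sim>[at_top] (\<lambda>B. C * B powr (1 - \<beta>) * ln B ^ (s' - 1))" if s2: "s' \<ge> 2"
  proof -
    define r where "r = s' - 1"
    obtain k where k: "k > 0" "((\<lambda>x. U S x / x ^ r) \<longlongrightarrow> k) at_top"
      using U_asymptotics(2)[OF S'_eq] s2 unfolding assms(8) r_def by blast
    have "\<forall>\<^sub>F x in at_top. U S x / x ^ r > k / 2"
      by (rule order_tendstoD(1)[OF k(2)]) (use k(1) in simp)
    then have "\<forall>\<^sub>F x in at_top. k / 2 \<le> U S x" using eventually_ge_at_top[of 1]
    proof eventually_elim
      case (elim x)
      have "k / 2 * 1 \<le> U S x / x ^ r * x ^ r" using elim k(1) less_imp_le[OF U0[of x]] by (intro mult_mono) auto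
      then show ?case using elim by simp
    qed
    then have as: "((\<lambda>B. N B / (2 * (B powr (1 - \<beta>) / c * U S (v B)))) \<longlongrightarrow> 1) at_top"
      using k(1) by (intro asymp[of "k / 2"]) auto
    \<comment> \<open>The product of the limits of the four factors displayed below.\<close>
    define C where "C = 1 * (2 / c) * k * \<beta> ^ r"
    have "((\<lambda>B. v B / ln B) \<longlongrightarrow> \<beta>) at_top" unfolding v_def using beta by real_asymp
    then have "((\<lambda>B. N B / (2 * (B powr (1 - \<beta>) / c * U S (v B))) * (2 / c) * (U S (v B) / v B ^ r) * (v B / ln B) ^ r) \<longlongrightarrow> C) at_top"
      unfolding C_def by (intro tendsto_intros as filterlim_compose[OF k(2) v_top])
    moreover have "\<forall>\<^sub>F B in at_top. N B / (2 * (B powr (1 - \<beta>) / c * U S (v B))) * (2 / c) * (U S (v B) / v B ^ r) * (v B / ln B) ^ r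
        = N B / (B powr (1 - \<beta>) * ln B ^ r)"
      using eventually_gt_at_top[of 1] eventually_compose_filterlim[OF eventually_gt_at_top[of 0] v_top]
    proof eventually_elim
      case (elim B)
      then show ?case using U0[of "v B"] c by (simp add: power_divide field_simps)
    qed
    ultimately have "((\<lambda>B. N B / (B powr (1 - \<beta>) * ln B ^ r)) \<longlongrightarrow> C) at_top"
      using filterlim_cong by fast
    moreover have "C > 0" using k c beta by (simp add: C_def)
    ultimately show ?thesis
      using asymp_equivI'_const[of N "\<lambda>B. B powr (1 - \<beta>) * ln B ^ r" C at_top]
      by (auto simp: mult.assoc r_def)
  qed
  have ii: "(\<exists>c1>0. \<exists>c2>0. \<forall>\<^sub>F B in at_top. c1 * B powr (1 - \<beta>) \<le> N B \<and> N B \<le> c2 * B powr (1 - \<beta>))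
      \<and> \<not> (\<exists>L. ((\<lambda>B. N B / B powr (1 - \<beta>)) \<longlongrightarrow> L) at_top)" if s1: "s' = 1"
  proof -
    obtain u1 u2 where u: "u1 > 0" "u2 > 0" and ev: "\<forall>\<^sub>F x in at_top. u1 \<le> U S x \<and> U S x \<le> u2"
      using U_asymptotics(1)[OF S'_eq] s1 unfolding assms(8) by blast
    have as: "((\<lambda>B. N B / (2 * (B powr (1 - \<beta>) / c * U S (v B)))) \<longlongrightarrow> 1) at_top"
      by (rule asymp[OF u(1)]) (use ev in \<open>auto elim: eventually_mono\<close>)
    have "\<forall>\<^sub>F B in at_top. dist (N B / (2 * (B powr (1 - \<beta>) / c * U S (v B)))) 1 < 1 / 2"
      using as by (rule tendstoD) simp
    then have "\<forall>\<^sub>F B in at_top. u1 / c * B powr (1 - \<beta>) \<le> N B \<and> N B \<le> 3 * u2 / c * B powr (1 - \<beta>)"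
      using eventually_compose_filterlim[OF ev v_top] eventually_gt_at_top[of 0]
    proof eventually_elim
      case (elim B)
      define P where "P = B powr (1 - \<beta>) / c"
      have P: "P > 0" using elim(3) c by (simp add: P_def)
      have PU: "2 * (P * U S (v B)) > 0" using P U0 by simp
      have "1 / 2 < N B / (2 * (P * U S (v B)))" "N B / (2 * (P * U S (v B))) < 3 / 2"
        using elim(1) unfolding P_def[symmetric] dist_real_def by linarith+
      then have "P * U S (v B) < N B" "N B < 3 * (P * U S (v B))"
        using PU by (simp_all add: pos_less_divide_eq pos_divide_less_eq)
      moreover have "P * u1 \<le> P * U S (v B)" "P * U S (v B) \<le> P * u2" using elim(2) P by auto
      ultimately have "P * u1 \<le> N B \<and> N B \<le> 3 * (P * u2)" by linarith
      then show ?case by (simp add: P_def mult_ac)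
    qed
    then have bounds: "\<exists>c1>0. \<exists>c2>0. \<forall>\<^sub>F B in at_top. c1 * B powr (1 - \<beta>) \<le> N B \<and> N B \<le> c2 * B powr (1 - \<beta>)"
      using u c by (intro exI[of _ "u1 / c"] conjI exI[of _ "3 * u2 / c"]) auto
    have "False" if L: "((\<lambda>B. N B / B powr (1 - \<beta>)) \<longlongrightarrow> L) at_top" for L
    proof -
      \<comment> \<open>Dividing by the quotient that tends to 1 cancels \<open>N B\<close> and
        isolates \<open>U S (v B)\<close>.\<close>
      have "((\<lambda>B. N B / B powr (1 - \<beta>) * (c / 2) / (N B / (2 * (B powr (1 - \<beta>) / c * U S (v B))))) \<longlongrightarrow> L * (c / 2) / 1) at_top"
        by (intro tendsto_intros L as) auto
      moreover have "\<forall>\<^sub>F B in at_top. N B / B powr (1 - \<beta>) * (c / 2) / (N B / (2 * (B powr (1 - \<beta>) / c * U S (v B)))) = U S (v B)"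
        using order_tendstoD(1)[OF as zero_less_one] eventually_gt_at_top[of 0]
      proof eventually_elim
        case (elim B)
        then have "N B \<noteq> 0" by auto
        then show ?case using elim c U0[of "v B"] by (simp add: field_simps)
      qed
      ultimately have UL: "((\<lambda>B. U S (v B)) \<longlongrightarrow> L * (c / 2) / 1) at_top"
        using filterlim_cong by fast
      \<comment> \<open>This map inverts \<open>v\<close>, so a limit of \<open>U S (v B)\<close> as
        \<open>B\<close> grows is a limit of \<open>U S\<close> along all reals.\<close>
      have inv: "filterlim (\<lambda>x. exp ((x - ln c) / \<beta>)) at_top at_top" using beta by real_asymp
      have "(U S \<longlongrightarrow> L * (c / 2) / 1) at_top"
        using filterlim_compose[OF UL inv] beta by (simp add: v_def)
      moreover obtain p where "p \<in> S" "w p > 0" using s1 S'_eq assms(8) by (metis (no_types, lifting) card_1_singletonE mem_Collect_eq singletonI)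
      ultimately show False using U_not_convergent by blast
    qed
    then show ?thesis using bounds by blast
  qed
  show ?thesis using i ii unfolding N_def \<beta>_def by blast
qed

end
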